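(* Let a universal constant $C>0$, a tolerance $\bar\varepsilon>0$ and a pair $(M_f,R_0)\in\mathbb{R}_+\times\mathbb{R}_{++}$ be given such that $CM_fR_0/\bar\varepsilon\ge1$. Then: (a) for any universal constant $C'>0$, RPB$(x_0,\lambda,\bar\varepsilon/2)$ with $\lambda$ satisfying $$\frac{R_0}{M_f}\le\lambda\le\frac{CR_0^2}{\bar\varepsilon}$$ is (up to a logarithmic term) $\bar\varepsilon$-optimal for any instance class $\mathcal{I}$ and scalar $\mu\in[0,C'M_f/R_0]$ such that $\mathcal{I}_\mu^u(M_f,R_0)\subseteq\mathcal{I}\subseteq\mathcal{I}_\mu(M_f,R_0)$; (b) RPB$(x_0,\lambda,\bar\varepsilon/2)$ with $\lambda$ satisfying $$\frac{\bar\varepsilon}{CM_f^2}\le\lambda\le\frac{CR_0^2}{\bar\varepsilon}$$ is $\bar\varepsilon$-optimal for any instance class $\mathcal{I}$ such that $\mathcal{I}_0^u(M_f,R_0)\subseteq\mathcal{I}\subseteq\mathcal{I}_0(M_f,R_0;C)$.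
   Context: Problem: $\phi^*:=\min\{\phi(x):=f(x)+h(x):x\in\mathbb{R}^n\}$; a $\bar\varepsilon$-solution is a point $x$ with $\phi(x)-\phi^*\le\bar\varepsilon$. Assumptions on $(f,f';h)$: (A1) $f,h:\mathbb{R}^n\to(-\infty,+\infty]$ are proper lower semicontinuous convex, $\operatorname{dom}h\subset\operatorname{dom}f$, and $f':\operatorname{dom}h\to\mathbb{R}^n$ satisfies $f'(x)\in\partial f(x)$ for all $x\in\operatorname{dom}h$; (A2) the set $X^*$ of minimizers of $\phi$ is nonempty; (A3) $h$ is $\mu$-convex (i.e. $h(\alpha z+(1-\alpha)u)\le\alpha h(z)+(1-\alpha)h(u)-\frac{\alpha(1-\alpha)\mu}{2}\|z-u\|^2$ for $z,u\in\operatorname{dom}h$, $\alpha\in[0,1]$) and $\|f'(x)\|\le M_f$ for all $x\in\operatorname{dom}h$; (A4) $|h(u)-h(v)|\le M_h\|u-v\|$ for all $u,v\in\operatorname{dom}h$. For $x_0\in\operatorname{dom}h$, $d_0:=\inf\{\|x_0-x^*\|:x^*\in X^*\}$. Instance classes (instances are pairs $(x_0,(f,f';h))$ with $x_0\in\operatorname{dom}h$; the dimension $n$ is arbitrary). $\mathcal{I}_\mu(M_f,R_0)$: all instances satisfying (A1)-(A3) (with these $M_f,\mu$) and $d_0\le R_0$. $\mathcal{I}_\mu^u(M_f,R_0)$: all instances in $\mathcal{I}_\mu(M_f,R_0)$ with $h\equiv\mu\|\cdot\|^2/2$. $\mathcal{I}_0(M_f,R_0;C)$: all instances in $\mathcal{I}_0(M_f,R_0)$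 for which there is $M_h\le CM_f$ such that $h$ satisfies (A4). Algorithm class. $\mathcal{A}(\mathcal{I},\bar\varepsilon)$ is the class of algorithms which, for a given $(x_0,(f,f';h))\in\mathcal{I}$, start from $x_0$ and generate a finite sequence $x_0,\dots,x_{J-1}$, $J\ge1$, such that: (1) $x_{J-1}$ is the only $\bar\varepsilon$-solution in $\{x_0,\dots,x_{J-1}\}$; (2) if $h$ is a quadratic function and $\nabla^2h$ is a multiple of the identity, then $x_j\in x_0+\operatorname{Lin}\{f'(x_0),\dots,f'(x_{j-1}),\nabla h(x_0),\dots,\nabla h(x_{j-1})\}$ for $j=1,\dots,J-1$ ($\operatorname{Lin}$ = linear hull). The number $J$ is the $\bar\varepsilon$-iteration complexity of the algorithm on the instance. RPB is regarded as such an algorithm through its sequence $x_0,x_1,\dots$ below, stopped at its first $\bar\varepsilon$-solution. A $\bar\varepsilon$-upper complexity bound for an algorithm with respect to $\mathcal{I}$ is an upper bound on the supremum of $J$ over instances in $\mathcal{I}$; an upper bound for some algorithm in $\mathcal{A}(\mathcal{I},\bar\varepsilon)$ is a $\bar\varepsilon$-upper complexity bound for $\mathcal{I}$. A $\bar\varepsilon$-lower complexity bound for $\mathcal{I}$ is a number that, for some instance in $\mathcal{I}$, is a lower bound on the infimum of $J$ over all algorithms in $\mathcal{A}(\mathcal{I},\bar\varepsilon)$. If $M_1,M_2$ are respectively $\bar\varepsilon$-lower and $\bar\varepsilon$-upper complexity bounds for $\mathcal{I}$ with $M_2=\mathcal{O}(M_1)$ (i.e. $M_2\le\bar cM_1$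 with a constant $\bar c$ depending only on the universal constants $C$, $C'$), then any algorithm in $\mathcal{A}(\mathcal{I},\bar\varepsilon)$ with $\bar\varepsilon$-upper complexity bound $\mathcal{O}(M_2)$ is called $\bar\varepsilon$-optimal for $\mathcal{I}$. "Up to a logarithmic term" means that $M_2=\mathcal{O}(M_1)$ is relaxed by allowing an additional factor $1+\log(\mu R_0^2/\bar\varepsilon+1)$. Method RPB$(x_0,\lambda,\delta)$ ($\lambda>0$, $\delta>0$). Set $x_0^c=\tilde x_0=x_0$, $C_1=\{x_0\}$. For $j=1,2,\dots$: let $f_j(u)=\max\{f(x)+\langle f'(x),u-x\rangle:x\in C_j\}$; let $x_j$ be the unique minimizer and $m_j$ the minimum value over $u\in\mathbb{R}^n$ of $f_j(u)+h(u)+\frac1{2\lambda}\|u-x_{j-1}^c\|^2$; let $\phi_j^\lambda:=\phi+\frac1{2\lambda}\|\cdot-x_{j-1}^c\|^2$; choose $\tilde x_j\in\operatorname{Argmin}\{\phi_j^\lambda(u):u\in\{x_j,\tilde x_{j-1}\}\}$; let $t_j:=\phi_j^\lambda(\tilde x_j)-m_j$. If $t_j\le\delta$ (serious iteration): choose any finite $C_{j+1}$ with $\{x_j\}\subset C_{j+1}\subset\{x_0,\dots,x_j\}$ and set $x_j^c=x_j$. Otherwise (null iteration): set $x_j^c=x_{j-1}^c$ and choose any $C_{j+1}$ with $A_j\cup\{x_j\}\subset C_{j+1}\subset C_j\cup\{x_j\}$, where $A_j:=\{x\in C_j:f(x)+\langle f'(x),x_j-x\rangle=f_j(x_j)\}$.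 *)

theory Defs
  imports "HOL-Analysis.Analysis"
begin

section \<open>Euclidean spaces of varying dimension\<close>

text \<open>
  The instance classes below contain instances of every dimension, so the dimension cannot be a
  type parameter. The type \<open>fseq\<close> of finitely supported real sequences carries the standard inner
  product, and Euclidean \<open>n\<close>-space is its subspace \<open>Rn n\<close> of sequences supported in \<open>{..<n}\<close>.
\<close>

typedef fseq = "{x :: nat \<Rightarrow> real. finite {i. x i \<noteq> 0}}"
  morphisms coord Abs_fseq
  by (rule exI[of _ "\<lambda>_. 0"]) simp

lemma finite_support: "finite {i. coord x i \<noteq> 0}"
  using coord[of x] by simp

lemma fseq_eqI: "(\<And>i. coord x i = coord y i) \<Longrightarrow> x = y"
  by (metis coord_inject ext)

instantiation fseq :: real_vector
begin

definition "0 = Abs_fseq (\<lambda>_. 0)"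
definition "x + y = Abs_fseq (\<lambda>i. coord x i + coord y i)"
definition "x - y = Abs_fseq (\<lambda>i. coord x i - coord y i)"
definition "- x = Abs_fseq (\<lambda>i. - coord x i)"
definition "r *\<^sub>R x = Abs_fseq (\<lambda>i. r * coord x i)"

lemma coord_zero [simp]: "coord 0 i = 0"
  by (simp add: zero_fseq_def Abs_fseq_inverse)

lemma coord_add [simp]: "coord (x + y) i = coord x i + coord y i"
proof -
  have "finite {i. coord x i + coord y i \<noteq> 0}"
    by (rule finite_subset[OF _ finite_UnI[OF finite_support[of x] finite_support[of y]]]) auto
  then show ?thesis by (simp add: plus_fseq_def Abs_fseq_inverse)
qed

lemma coord_diff [simp]: "coord (x - y) i = coord x i - coord y i"
proof -
  have "finite {i. coord x i - coord y i \<noteq> 0}"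
    by (rule finite_subset[OF _ finite_UnI[OF finite_support[of x] finite_support[of y]]]) auto
  then show ?thesis by (simp add: minus_fseq_def Abs_fseq_inverse)
qed

lemma coord_minus [simp]: "coord (- x) i = - coord x i"
  using finite_support[of x] by (simp add: uminus_fseq_def Abs_fseq_inverse)

lemma coord_scaleR [simp]: "coord (r *\<^sub>R x) i = r * coord x i"
proof -
  have "finite {i. r * coord x i \<noteq> 0}"
    by (rule finite_subset[OF _ finite_support[of x]]) auto
  then show ?thesis by (simp add: scaleR_fseq_def Abs_fseq_inverse)
qed

instance
proof
  fix x y z :: fseq and a b :: real
  show "x + y + z = x + (y + z)" "x + y = y + x" "0 + x = x" "- x + x = 0" "x - y = x + - y"
    by (rule fseq_eqI; simp)+
  show "a *\<^sub>R (x + y) = a *\<^sub>R x + a *\<^sub>R y" "(a + b) *\<^sub>R x = a *\<^sub>R x + b *\<^sub>R x"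
    "a *\<^sub>R b *\<^sub>R x = (a * b) *\<^sub>R x" "1 *\<^sub>R x = x"
    by (rule fseq_eqI; simp add: algebra_simps)+
qed

end

instantiation fseq :: real_inner
begin

definition "inner x y = (\<Sum>i | coord x i * coord y i \<noteq> 0. coord x i * coord y i)"
definition "norm (x :: fseq) = sqrt (inner x x)"
definition "sgn (x :: fseq) = x /\<^sub>R norm x"
definition "dist (x :: fseq) y = norm (x - y)"
definition "(uniformity :: (fseq \<times> fseq) filter) =
  (INF e\<in>{0<..}. principal {(x, y). dist x y < e})"
definition "open (U :: fseq set) \<longleftrightarrow> (\<forall>x\<in>U. \<forall>\<^sub>F (x', y) in uniformity. x' = x \<longrightarrow> y \<in> U)"

lemma inner_fseq_superset:
  assumes "finite A" "\<And>i. i \<notin> A \<Longrightarrow> coord x i * coord y i = 0"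
  shows "inner x y = (\<Sum>i\<in>A. coord x i * coord y i)"
  unfolding inner_fseq_def
  by (rule sum.mono_neutral_left) (use assms in auto)

instance
proof
  fix x y z :: fseq and r :: real
  show "dist x y = norm (x - y)" by (rule dist_fseq_def)
  show "sgn x = x /\<^sub>R norm x" by (rule sgn_fseq_def)
  show "norm x = sqrt (inner x x)" by (rule norm_fseq_def)
  show "(uniformity :: (fseq \<times> fseq) filter) = (INF e\<in>{0<..}. principal {(x, y). dist x y < e})"
    by (rule uniformity_fseq_def)
  show "open U \<longleftrightarrow> (\<forall>x\<in>U. \<forall>\<^sub>F (x', y) in uniformity. x' = x \<longrightarrow> y \<in> U)" for U :: "fseq set"
    by (rule open_fseq_def)
  show "inner x y = inner y x" by (simp add: inner_fseq_def mult.commute)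
  let ?A = "{i. coord x i \<noteq> 0} \<union> {i. coord y i \<noteq> 0}"
  have A: "finite ?A" using finite_support by simp
  have "inner (x + y) z = (\<Sum>i\<in>?A. coord (x + y) i * coord z i)"
    by (rule inner_fseq_superset[OF A]) auto
  moreover have "inner x z = (\<Sum>i\<in>?A. coord x i * coord z i)"
    by (rule inner_fseq_superset[OF A]) auto
  moreover have "inner y z = (\<Sum>i\<in>?A. coord y i * coord z i)"
    by (rule inner_fseq_superset[OF A]) auto
  ultimately show "inner (x + y) z = inner x z + inner y z"
    by (simp add: distrib_right sum.distrib)
  have "inner (r *\<^sub>R x) y = (\<Sum>i\<in>?A. coord (r *\<^sub>R x) i * coord y i)"
    by (rule inner_fseq_superset[OF A]) auto
  moreover have "inner x y = (\<Sum>i\<in>?A. coord x i * coord y i)"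
    by (rule inner_fseq_superset[OF A]) auto
  ultimately show "inner (r *\<^sub>R x) y = r * inner x y"
    by (simp add: sum_distrib_left mult.assoc)
  show "0 \<le> inner x x" by (simp add: inner_fseq_def sum_nonneg)
  have "inner x x = (\<Sum>i | coord x i \<noteq> 0. coord x i * coord x i)"
    by (simp add: inner_fseq_def)
  then have "inner x x = 0 \<longleftrightarrow> (\<forall>i. coord x i = 0)"
    using finite_support[of x] by (simp add: sum_nonneg_eq_0_iff)
  then show "inner x x = 0 \<longleftrightarrow> x = 0"
    by (metis coord_zero fseq_eqI)
qed

end

definition Rn :: "nat \<Rightarrow> fseq set" where
  "Rn n = {x. \<forall>i\<ge>n. coord x i = 0}"

lemma subspace_Rn: "subspace (Rn n)"
  by (auto simp: Rn_def subspace_def)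

lemma inner_Rn:
  assumes "x \<in> Rn n" shows "inner x y = (\<Sum>i<n. coord x i * coord y i)"
  by (rule inner_fseq_superset) (use assms in \<open>auto simp: Rn_def\<close>)

lemma norm_Rn:
  assumes "x \<in> Rn n" shows "norm x = sqrt (\<Sum>i<n. (coord x i)\<^sup>2)"
  by (simp add: norm_eq_sqrt_inner inner_Rn[OF assms] power2_eq_square)

lemma bij_betw_Rn: "bij_betw coord (Rn n) {x. \<forall>i\<ge>n. x i = 0}"
proof (rule bij_betw_byWitness[where f' = Abs_fseq])
  have fin: "finite {i. x i \<noteq> 0}" if "\<forall>i\<ge>n. x i = 0" for x :: "nat \<Rightarrow> real"
    by (rule finite_subset[of _ "{..<n}"]) (use that in \<open>auto simp: not_le[symmetric]\<close>)
  show "\<forall>x\<in>{x. \<forall>i\<ge>n. x i = 0}. coord (Abs_fseq x) = x"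
    "Abs_fseq ` {x. \<forall>i\<ge>n. x i = 0} \<subseteq> Rn n"
    using fin by (auto simp: Rn_def Abs_fseq_inverse)
qed (auto simp: Rn_def coord_inverse)


section \<open>Convex analysis of extended real functions on \<open>Rn n\<close>\<close>

definition edom :: "nat \<Rightarrow> (fseq \<Rightarrow> ereal) \<Rightarrow> fseq set" where
  "edom n g = {x \<in> Rn n. g x < \<infinity>}"

definition proper_on :: "nat \<Rightarrow> (fseq \<Rightarrow> ereal) \<Rightarrow> bool" where
  "proper_on n g \<longleftrightarrow> (\<forall>x\<in>Rn n. g x \<noteq> -\<infinity>) \<and> edom n g \<noteq> {}"

definition lsc_fun_on :: "nat \<Rightarrow> (fseq \<Rightarrow> ereal) \<Rightarrow> bool" where
  "lsc_fun_on n g \<longleftrightarrow> (\<forall>x\<in>Rn n. g x \<le> Liminf (at x within Rn n) g)"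

definition econvex_on :: "nat \<Rightarrow> (fseq \<Rightarrow> ereal) \<Rightarrow> bool" where
  "econvex_on n g \<longleftrightarrow> (\<forall>x\<in>Rn n. \<forall>y\<in>Rn n. \<forall>\<alpha>\<in>{0..1}.
     g (\<alpha> *\<^sub>R x + (1 - \<alpha>) *\<^sub>R y) \<le> ereal \<alpha> * g x + ereal (1 - \<alpha>) * g y)"

definition mu_convex_on :: "nat \<Rightarrow> real \<Rightarrow> (fseq \<Rightarrow> ereal) \<Rightarrow> bool" where
  "mu_convex_on n \<mu> g \<longleftrightarrow> (\<forall>z\<in>edom n g. \<forall>u\<in>edom n g. \<forall>\<alpha>\<in>{0..1}.
     g (\<alpha> *\<^sub>R z + (1 - \<alpha>) *\<^sub>R u) \<le>
       ereal \<alpha> * g z + ereal (1 - \<alpha>) * g u - ereal (\<alpha> * (1 - \<alpha>) * \<mu> / 2 * (norm (z - u))\<^sup>2))"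

definition subdifferential :: "nat \<Rightarrow> (fseq \<Rightarrow> ereal) \<Rightarrow> fseq \<Rightarrow> fseq set" where
  "subdifferential n g x = {s \<in> Rn n. \<forall>u\<in>Rn n. g x + ereal (s \<bullet> (u - x)) \<le> g u}"

definition argmin_on :: "'a set \<Rightarrow> ('a \<Rightarrow> ereal) \<Rightarrow> 'a set" where
  "argmin_on S g = {x \<in> S. \<forall>u\<in>S. g x \<le> g u}"

definition grad :: "nat \<Rightarrow> (fseq \<Rightarrow> ereal) \<Rightarrow> fseq \<Rightarrow> fseq" where
  "grad n g x = (THE s. s \<in> Rn n \<and>
     ((\<lambda>u. real_of_ereal (g u)) has_derivative (\<lambda>v. v \<bullet> s)) (at x within Rn n))"

text \<open>Quadratic functions whose Hessian is \<open>a\<close> times the identity; \<open>a = 0\<close> is included.\<close>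

definition scalar_quadratic :: "nat \<Rightarrow> (fseq \<Rightarrow> ereal) \<Rightarrow> bool" where
  "scalar_quadratic n g \<longleftrightarrow> (\<exists>a c :: real. \<exists>b\<in>Rn n. \<forall>u\<in>Rn n.
     g u = ereal (a / 2 * (norm u)\<^sup>2 + b \<bullet> u + c))"


section \<open>Instances and instance classes\<close>

text \<open>
  An instance \<open>(x\<^sub>0, (f, f'; h))\<close> together with its dimension. Only the values of \<open>f\<close> and \<open>h\<close> on
  \<open>Rn n\<close> and of \<open>f'\<close> on the domain of \<open>h\<close> are ever used.
\<close>

record problem =
  dimn :: nat
  start :: fseq
  fobj :: "fseq \<Rightarrow> ereal"
  fsub :: "fseq \<Rightarrow> fseq"
  hreg :: "fseq \<Rightarrow> ereal"

definition phi :: "problem \<Rightarrow> fseq \<Rightarrow> ereal" where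
  "phi P x = fobj P x + hreg P x"

definition phi_star :: "problem \<Rightarrow> ereal" where
  "phi_star P = (INF x\<in>Rn (dimn P). phi P x)"

definition eps_solution :: "real \<Rightarrow> problem \<Rightarrow> fseq \<Rightarrow> bool" where
  "eps_solution \<epsilon> P x \<longleftrightarrow> x \<in> Rn (dimn P) \<and> phi P x - phi_star P \<le> ereal \<epsilon>"

definition minimizers :: "problem \<Rightarrow> fseq set" where
  "minimizers P = argmin_on (Rn (dimn P)) (phi P)"

definition dist0 :: "problem \<Rightarrow> real" where
  "dist0 P = infdist (start P) (minimizers P)"

definition A1 :: "problem \<Rightarrow> bool" where
  "A1 P \<longleftrightarrow>
     (\<forall>g\<in>{fobj P, hreg P}. proper_on (dimn P) g \<and> lsc_fun_on (dimn P) g \<and> econvex_on (dimn P) g) \<and>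
     edom (dimn P) (hreg P) \<subseteq> edom (dimn P) (fobj P) \<and>
     (\<forall>x\<in>edom (dimn P) (hreg P). fsub P x \<in> subdifferential (dimn P) (fobj P) x)"

definition A2 :: "problem \<Rightarrow> bool" where
  "A2 P \<longleftrightarrow> minimizers P \<noteq> {}"

definition A3 :: "real \<Rightarrow> real \<Rightarrow> problem \<Rightarrow> bool" where
  "A3 \<mu> Mf P \<longleftrightarrow> mu_convex_on (dimn P) \<mu> (hreg P) \<and>
     (\<forall>x\<in>edom (dimn P) (hreg P). norm (fsub P x) \<le> Mf)"

definition A4 :: "real \<Rightarrow> problem \<Rightarrow> bool" where
  "A4 Mh P \<longleftrightarrow> (\<forall>u\<in>edom (dimn P) (hreg P). \<forall>v\<in>edom (dimn P) (hreg P).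
     \<bar>hreg P u - hreg P v\<bar> \<le> ereal (Mh * norm (u - v)))"

definition inst_class :: "real \<Rightarrow> real \<Rightarrow> real \<Rightarrow> problem set" where
  "inst_class \<mu> Mf R0 = {P. dimn P \<ge> 1 \<and> start P \<in> edom (dimn P) (hreg P) \<and>
     A1 P \<and> A2 P \<and> A3 \<mu> Mf P \<and> dist0 P \<le> R0}"

definition inst_class_u :: "real \<Rightarrow> real \<Rightarrow> real \<Rightarrow> problem set" where
  "inst_class_u \<mu> Mf R0 =
     {P \<in> inst_class \<mu> Mf R0. \<forall>x\<in>Rn (dimn P). hreg P x = ereal (\<mu> * (norm x)\<^sup>2 / 2)}"

definition inst_class_0_Lip :: "real \<Rightarrow> real \<Rightarrow> real \<Rightarrow> problem set" where
  "inst_class_0_Lip Mf R0 C = {P \<in> inst_class 0 Mf R0. \<exists>Mh \<le> C * Mf. A4 Mh P}"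


section \<open>Algorithms and complexity bounds\<close>

text \<open>An algorithm maps each instance to the list \<open>[x\<^sub>0, \<dots>, x\<^bsub>J-1\<^esub>]\<close>; the length is \<open>J\<close>.\<close>

type_synonym algorithm = "problem \<Rightarrow> fseq list"

definition admissible_run :: "real \<Rightarrow> problem \<Rightarrow> fseq list \<Rightarrow> bool" where
  "admissible_run \<epsilon> P xs \<longleftrightarrow>
     xs \<noteq> [] \<and> xs ! 0 = start P \<and> set xs \<subseteq> Rn (dimn P) \<and>
     (\<forall>j<length xs. eps_solution \<epsilon> P (xs ! j) \<longleftrightarrow> j = length xs - 1) \<and>
     (scalar_quadratic (dimn P) (hreg P) \<longrightarrow>
       (\<forall>j\<in>{1..<length xs}. \<exists>v\<in>span ((\<lambda>i. fsub P (xs ! i)) ` {..<j} \<union>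
                                       (\<lambda>i. grad (dimn P) (hreg P) (xs ! i)) ` {..<j}).
          xs ! j = start P + v))"

definition alg_class :: "problem set \<Rightarrow> real \<Rightarrow> algorithm set" where
  "alg_class I \<epsilon> = {alg. \<forall>P\<in>I. admissible_run \<epsilon> P (alg P)}"

definition alg_upper_bound :: "problem set \<Rightarrow> algorithm \<Rightarrow> real \<Rightarrow> bool" where
  "alg_upper_bound I alg M \<longleftrightarrow> (\<forall>P\<in>I. real (length (alg P)) \<le> M)"

definition upper_complexity_bound :: "problem set \<Rightarrow> real \<Rightarrow> real \<Rightarrow> bool" where
  "upper_complexity_bound I \<epsilon> M \<longleftrightarrow> (\<exists>alg\<in>alg_class I \<epsilon>. alg_upper_bound I alg M)"

definition lower_complexity_bound :: "problem set \<Rightarrow> real \<Rightarrow> real \<Rightarrow> bool" where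
  "lower_complexity_bound I \<epsilon> M \<longleftrightarrow>
     (\<exists>P\<in>I. \<forall>alg\<in>alg_class I \<epsilon>. M \<le> real (length (alg P)))"

text \<open>
  Optimality with the constant \<open>c\<close> hidden in the \<open>O\<close> symbols made explicit, and with an additional
  factor \<open>L\<close> allowed between the upper and the lower complexity bound (\<open>L = 1\<close> for plain
  optimality).
\<close>

definition eps_optimal :: "real \<Rightarrow> real \<Rightarrow> problem set \<Rightarrow> real \<Rightarrow> algorithm \<Rightarrow> bool" where
  "eps_optimal c L I \<epsilon> alg \<longleftrightarrow> alg \<in> alg_class I \<epsilon> \<and>
     (\<exists>M1 M2. lower_complexity_bound I \<epsilon> M1 \<and> upper_complexity_bound I \<epsilon> M2 \<and>
        M2 \<le> c * L * M1 \<and> alg_upper_bound I alg (c * M2))"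


section \<open>The relaxed proximal bundle method\<close>

definition linearization :: "problem \<Rightarrow> fseq \<Rightarrow> fseq \<Rightarrow> ereal" where
  "linearization P x u = fobj P x + ereal (fsub P x \<bullet> (u - x))"

definition bundle_model :: "problem \<Rightarrow> fseq set \<Rightarrow> fseq \<Rightarrow> ereal" where
  "bundle_model P B u = Max ((\<lambda>x. linearization P x u) ` B)"

definition prox_term :: "real \<Rightarrow> fseq \<Rightarrow> fseq \<Rightarrow> ereal" where
  "prox_term lam c u = ereal ((norm (u - c))\<^sup>2 / (2 * lam))"

text \<open>
  \<open>x\<close>, \<open>xc\<close>, \<open>xt\<close> and \<open>B\<close> are the sequences of iterates, prox-centers, points \<open>\<tilde>x\<^sub>j\<close> (the best
  points found so far) and bundles \<open>C\<^sub>j\<close>; \<open>B 0\<close> is not used.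
\<close>

definition rpb_step ::
  "problem \<Rightarrow> real \<Rightarrow> real \<Rightarrow> (nat \<Rightarrow> fseq) \<Rightarrow> (nat \<Rightarrow> fseq) \<Rightarrow> (nat \<Rightarrow> fseq) \<Rightarrow> (nat \<Rightarrow> fseq set) \<Rightarrow> nat \<Rightarrow> bool"
  where
  "rpb_step P lam \<delta> x xc xt B j \<longleftrightarrow>
     (let model = (\<lambda>u. bundle_model P (B j) u + hreg P u + prox_term lam (xc (j - 1)) u);
          phi_lam = (\<lambda>u. phi P u + prox_term lam (xc (j - 1)) u);
          m = model (x j);
          t = phi_lam (xt j) - m;
          A = {y \<in> B j. linearization P y (x j) = bundle_model P (B j) (x j)}
      in argmin_on (Rn (dimn P)) model = {x j} \<and>
         xt j \<in> argmin_on {x j, xt (j - 1)} phi_lam \<and>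
         (if t \<le> ereal \<delta>
          then {x j} \<subseteq> B (Suc j) \<and> B (Suc j) \<subseteq> x ` {0..j} \<and> xc j = x j
          else A \<union> {x j} \<subseteq> B (Suc j) \<and> B (Suc j) \<subseteq> B j \<union> {x j} \<and> xc j = xc (j - 1)))"

definition rpb_iterates :: "problem \<Rightarrow> real \<Rightarrow> real \<Rightarrow> (nat \<Rightarrow> fseq) \<Rightarrow> bool" where
  "rpb_iterates P lam \<delta> x \<longleftrightarrow> (\<exists>xc xt B.
     x 0 = start P \<and> xc 0 = start P \<and> xt 0 = start P \<and> B 1 = {start P} \<and>
     (\<forall>j\<ge>1. rpb_step P lam \<delta> x xc xt B j))"

text \<open>
  If no iterate is an \<open>\<epsilon>\<close>-solution, then the list below contains none either, so no algorithm
  producing it belongs to \<open>alg_class\<close>.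
\<close>

definition stop_at_first :: "real \<Rightarrow> problem \<Rightarrow> (nat \<Rightarrow> fseq) \<Rightarrow> fseq list" where
  "stop_at_first \<epsilon> P x = map x [0..<Suc (LEAST k. eps_solution \<epsilon> P (x k))]"

text \<open>
  The method leaves the bundles and, in case of ties, the points \<open>\<tilde>x\<^sub>j\<close> open; every way of
  making these choices gives one algorithm.
\<close>

definition rpb_algorithms :: "problem set \<Rightarrow> real \<Rightarrow> real \<Rightarrow> real \<Rightarrow> algorithm set" where
  "rpb_algorithms I \<epsilon> lam \<delta> =
     {alg. \<forall>P\<in>I. \<exists>x. rpb_iterates P lam \<delta> x \<and> alg P = stop_at_first \<epsilon> P x}"

definition rpb_eps_optimal :: "real \<Rightarrow> real \<Rightarrow> problem set \<Rightarrow> real \<Rightarrow> real \<Rightarrow> real \<Rightarrow> bool" where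
  "rpb_eps_optimal c L I \<epsilon> lam \<delta> \<longleftrightarrow>
     rpb_algorithms I \<epsilon> lam \<delta> \<noteq> {} \<and>
     (\<forall>alg\<in>rpb_algorithms I \<epsilon> lam \<delta>. eps_optimal c L I \<epsilon> alg)"

end

theory Submission
  imports Defs
begin

text \<open>
Write \<open>\<kappa> = 1/\<lambda> + \<mu>\<close> for the curvature of the proximal subproblem, \<open>\<delta> = \<epsilon>/2\<close> for the tolerance of a cycle
and \<open>z\<close> for a minimizer of \<open>\<phi>\<close> with \<open>\<parallel>x\<^sub>0 - z\<parallel> \<le> 2 R\<^sub>0\<close>. The argument matches an upper bound for the
number of iterations, obtained as (iterations per cycle) times (number of serious iterations), with
a lower bound from a worst-case instance.

Null iterations. Keeping the cuts that are active at \<open>x\<^sub>j\<close> already preserves the minimum \<open>m\<^sub>j\<close> of the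
model and its quadratic growth around \<open>x\<^sub>j\<close> (\<open>prox_model_growth\<close>). Hence a null step of length \<open>r\<close>
raises \<open>m\<close> by at least \<open>\<kappa> r\<^sup>2 / 2\<close>, while the new cut at \<open>x\<^sub>j\<close> limits the new gap to \<open>2 M r\<close>. The gaps
of one cycle therefore satisfy \<open>t' + t'\<^sup>2 / K \<le> t\<close> with \<open>K = 8 M\<^sup>2 / \<kappa>\<close> (\<open>null_gap_decrease\<close>), and \<open>1 / t\<close>
grows by a fixed multiple of \<open>1 / K\<close> at every step provided that the first gap of the cycle is
\<open>\<O>(K)\<close>. A cycle thus has \<open>\<O>(K / \<epsilon> + 1)\<close> iterations, without a logarithm. The two parameter regimes
are two reasons for such a first gap: for \<open>\<lambda> \<ge> R\<^sub>0 / M\<close> and \<open>\<mu> \<le> C' M / R\<^sub>0\<close> the distance of the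
center to \<open>z\<close> is \<open>\<O>(M / \<kappa>)\<close>, which controls the first step (\<open>start_gap_strongly_convex\<close>); for Lipschitz
\<open>h\<close> the first step has length \<open>\<O>(\<lambda> M)\<close> anyway (\<open>start_gap_Lipschitz\<close>).

Serious iterations. As long as no iterate is an \<open>\<epsilon>\<close>-solution, a serious iteration turns the squared
distance \<open>D\<close> of the center to \<open>z\<close> into some \<open>D'\<close> with \<open>(1 + \<lambda> \<mu>) D' + \<lambda> \<epsilon> \<le> D\<close>
(\<open>serious_distance_decrease\<close>). So their number is \<open>\<O>(R\<^sub>0\<^sup>2 / (\<lambda> \<epsilon>))\<close>, and for \<open>\<mu> > 0\<close> also
\<open>\<O>((\<kappa> / \<mu>) (1 + ln (1 + \<mu> R\<^sub>0\<^sup>2 / \<epsilon>)))\<close> (\<open>geometric_cycle_bound\<close>). Multiplying with the length of a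
cycle, \<open>\<lambda>\<close> cancels and \<open>Q = M\<^sup>2 R\<^sub>0\<^sup>2 / \<epsilon>\<^sup>2\<close>, respectively \<open>T = M\<^sup>2 / (\<mu> \<epsilon>)\<close> times the logarithmic factor,
remains; the limits on \<open>\<lambda>\<close> and \<open>\<mu>\<close> and \<open>C M R\<^sub>0 \<ge> \<epsilon>\<close> absorb the additive constants.

Lower bound. For \<open>f(x) = M max(max\<^sub>i x\<^sub>i, -\<tau>)\<close> on \<open>n\<close>-space, \<open>h = \<mu> \<parallel>\<cdot>\<parallel>\<^sup>2 / 2\<close> and \<open>x\<^sub>0 = 0\<close>, an oracle that
returns the first maximal coordinate discloses at most one new coordinate per call. So the \<open>j\<close>-th
iterate is supported in the first \<open>j\<close> coordinates and \<open>\<phi> \<ge> 0\<close> there for \<open>j < n\<close>, whereas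
\<open>\<phi>\<^sup>* \<le> -M \<tau> / 2\<close>. With \<open>\<tau> = 3 \<epsilon> / M\<close> the instance lies in the class for all positive \<open>n \<le> min (Q / 9) (T / 3)\<close>,
respectively \<open>n \<le> Q / 9\<close> if \<open>\<mu> = 0\<close> (\<open>lower_complexity_bound_of_class\<close>).

The bundle method generates points that a lower bound of this kind applies to because, for a
quadratic \<open>h\<close> with scalar Hessian, projecting \<open>x\<^sub>j\<close> onto \<open>x\<^sub>0\<close> plus the span of the available
subgradients and gradients leaves the cuts unchanged and decreases the rest of the model
(\<open>iterates_in_gradient_span\<close>).
\<close>


section \<open>Strong convexity of the proximal subproblem\<close>

lemma norm_sq_convex_combination:
  fixes u v c :: "'a::real_inner"
  shows "(norm (\<alpha> *\<^sub>R u + (1 - \<alpha>) *\<^sub>R v - c))\<^sup>2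
    = \<alpha> * (norm (u - c))\<^sup>2 + (1 - \<alpha>) * (norm (v - c))\<^sup>2 - \<alpha> * (1 - \<alpha>) * (norm (u - v))\<^sup>2"
proof -
  define a b where "a = u - c" and "b = v - c"
  have 1: "\<alpha> *\<^sub>R u + (1 - \<alpha>) *\<^sub>R v - c = \<alpha> *\<^sub>R a + (1 - \<alpha>) *\<^sub>R b"
    by (simp add: a_def b_def algebra_simps)
  have 2: "u - v = a - b" by (simp add: a_def b_def)
  show ?thesis
    unfolding 1 2 a_def[symmetric] b_def[symmetric]
    by (simp add: power2_norm_eq_inner inner_add_left inner_add_right inner_diff_left
        inner_diff_right inner_commute algebra_simps)
qed

text \<open>
The setting of the analysis, in a real inner product space of any dimension: \<open>D\<close> is the domain of
\<open>h\<close>, on which \<open>f\<close> and \<open>h\<close> are real-valued, and \<open>z\<close> is a minimizer of \<open>f + h\<close>.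
\<close>

locale composite_problem =
  fixes D :: "'a::real_inner set" and f h :: "'a \<Rightarrow> real" and f' :: "'a \<Rightarrow> 'a"
    and M \<mu> :: real and z :: 'a
  assumes convex_D: "convex D"
    and subgradient: "\<lbrakk>x \<in> D; u \<in> D\<rbrakk> \<Longrightarrow> f x + f' x \<bullet> (u - x) \<le> f u"
    and norm_f'_le: "x \<in> D \<Longrightarrow> norm (f' x) \<le> M"
    and h_mu_convex: "\<lbrakk>u \<in> D; v \<in> D; 0 \<le> \<alpha>; \<alpha> \<le> 1\<rbrakk> \<Longrightarrow>
      h (\<alpha> *\<^sub>R u + (1 - \<alpha>) *\<^sub>R v) \<le> \<alpha> * h u + (1 - \<alpha>) * h v - \<alpha> * (1 - \<alpha>) * \<mu> / 2 * (norm (u - v))\<^sup>2"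
    and z_mem: "z \<in> D"
    and z_min: "u \<in> D \<Longrightarrow> f z + h z \<le> f u + h u"
    and M_pos: "0 < M"
    and mu_nonneg: "0 \<le> \<mu>"
begin

definition lin :: "'a \<Rightarrow> 'a \<Rightarrow> real" where
  "lin x u = f x + f' x \<bullet> (u - x)"

definition cutting_model :: "'a set \<Rightarrow> 'a \<Rightarrow> real" where
  "cutting_model B u = Max ((\<lambda>x. lin x u) ` B)"

definition prox_model :: "real \<Rightarrow> 'a set \<Rightarrow> 'a \<Rightarrow> 'a \<Rightarrow> real" where
  "prox_model lam B c u = cutting_model B u + h u + (norm (u - c))\<^sup>2 / (2 * lam)"

definition prox_obj :: "real \<Rightarrow> 'a \<Rightarrow> 'a \<Rightarrow> real" where
  "prox_obj lam c u = f u + h u + (norm (u - c))\<^sup>2 / (2 * lam)"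

lemma inner_f'_le: "x \<in> D \<Longrightarrow> f' x \<bullet> d \<le> M * norm d"
  by (meson norm_cauchy_schwarz norm_f'_le norm_ge_zero mult_right_mono order_trans)

lemma f_lipschitz:
  assumes "x \<in> D" "u \<in> D" shows "f u - f x \<le> M * norm (u - x)"
proof -
  have "f u + f' u \<bullet> (x - u) \<le> f x" using subgradient assms by blast
  moreover have "- (f' u \<bullet> (x - u)) = f' u \<bullet> (u - x)" by (simp add: inner_diff_right)
  moreover have "f' u \<bullet> (u - x) \<le> M * norm (u - x)" using inner_f'_le assms by blast
  ultimately show ?thesis by linarith
qed

lemma lin_le_f: "x \<in> D \<Longrightarrow> u \<in> D \<Longrightarrow> lin x u \<le> f u"
  by (simp add: lin_def subgradient)

lemma f_minus_lin_le:
  assumes "x \<in> D" "u \<in> D" shows "f u - lin x u \<le> 2 * M * norm (u - x)"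
proof -
  have "f' x \<bullet> (x - u) \<le> M * norm (x - u)" using inner_f'_le assms by blast
  moreover have "f' x \<bullet> (x - u) = - (f' x \<bullet> (u - x))" by (simp add: inner_diff_right)
  moreover have "f u - f x \<le> M * norm (u - x)" using f_lipschitz assms by blast
  ultimately show ?thesis by (simp add: lin_def norm_minus_commute)
qed

lemma lin_lipschitz: "x \<in> D \<Longrightarrow> lin x u - lin x v \<le> M * norm (u - v)"
  using inner_f'_le[of x "u - v"] by (simp add: lin_def inner_diff_right)

lemma lin_le_cutting_model: "finite B \<Longrightarrow> x \<in> B \<Longrightarrow> lin x u \<le> cutting_model B u"
  by (simp add: cutting_model_def)

lemma cutting_model_leI: "finite B \<Longrightarrow> B \<noteq> {} \<Longrightarrow> (\<And>x. x \<in> B \<Longrightarrow> lin x u \<le> m) \<Longrightarrow> cutting_model B u \<le> m"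
  by (simp add: cutting_model_def)

lemma cutting_model_le_f: "finite B \<Longrightarrow> B \<noteq> {} \<Longrightarrow> B \<subseteq> D \<Longrightarrow> u \<in> D \<Longrightarrow> cutting_model B u \<le> f u"
  by (rule cutting_model_leI) (auto simp: lin_le_f subsetD)

lemma cutting_model_attained:
  assumes "finite B" "B \<noteq> {}" obtains x where "x \<in> B" "lin x u = cutting_model B u"
proof -
  have "cutting_model B u \<in> (\<lambda>x. lin x u) ` B" unfolding cutting_model_def by (rule Max_in) (use assms in auto)
  then show thesis using that by auto
qed

lemma cutting_model_lipschitz:
  assumes "finite B" "B \<noteq> {}" "B \<subseteq> D" shows "cutting_model B u - cutting_model B v \<le> M * norm (u - v)"
proof -
  obtain x where x: "x \<in> B" "lin x u = cutting_model B u" using cutting_model_attained assms by blast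
  have "lin x v \<le> cutting_model B v" using lin_le_cutting_model assms x by blast
  then show ?thesis using lin_lipschitz[of x u v] x assms by auto
qed

lemma lin_affine:
  "lin x (\<alpha> *\<^sub>R u + (1 - \<alpha>) *\<^sub>R v) = \<alpha> * lin x u + (1 - \<alpha>) * lin x v"
  by (simp add: lin_def inner_add_right inner_diff_right algebra_simps)

lemma prox_regularizer_convex:
  assumes "u \<in> D" "v \<in> D" "0 \<le> \<alpha>" "\<alpha> \<le> 1" "lam > 0"
  defines "w \<equiv> \<alpha> *\<^sub>R u + (1 - \<alpha>) *\<^sub>R v"
  shows "h w + (norm (w - c))\<^sup>2 / (2 * lam)
    \<le> \<alpha> * (h u + (norm (u - c))\<^sup>2 / (2 * lam)) + (1 - \<alpha>) * (h v + (norm (v - c))\<^sup>2 / (2 * lam))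
      - \<alpha> * (1 - \<alpha>) * (1 / lam + \<mu>) / 2 * (norm (u - v))\<^sup>2"
proof -
  have "h w \<le> \<alpha> * h u + (1 - \<alpha>) * h v - \<alpha> * (1 - \<alpha>) * \<mu> / 2 * (norm (u - v))\<^sup>2"
    unfolding w_def using h_mu_convex assms by blast
  moreover have "(norm (w - c))\<^sup>2 / (2 * lam) = \<alpha> * ((norm (u - c))\<^sup>2 / (2 * lam))
    + (1 - \<alpha>) * ((norm (v - c))\<^sup>2 / (2 * lam)) - \<alpha> * (1 - \<alpha>) * (1 / lam) / 2 * (norm (u - v))\<^sup>2"
    unfolding w_def norm_sq_convex_combination using \<open>lam > 0\<close> by (simp add: field_simps)
  moreover have "\<alpha> * (1 - \<alpha>) * (1 / lam + \<mu>) / 2 * (norm (u - v))\<^sup>2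
    = \<alpha> * (1 - \<alpha>) * (1 / lam) / 2 * (norm (u - v))\<^sup>2 + \<alpha> * (1 - \<alpha>) * \<mu> / 2 * (norm (u - v))\<^sup>2"
    by (simp only: distrib_left distrib_right add_divide_distrib)
  ultimately show ?thesis by (simp only: distrib_left)
qed

text \<open>
The key property of the bundle update. On a short segment from \<open>y\<close> towards \<open>u\<close> the inactive cuts
stay below, so there the model of \<open>B\<close> is dominated by the chord between its value at \<open>y\<close> and the
value at \<open>u\<close> of any model \<open>B'\<close> that retains the cuts active at \<open>y\<close>. Minimality of \<open>y\<close> along the segment
and the strong convexity of the remaining terms then give the growth of the model of \<open>B'\<close>.
\<close>

lemma prox_model_growth:
  assumes "finite B" "B \<noteq> {}" "B \<subseteq> D" "y \<in> D" "lam > 0"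
    and ymin: "\<And>v. v \<in> D \<Longrightarrow> prox_model lam B c y \<le> prox_model lam B c v"
    and act: "{x \<in> B. lin x y = cutting_model B y} \<subseteq> B'" and "finite B'" "u \<in> D"
  shows "prox_model lam B c y + (1 / lam + \<mu>) / 2 * (norm (u - y))\<^sup>2 \<le> prox_model lam B' c u"
proof -
  define \<kappa> where "\<kappa> = 1 / lam + \<mu>"
  define w where "w \<alpha> = \<alpha> *\<^sub>R u + (1 - \<alpha>) *\<^sub>R y" for \<alpha>
  \<comment> \<open>An active cut obeys this bound for all \<open>\<alpha>\<close>, an inactive one by continuity for small \<open>\<alpha>\<close>.\<close>
  have near: "\<forall>\<^sub>F \<alpha> in at_right 0. lin x (w \<alpha>) \<le> \<alpha> * cutting_model B' u + (1 - \<alpha>) * cutting_model B y"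
    if x: "x \<in> B" for x
  proof (cases "lin x y = cutting_model B y")
    case True
    then have "lin x u \<le> cutting_model B' u" using act x lin_le_cutting_model \<open>finite B'\<close> by blast
    then have "lin x (w \<alpha>) \<le> \<alpha> * cutting_model B' u + (1 - \<alpha>) * cutting_model B y" if "\<alpha> > 0" for \<alpha>
      using that True by (simp add: w_def lin_affine)
    then show ?thesis by (intro eventually_mono[OF eventually_at_right_less])
  next
    case False
    then have lt: "lin x y < cutting_model B y" using lin_le_cutting_model[of B x y] assms x by auto
    have "((\<lambda>\<alpha>. \<alpha> * cutting_model B' u + (1 - \<alpha>) * cutting_model B y - lin x (w \<alpha>)) \<longlongrightarrow>
        0 * cutting_model B' u + (1 - 0) * cutting_model B y - (0 * lin x u + (1 - 0) * lin x y)) (at_right 0)"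
      unfolding w_def lin_affine by (intro tendsto_intros)
    then have "\<forall>\<^sub>F \<alpha> in at_right 0. 0 < \<alpha> * cutting_model B' u + (1 - \<alpha>) * cutting_model B y - lin x (w \<alpha>)"
      by (rule order_tendstoD) (use lt in simp)
    then show ?thesis by (rule eventually_mono) simp
  qed
  have "\<forall>\<^sub>F \<alpha> in at_right 0. \<forall>x\<in>B. lin x (w \<alpha>) \<le> \<alpha> * cutting_model B' u + (1 - \<alpha>) * cutting_model B y"
    using near \<open>finite B\<close> by (simp add: eventually_ball_finite)
  moreover have "\<forall>\<^sub>F \<alpha>::real in at_right 0. 0 < \<alpha> \<and> \<alpha> < 1"
    using eventually_at_right_real[of 0 1] by simp
  ultimately have "\<forall>\<^sub>F \<alpha> in at_right 0.
      prox_model lam B c y + (1 - \<alpha>) * \<kappa> / 2 * (norm (u - y))\<^sup>2 \<le> prox_model lam B' c u"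
  proof eventually_elim
    case (elim \<alpha>)
    have wD: "w \<alpha> \<in> D" unfolding w_def
      using convexD[OF convex_D \<open>u \<in> D\<close> \<open>y \<in> D\<close>] elim by simp
    have "cutting_model B (w \<alpha>) \<le> \<alpha> * cutting_model B' u + (1 - \<alpha>) * cutting_model B y"
      using elim assms by (intro cutting_model_leI) auto
    moreover have "h (w \<alpha>) + (norm (w \<alpha> - c))\<^sup>2 / (2 * lam)
    \<le> \<alpha> * (h u + (norm (u - c))\<^sup>2 / (2 * lam)) + (1 - \<alpha>) * (h y + (norm (y - c))\<^sup>2 / (2 * lam))
      - \<alpha> * (1 - \<alpha>) * \<kappa> / 2 * (norm (u - y))\<^sup>2"
      unfolding w_def \<kappa>_def by (rule prox_regularizer_convex) (use assms elim in auto)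
    ultimately have "prox_model lam B c (w \<alpha>) \<le> \<alpha> * prox_model lam B' c u + (1 - \<alpha>) * prox_model lam B c y
      - \<alpha> * (1 - \<alpha>) * \<kappa> / 2 * (norm (u - y))\<^sup>2"
      unfolding prox_model_def by (simp add: algebra_simps)
    with ymin[OF wD] have "\<alpha> * (prox_model lam B c y + (1 - \<alpha>) * \<kappa> / 2 * (norm (u - y))\<^sup>2)
      \<le> \<alpha> * prox_model lam B' c u"
      by (simp add: algebra_simps)
    then show ?case using elim by simp
  qed
  \<comment> \<open>Dividing by \<open>\<alpha>\<close> has left a factor \<open>1 - \<alpha>\<close>, which disappears in the limit.\<close>
  moreover have "((\<lambda>\<alpha>. prox_model lam B c y + (1 - \<alpha>) * \<kappa> / 2 * (norm (u - y))\<^sup>2) \<longlongrightarrow>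
      prox_model lam B c y + (1 - 0) * \<kappa> / 2 * (norm (u - y))\<^sup>2) (at_right 0)"
    by (intro tendsto_intros) auto
  ultimately have "prox_model lam B c y + (1 - 0) * \<kappa> / 2 * (norm (u - y))\<^sup>2 \<le> prox_model lam B' c u"
    by (intro tendsto_upperbound[where F = "at_right 0"]) auto
  then show ?thesis by (simp add: \<kappa>_def)
qed

lemma prox_model_growth_self:
  assumes "finite B" "B \<noteq> {}" "B \<subseteq> D" "y \<in> D" "lam > 0"
    and "\<And>v. v \<in> D \<Longrightarrow> prox_model lam B c y \<le> prox_model lam B c v" and "u \<in> D"
  shows "prox_model lam B c y + (1 / lam + \<mu>) / 2 * (norm (u - y))\<^sup>2 \<le> prox_model lam B c u"
  using prox_model_growth[OF assms(1-6), of B] assms by auto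

lemma prox_model_le_prox_obj:
  assumes "finite B" "B \<noteq> {}" "B \<subseteq> D" "u \<in> D"
  shows "prox_model lam B c u \<le> prox_obj lam c u"
  using cutting_model_le_f[OF assms] by (simp add: prox_model_def prox_obj_def)

text \<open>
The subproblem value at \<open>u\<close> is exact up to the linearization error of any single cut, and this error
is linear in the distance to the point where the cut was taken, because
\<open>f\<close> and the cut are both Lipschitz with constant \<open>M\<close>.
\<close>

lemma prox_obj_minus_prox_model_le:
  assumes "finite B" "y \<in> B" "B \<subseteq> D" "u \<in> D"
  shows "prox_obj lam c u - prox_model lam B c u \<le> 2 * M * norm (u - y)"
proof -
  have "lin y u \<le> cutting_model B u" using lin_le_cutting_model assms by blast
  moreover have "f u - lin y u \<le> 2 * M * norm (u - y)" using f_minus_lin_le assms by blast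
  ultimately show ?thesis by (simp add: prox_model_def prox_obj_def)
qed

text \<open>
Up to an error linear in the distance to a cut, the subproblem objective is \<open>f + h\<close>, which has a
minimum, plus the proximal term, whose quadratic growth dominates the error.
\<close>

lemma prox_model_bounded_below:
  assumes "finite B" "B \<noteq> {}" "B \<subseteq> D" "lam > 0"
  shows "\<exists>m. \<forall>u\<in>D. m \<le> prox_model lam B c u"
proof -
  obtain y where y: "y \<in> B" using assms by blast
  have "f z + h z - 2 * M * norm (c - y) - 2 * M\<^sup>2 * lam \<le> prox_model lam B c u" if u: "u \<in> D" for u
  proof -
    define r where "r = norm (u - c)"
    have "prox_obj lam c u - prox_model lam B c u \<le> 2 * M * norm (u - y)"
      using prox_obj_minus_prox_model_le assms y u by blast
    moreover have "norm (u - y) \<le> r + norm (c - y)"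
      unfolding r_def by (metis norm_triangle_ineq diff_add_cancel add_diff_eq)
    then have "2 * M * norm (u - y) \<le> 2 * M * r + 2 * M * norm (c - y)"
      using M_pos by (metis mult_left_mono distrib_left less_eq_real_def mult_nonneg_nonneg zero_le_numeral)
    moreover have "0 \<le> (r - 2 * M * lam)\<^sup>2 / (2 * lam)" using assms by simp
    then have "2 * M * r \<le> r\<^sup>2 / (2 * lam) + 2 * M\<^sup>2 * lam"
      using assms by (simp add: field_simps power2_eq_square)
    ultimately show ?thesis using z_min[OF u] by (simp add: prox_obj_def r_def)
  qed
  then show ?thesis by blast
qed

end


section \<open>Null and serious iterations\<close>

definition (in composite_problem) gap :: "real \<Rightarrow> 'a set \<Rightarrow> 'a \<Rightarrow> 'a \<Rightarrow> 'a \<Rightarrow> real" where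
  "gap lam B c y u = prox_obj lam c y - prox_model lam B c u"

text \<open>
A run of the method, with real-valued quantities. The indices are shifted: step \<open>j\<close> passes from
\<open>x j\<close> to \<open>x (Suc j)\<close>, using the bundle \<open>B (Suc j)\<close> and the center \<open>xc j\<close>.
\<close>

locale bundle_run = composite_problem D f h f' M \<mu> z
  for D :: "'a::real_inner set" and f h :: "'a \<Rightarrow> real" and f' :: "'a \<Rightarrow> 'a"
    and M \<mu> :: real and z :: 'a +
  fixes lam \<delta> :: real and x xc xt :: "nat \<Rightarrow> 'a" and B :: "nat \<Rightarrow> 'a set"
  assumes lam_pos: "0 < lam" and delta_pos: "0 < \<delta>"
    and x_mem: "x j \<in> D"
    and initial: "xc 0 = x 0" "xt 0 = x 0" "B (Suc 0) = {x 0}"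
    and x_min: "v \<in> D \<Longrightarrow>
      prox_model lam (B (Suc j)) (xc j) (x (Suc j)) \<le> prox_model lam (B (Suc j)) (xc j) v"
    and xt_choice: "xt (Suc j) \<in> {x (Suc j), xt j}"
    and xt_le: "y \<in> {x (Suc j), xt j} \<Longrightarrow> prox_obj lam (xc j) (xt (Suc j)) \<le> prox_obj lam (xc j) y"
    and serious: "gap lam (B (Suc j)) (xc j) (xt (Suc j)) (x (Suc j)) \<le> \<delta> \<Longrightarrow>
      x (Suc j) \<in> B (Suc (Suc j)) \<and> B (Suc (Suc j)) \<subseteq> x ` {0..Suc j} \<and> xc (Suc j) = x (Suc j)"
    and null: "\<not> gap lam (B (Suc j)) (xc j) (xt (Suc j)) (x (Suc j)) \<le> \<delta> \<Longrightarrow>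
      {y \<in> B (Suc j). lin y (x (Suc j)) = cutting_model (B (Suc j)) (x (Suc j))} \<union> {x (Suc j)} \<subseteq> B (Suc (Suc j)) \<and>
      B (Suc (Suc j)) \<subseteq> B (Suc j) \<union> {x (Suc j)} \<and> xc (Suc j) = xc j"
begin

text \<open>
The gap \<open>t j\<close> belongs to the iterate \<open>x (Suc j)\<close>.
\<close>

definition t :: "nat \<Rightarrow> real" where
  "t j = gap lam (B (Suc j)) (xc j) (xt (Suc j)) (x (Suc j))"

definition \<kappa> :: real where "\<kappa> = 1 / lam + \<mu>"

definition K :: real where "K = 8 * M\<^sup>2 / \<kappa>"

lemma kappa_pos: "0 < \<kappa>"
  using lam_pos mu_nonneg by (simp add: \<kappa>_def add_pos_nonneg)

lemma kappa_ge: "1 / lam \<le> \<kappa>"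
  using mu_nonneg by (simp add: \<kappa>_def)

lemma K_pos: "0 < K"
  using kappa_pos M_pos by (simp add: K_def)

text \<open>
Both kinds of update keep the cut at the latest iterate. This makes the next gap proportional to the
length of the next step.
\<close>

lemma newest_in_bundle: "x j \<in> B (Suc j)"
  using initial serious null by (cases j) auto

lemma bundle_subset: "B (Suc j) \<subseteq> x ` {0..j}"
proof (induction j)
  case (Suc j)
  then have "B (Suc j) \<union> {x (Suc j)} \<subseteq> x ` {0..Suc j}"
    by (force simp: subset_iff image_iff le_Suc_eq)
  then show ?case using serious[of j] null[of j] by blast
qed (use initial in auto)

lemma bundle_props: "finite (B (Suc j))" "B (Suc j) \<noteq> {}" "B (Suc j) \<subseteq> D"
  using bundle_subset[of j] newest_in_bundle[of j] x_mem by (auto intro: finite_subset)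

lemma xt_mem_iterates: "xt j \<in> x ` {0..j}"
proof (induction j)
  case (Suc j)
  then show ?case using xt_choice[of j] by (force simp: le_Suc_eq)
qed (use initial in auto)

lemma xc_mem_iterates: "xc j \<in> x ` {0..j}"
proof (induction j)
  case (Suc j)
  then show ?case using serious[of j] null[of j] by (force simp: le_Suc_eq)
qed (use initial in auto)

lemma t_le_step: "t j \<le> 2 * M * norm (x (Suc j) - x j)"
proof -
  have "prox_obj lam (xc j) (x (Suc j)) - prox_model lam (B (Suc j)) (xc j) (x (Suc j))
      \<le> 2 * M * norm (x (Suc j) - x j)"
    by (rule prox_obj_minus_prox_model_le[OF bundle_props(1) newest_in_bundle bundle_props(3) x_mem])
  then show ?thesis using xt_le[of "x (Suc j)" j] by (simp add: t_def gap_def)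
qed

lemma prox_model_growth_step:
  assumes "u \<in> D"
  shows "prox_model lam (B (Suc j)) (xc j) (x (Suc j)) + \<kappa> / 2 * (norm (u - x (Suc j)))\<^sup>2
    \<le> prox_model lam (B (Suc j)) (xc j) u"
  unfolding \<kappa>_def by (rule prox_model_growth_self[OF bundle_props x_mem lam_pos x_min assms])

text \<open>
A null step of length \<open>r\<close> raises the model minimum by \<open>\<kappa> r\<^sup>2 / 2\<close> and hence lowers the gap by that much,
whereas the new gap is at most \<open>2 M r\<close>. Eliminating \<open>r\<close> gives the recursion, with \<open>K = 8 M\<^sup>2 / \<kappa>\<close>.
\<close>

lemma null_gap_decrease:
  assumes "\<not> t j \<le> \<delta>" "0 \<le> t (Suc j)"
  shows "t (Suc j) + (t (Suc j))\<^sup>2 / K \<le> t j"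
proof -
  let ?m = "\<lambda>i. prox_model lam (B (Suc i)) (xc i) (x (Suc i))"
  define r where "r = norm (x (Suc (Suc j)) - x (Suc j))"
  have xc: "xc (Suc j) = xc j"
    and act: "{y \<in> B (Suc j). lin y (x (Suc j)) = cutting_model (B (Suc j)) (x (Suc j))} \<subseteq> B (Suc (Suc j))"
    using null[of j] assms(1) by (auto simp: t_def)
  have grow: "?m j + \<kappa> / 2 * r\<^sup>2 \<le> ?m (Suc j)"
    using prox_model_growth[OF bundle_props x_mem lam_pos x_min act bundle_props(1) x_mem]
    by (simp add: \<kappa>_def r_def xc)
  have "prox_obj lam (xc j) (xt (Suc (Suc j))) \<le> prox_obj lam (xc j) (xt (Suc j))"
    using xt_le[of "xt (Suc j)" "Suc j"] xc by simp
  then have dec: "t (Suc j) + \<kappa> / 2 * r\<^sup>2 \<le> t j" using grow by (simp add: t_def gap_def xc)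
  have "t (Suc j) \<le> 2 * M * r" using t_le_step[of "Suc j"] by (simp add: r_def)
  then have "(t (Suc j))\<^sup>2 \<le> (2 * M * r)\<^sup>2" using assms(2) power_mono by blast
  then have "(t (Suc j))\<^sup>2 / K \<le> (2 * M * r)\<^sup>2 / K"
    using K_pos by (simp add: divide_right_mono)
  also have "\<dots> = \<kappa> / 2 * r\<^sup>2"
    using kappa_pos M_pos by (simp add: K_def power_mult_distrib field_simps power2_eq_square)
  finally show ?thesis using dec by linarith
qed

text \<open>
The growth of the model around its minimizer is compared at \<open>z\<close>. The gap test makes the model minimum
exceed \<open>f (xt) + h (xt) - \<delta>\<close>, so an excess of \<open>2 \<delta>\<close> in the objective value leaves a decrease \<open>\<delta>\<close>.
\<close>

lemma serious_distance_decrease: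
  assumes "t j \<le> \<delta>" "f z + h z + 2 * \<delta> \<le> f (xt (Suc j)) + h (xt (Suc j))"
  shows "(1 + lam * \<mu>) * (norm (xc (Suc j) - z))\<^sup>2 + 2 * lam * \<delta> \<le> (norm (xc j - z))\<^sup>2"
proof -
  let ?m = "prox_model lam (B (Suc j)) (xc j)"
  have xc: "xc (Suc j) = x (Suc j)" using serious assms(1) by (auto simp: t_def)
  have "?m (x (Suc j)) + \<kappa> / 2 * (norm (xc (Suc j) - z))\<^sup>2 \<le> ?m z"
    using prox_model_growth_step[OF z_mem] xc by (simp add: norm_minus_commute)
  also have "\<dots> \<le> prox_obj lam (xc j) z"
    by (rule prox_model_le_prox_obj[OF bundle_props z_mem])
  also have "\<dots> = f z + h z + (norm (xc j - z))\<^sup>2 / (2 * lam)"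
    by (simp add: prox_obj_def norm_minus_commute)
  finally have 1: "?m (x (Suc j)) + \<kappa> / 2 * (norm (xc (Suc j) - z))\<^sup>2
    \<le> f z + h z + (norm (xc j - z))\<^sup>2 / (2 * lam)" .
  have "0 \<le> (norm (xt (Suc j) - xc j))\<^sup>2 / (2 * lam)" using lam_pos by simp
  then have "f (xt (Suc j)) + h (xt (Suc j)) - \<delta> \<le> ?m (x (Suc j))"
    using assms(1) unfolding t_def gap_def prox_obj_def by linarith
  with 1 assms(2) have "\<delta> + \<kappa> / 2 * (norm (xc (Suc j) - z))\<^sup>2 \<le> (norm (xc j - z))\<^sup>2 / (2 * lam)"
    by linarith
  then have "2 * lam * (\<delta> + \<kappa> / 2 * (norm (xc (Suc j) - z))\<^sup>2) \<le> (norm (xc j - z))\<^sup>2"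
    using lam_pos by (simp add: field_simps)
  moreover have "2 * lam * (\<delta> + \<kappa> / 2 * (norm (xc (Suc j) - z))\<^sup>2)
    = (1 + lam * \<mu>) * (norm (xc (Suc j) - z))\<^sup>2 + 2 * lam * \<delta>"
    using lam_pos by (simp add: \<kappa>_def field_simps)
  ultimately show ?thesis by simp
qed

text \<open>
Comparing the model growth at \<open>z\<close> bounds the distance \<open>e\<close> of the new iterate to \<open>z\<close> by a quadratic
inequality, whose solution is \<open>e \<le> 4 M / \<kappa> + d\<close>. If the center is within \<open>d = \<O>(M / \<kappa>)\<close> of \<open>z\<close>, the step
from the center is therefore \<open>\<O>(M / \<kappa>)\<close> as well, and the first gap of a cycle is \<open>\<O>(K)\<close>.
\<close>

lemma start_gap_strongly_convex:
  assumes c: "xc j = x j" and d: "norm (xc j - z) \<le> d" and b: "d \<le> b * M / \<kappa>"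
  shows "t j \<le> (1 + b / 2) * K"
proof -
  define e where "e = norm (x (Suc j) - z)"
  define p where "p = 4 * M / \<kappa>"
  have d0: "0 \<le> d" using d norm_ge_zero order_trans by blast
  have p0: "0 \<le> p" using kappa_pos M_pos by (simp add: p_def)
  have e0: "0 \<le> e" by (simp add: e_def)
  let ?m = "prox_model lam (B (Suc j)) (xc j)"
  let ?r = "norm (x (Suc j) - x j)"
  have tri: "?r \<le> e + d"
    unfolding e_def using norm_triangle_ineq4[of "x (Suc j) - z" "x j - z"] c d by simp
  have "?m (x (Suc j)) + \<kappa> / 2 * e\<^sup>2 \<le> ?m z"
    using prox_model_growth_step[OF z_mem] by (simp add: e_def norm_minus_commute)
  also have "\<dots> \<le> prox_obj lam (xc j) z"
    by (rule prox_model_le_prox_obj[OF bundle_props z_mem])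
  also have "\<dots> = f z + h z + (norm (xc j - z))\<^sup>2 / (2 * lam)"
    by (simp add: prox_obj_def norm_minus_commute)
  also have "\<dots> \<le> f z + h z + d\<^sup>2 / (2 * lam)"
    using d lam_pos by (simp add: divide_right_mono power_mono)
  finally have 1: "?m (x (Suc j)) + \<kappa> / 2 * e\<^sup>2 \<le> f z + h z + d\<^sup>2 / (2 * lam)" .
  have "f (x (Suc j)) + h (x (Suc j)) \<le> prox_obj lam (xc j) (x (Suc j))"
    using lam_pos by (simp add: prox_obj_def)
  moreover have "prox_obj lam (xc j) (x (Suc j)) - ?m (x (Suc j)) \<le> 2 * M * ?r"
    by (rule prox_obj_minus_prox_model_le[OF bundle_props(1) newest_in_bundle bundle_props(3) x_mem])
  moreover have "2 * M * ?r \<le> 2 * M * (e + d)" using tri M_pos by simp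
  ultimately have "f z + h z - 2 * M * (e + d) \<le> ?m (x (Suc j))"
    using z_min[OF x_mem, of "Suc j"] by linarith
  with 1 have "\<kappa> / 2 * e\<^sup>2 \<le> 2 * M * (e + d) + d\<^sup>2 / (2 * lam)" by linarith
  also have "d\<^sup>2 / (2 * lam) \<le> \<kappa> / 2 * d\<^sup>2"
    using mult_right_mono[OF kappa_ge, of "d\<^sup>2 / 2"] by simp
  finally have "\<kappa> / 2 * e\<^sup>2 \<le> 2 * M * (e + d) + \<kappa> / 2 * d\<^sup>2" by linarith
  moreover have "2 * M * (e + d) + \<kappa> / 2 * d\<^sup>2 = \<kappa> / 2 * (p * (e + d) + d\<^sup>2)"
    using kappa_pos by (simp add: p_def field_simps)
  ultimately have "\<kappa> / 2 * e\<^sup>2 \<le> \<kappa> / 2 * (p * (e + d) + d\<^sup>2)" by simp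
  then have quad: "e\<^sup>2 \<le> p * (e + d) + d\<^sup>2" using kappa_pos by simp
  have "e \<le> p + d"
  proof (rule ccontr)
    assume "\<not> ?thesis"
    then have gt: "p + d < e" by simp
    have "0 \<le> (e - p - d) * d" "0 < (e - p - d) * e"
      using gt d0 p0 e0 by (auto intro!: mult_nonneg_nonneg mult_pos_pos)
    then show False using quad by (simp add: algebra_simps power2_eq_square)
  qed
  then have "?r \<le> 4 * M / \<kappa> + 2 * (b * M / \<kappa>)" using tri b by (simp add: p_def)
  then have "2 * M * ?r \<le> 2 * M * (4 * M / \<kappa> + 2 * (b * M / \<kappa>))" using M_pos by simp
  also have "\<dots> = (1 + b / 2) * K"
    by (simp add: K_def algebra_simps power2_eq_square add_divide_distrib)
  finally show ?thesis using t_le_step[of j] by linarith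
qed

text \<open>
If \<open>h\<close> is Lipschitz too, the cutting-plane model plus \<open>h\<close> decreases along the step by at most
\<open>(1 + b) M r\<close>, and by at least \<open>r\<^sup>2 / \<lambda>\<close> because of the growth of the subproblem; this bounds \<open>r\<close> irrespective of the distance to a minimizer.
\<close>

lemma start_gap_Lipschitz:
  assumes c: "xc j = x j" and "\<mu> = 0" "0 \<le> b"
    and Lip: "\<And>u v. u \<in> D \<Longrightarrow> v \<in> D \<Longrightarrow> h u - h v \<le> b * M * norm (u - v)"
  shows "t j \<le> (1 + b) / 4 * K"
proof -
  let ?r = "norm (x (Suc j) - x j)"
  let ?B = "B (Suc j)"
  have kap: "\<kappa> = 1 / lam" unfolding \<kappa>_def using \<open>\<mu> = 0\<close> by simp
  have "prox_model lam ?B (x j) (x (Suc j)) + \<kappa> / 2 * ?r\<^sup>2 \<le> prox_model lam ?B (x j) (x j)"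
    using prox_model_growth_step[OF x_mem, of j j] c by (simp add: norm_minus_commute)
  then have "cutting_model ?B (x (Suc j)) + h (x (Suc j)) + ?r\<^sup>2 / lam \<le> cutting_model ?B (x j) + h (x j)"
    by (simp add: prox_model_def kap)
  moreover have "cutting_model ?B (x j) - cutting_model ?B (x (Suc j)) \<le> M * ?r"
    using cutting_model_lipschitz[OF bundle_props] by (simp add: norm_minus_commute)
  moreover have "h (x j) - h (x (Suc j)) \<le> b * M * ?r"
    using Lip[OF x_mem x_mem] by (simp add: norm_minus_commute)
  ultimately have "?r\<^sup>2 / lam \<le> (1 + b) * M * ?r" by (simp add: algebra_simps)
  then have "?r * ?r \<le> ((1 + b) * M * lam) * ?r"
    using lam_pos by (simp add: field_simps power2_eq_square)
  then have "?r \<le> (1 + b) * M * lam" if "?r > 0" using that mult_right_le_imp_le by blast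
  then have 2: "2 * M * ?r \<le> 2 * M * ((1 + b) * M * lam)" if "?r > 0"
    using that M_pos by simp
  show ?thesis
  proof (cases "?r > 0")
    case True
    have "2 * M * ((1 + b) * M * lam) = (1 + b) / 4 * K"
      by (simp add: K_def kap power2_eq_square)
    then show ?thesis using 2[OF True] t_le_step[of j] by linarith
  next
    case False
    then have "t j \<le> 0" using t_le_step[of j] by simp
    also have "0 \<le> (1 + b) / 4 * K" using K_pos \<open>0 \<le> b\<close> by simp
    finally show ?thesis .
  qed
qed

text \<open>
Taking reciprocals in the recursion \<open>s + s\<^sup>2 / K \<le> t\<close> shows that the reciprocal gap increases by at least
\<open>1 / (K + s)\<close>. This is bounded away from zero by the size of the gap at the start of the cycle, which
is what avoids a logarithmic number of initial steps.
\<close>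

lemma reciprocal_gap_growth:
  assumes "\<not> t j \<le> \<delta>" "\<not> t (Suc j) \<le> \<delta>" "t j \<le> a * K"
  shows "t (Suc j) \<le> a * K" "1 / t j + 1 / ((1 + a) * K) \<le> 1 / t (Suc j)"
proof -
  define s where "s = t (Suc j)"
  have s: "0 < s" and tj: "0 < t j" using assms delta_pos by (auto simp: s_def)
  have dec: "s + s\<^sup>2 / K \<le> t j" using null_gap_decrease[OF assms(1)] s by (simp add: s_def)
  moreover have "0 \<le> s\<^sup>2 / K" using K_pos by simp
  ultimately show le: "t (Suc j) \<le> a * K" using assms(3) by (simp add: s_def)
  have "1 / t j \<le> 1 / (s + s\<^sup>2 / K)"
    using dec s tj K_pos by (intro divide_left_mono) (auto intro!: mult_pos_pos add_pos_nonneg)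
  also have "\<dots> = 1 / s - 1 / (K + s)"
  proof -
    have "s + s\<^sup>2 / K = s * (K + s) / K"
      using K_pos by (simp add: field_simps power2_eq_square)
    then show ?thesis using s K_pos by (simp add: diff_frac_eq add_pos_pos less_imp_neq[symmetric])
  qed
  also have "\<dots> \<le> 1 / s - 1 / ((1 + a) * K)"
    using le s K_pos by (simp add: s_def algebra_simps frac_le)
  finally show "1 / t j + 1 / ((1 + a) * K) \<le> 1 / t (Suc j)" by (simp add: s_def)
qed

text \<open>
The whole count, by induction along the iterations: \<open>s\<close> is the number of serious iterations so far and
\<open>n\<close> the number of null iterations since the last one. The invariant \<open>dist_inv\<close> unrolls the decrease
of the distance to \<open>z\<close>, and \<open>cycle_inv\<close> the growth of the reciprocal gap.
\<close>

lemma iteration_bound: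
  fixes a W :: real and N :: nat
  defines "W \<equiv> (1 + a) * K / \<delta> + 2"
  assumes a: "0 \<le> a"
    and start: "\<And>j. xc j = x j \<Longrightarrow> norm (xc j - z) \<le> norm (x 0 - z) \<Longrightarrow> t j \<le> a * K"
    and unsolved: "\<And>i. i \<le> N \<Longrightarrow> f z + h z + 2 * \<delta> \<le> f (x i) + h (x i)"
  shows "\<exists>s::nat. real N \<le> W * (real s + 1) \<and>
    2 * lam * \<delta> * (\<Sum>i<s. (1 + lam * \<mu>) ^ i) \<le> (norm (x 0 - z))\<^sup>2"
proof -
  define q where "q = 1 + lam * \<mu>"
  have q1: "1 \<le> q" using lam_pos mu_nonneg by (simp add: q_def)
  have aK: "0 < (1 + a) * K" using a K_pos by simp
  define dist_inv where "dist_inv j s \<longleftrightarrow>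
    q ^ s * (norm (xc j - z))\<^sup>2 + 2 * lam * \<delta> * (\<Sum>i<s. q ^ i) \<le> (norm (x 0 - z))\<^sup>2" for j s
  define cycle_inv where "cycle_inv j n \<longleftrightarrow> (n = 0 \<longrightarrow> xc j = x j) \<and>
    (n > 0 \<longrightarrow> (\<exists>i. j = Suc i \<and> \<delta> < t i \<and> t i \<le> a * K \<and> (real n - 1) / ((1 + a) * K) \<le> 1 / t i))"
    for j n
  \<comment> \<open>A gap above \<open>\<delta>\<close> has a reciprocal below \<open>1 / \<delta>\<close>, which limits the number of null iterations in a row.\<close>
  have cycle_length: "real n + 1 \<le> W" if inv: "cycle_inv j n" for j n
  proof (cases "n = 0")
    case True
    then show ?thesis using aK delta_pos by (simp add: W_def)
  next
    case False
    then obtain i where i: "\<delta> < t i" "(real n - 1) / ((1 + a) * K) \<le> 1 / t i"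
      using inv by (auto simp: cycle_inv_def)
    have "1 / t i \<le> 1 / \<delta>" using i delta_pos by (simp add: frac_le)
    then have "(real n - 1) / ((1 + a) * K) \<le> 1 / \<delta>" using i by linarith
    then show ?thesis using aK delta_pos by (simp add: W_def field_simps)
  qed
  have "\<exists>s n. real j \<le> W * real s + real n \<and> dist_inv j s \<and> cycle_inv j n" if "j \<le> N" for j
    using that
  proof (induction j)
    case 0
    show ?case
      by (rule exI[of _ 0], rule exI[of _ 0]) (simp add: dist_inv_def cycle_inv_def initial)
  next
    case (Suc j)
    then obtain s n where IH: "real j \<le> W * real s + real n" "dist_inv j s" "cycle_inv j n" by auto
    show ?case
    proof (cases "t j \<le> \<delta>")
      case True
      have "f z + h z + 2 * \<delta> \<le> f (xt (Suc j)) + h (xt (Suc j))"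
        using xt_mem_iterates[of "Suc j"] unsolved Suc.prems by auto
      then have dec: "q * (norm (xc (Suc j) - z))\<^sup>2 + 2 * lam * \<delta> \<le> (norm (xc j - z))\<^sup>2"
        using serious_distance_decrease[OF True] by (simp add: q_def)
      have "q ^ Suc s * (norm (xc (Suc j) - z))\<^sup>2 + 2 * lam * \<delta> * (\<Sum>i<Suc s. q ^ i)
        = q ^ s * (q * (norm (xc (Suc j) - z))\<^sup>2 + 2 * lam * \<delta>) + 2 * lam * \<delta> * (\<Sum>i<s. q ^ i)"
        by (simp add: algebra_simps)
      also have "\<dots> \<le> q ^ s * (norm (xc j - z))\<^sup>2 + 2 * lam * \<delta> * (\<Sum>i<s. q ^ i)"
        using mult_left_mono[OF dec, of "q ^ s"] q1 by simp
      finally have "dist_inv (Suc j) (Suc s)" using IH(2) by (simp add: dist_inv_def)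
      moreover have "real (Suc j) \<le> W * real (Suc s) + real 0"
        using IH(1) cycle_length[OF IH(3)] by (simp add: algebra_simps)
      moreover have "cycle_inv (Suc j) 0"
        using serious[of j] True by (simp add: cycle_inv_def t_def)
      ultimately show ?thesis by blast
    next
      case False
      have xc: "xc (Suc j) = xc j" using null[of j] False by (simp add: t_def)
      have "t j \<le> a * K \<and> real n / ((1 + a) * K) \<le> 1 / t j"
      proof (cases "n = 0")
        case True
        have "(norm (xc j - z))\<^sup>2 \<le> q ^ s * (norm (xc j - z))\<^sup>2"
          using mult_right_mono[of 1 "q ^ s" "(norm (xc j - z))\<^sup>2"] q1 by simp
        moreover have "0 \<le> 2 * lam * \<delta> * (\<Sum>i<s. q ^ i)"
          using lam_pos delta_pos q1 by (intro mult_nonneg_nonneg sum_nonneg) auto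
        ultimately have "(norm (xc j - z))\<^sup>2 \<le> (norm (x 0 - z))\<^sup>2"
          using IH(2) unfolding dist_inv_def by linarith
        then have "norm (xc j - z) \<le> norm (x 0 - z)" by (simp add: power2_le_iff_abs_le)
        then show ?thesis using start[of j] IH(3) True False delta_pos by (simp add: cycle_inv_def)
      next
        case nz: False
        then obtain i where i: "j = Suc i" "\<delta> < t i" "t i \<le> a * K"
          "(real n - 1) / ((1 + a) * K) \<le> 1 / t i"
          using IH(3) by (auto simp: cycle_inv_def)
        have "t j \<le> a * K" "1 / t i + 1 / ((1 + a) * K) \<le> 1 / t j"
          using reciprocal_gap_growth[of i a] i False by auto
        with i(4) show ?thesis by (simp add: diff_divide_distrib)
      qed
      then have "cycle_inv (Suc j) (Suc n)" using False by (simp add: cycle_inv_def)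
      moreover have "dist_inv (Suc j) s" using IH(2) by (simp add: dist_inv_def xc)
      moreover have "real (Suc j) \<le> W * real s + real (Suc n)" using IH(1) by simp
      ultimately show ?thesis by blast
    qed
  qed
  then obtain s n where inv: "real N \<le> W * real s + real n" "dist_inv N s" "cycle_inv N n" by blast
  have "real N \<le> W * (real s + 1)" using inv(1) cycle_length[OF inv(3)] by (simp add: algebra_simps)
  moreover have "0 \<le> q ^ s * (norm (xc N - z))\<^sup>2" using q1 by simp
  then have "2 * lam * \<delta> * (\<Sum>i<s. q ^ i) \<le> (norm (x 0 - z))\<^sup>2"
    using inv(2) unfolding dist_inv_def by linarith
  ultimately show ?thesis unfolding q_def by blast
qed

end


section \<open>Attainment of minima in finite dimension\<close>

definition unit_vec :: "nat \<Rightarrow> fseq" where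
  "unit_vec i = Abs_fseq (\<lambda>k. if k = i then 1 else 0)"

lemma coord_unit_vec: "coord (unit_vec i) k = (if k = i then 1 else 0)"
  by (simp add: unit_vec_def Abs_fseq_inverse)

lemma inner_unit_vec [simp]: "x \<bullet> unit_vec i = coord x i" "unit_vec i \<bullet> x = coord x i"
  using inner_fseq_superset[of "{i}" x "unit_vec i"] by (auto simp: coord_unit_vec inner_commute)

lemma norm_unit_vec [simp]: "norm (unit_vec i) = 1"
  by (simp add: norm_eq_sqrt_inner coord_unit_vec)

lemma unit_vec_Rn: "i < n \<Longrightarrow> unit_vec i \<in> Rn n"
  by (auto simp: Rn_def coord_unit_vec)

lemma coord_sum: "coord (\<Sum>i\<in>A. g i) k = (\<Sum>i\<in>A. coord (g i) k)"
  by (induction A rule: infinite_finite_induct) auto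

lemma Rn_expansion:
  assumes "x \<in> Rn n" shows "x = (\<Sum>i<n. coord x i *\<^sub>R unit_vec i)"
  by (rule fseq_eqI) (use assms in \<open>auto simp: coord_sum coord_unit_vec Rn_def if_distrib cong: if_cong\<close>)

text \<open>
The space of finitely supported sequences is incomplete, but its finite-dimensional subspaces are not:
coordinatewise limits can be reassembled from the unit vectors.
\<close>

lemma Rn_Cauchy_convergent:
  assumes X: "\<And>k. X k \<in> Rn n" and "Cauchy X"
  obtains l where "l \<in> Rn n" "X \<longlonglongrightarrow> l"
proof -
  have lim: "\<exists>l. (\<lambda>k. coord (X k) i) \<longlonglongrightarrow> l" for i
  proof -
    have "Cauchy (\<lambda>k. X k \<bullet> unit_vec i)"
      using bounded_linear.Cauchy[OF bounded_linear_inner_left \<open>Cauchy X\<close>] .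
    then show ?thesis using real_Cauchy_convergent by (simp add: convergent_def)
  qed
  then obtain L where L: "\<And>i. (\<lambda>k. coord (X k) i) \<longlonglongrightarrow> L i" by metis
  define l where "l = (\<Sum>i<n. L i *\<^sub>R unit_vec i)"
  have "(\<lambda>k. \<Sum>i<n. coord (X k) i *\<^sub>R unit_vec i) \<longlonglongrightarrow> l"
    unfolding l_def by (intro tendsto_intros L)
  then have "X \<longlonglongrightarrow> l" using Rn_expansion[OF X] by simp
  moreover have "l \<in> Rn n" unfolding l_def
    by (intro subspace_sum subspace_Rn subspace_scale unit_vec_Rn) auto
  ultimately show thesis using that by blast
qed

lemma lsc_fun_on_sequence:
  assumes "lsc_fun_on n g" and X: "\<And>k. X k \<in> Rn n" "X \<longlonglongrightarrow> l" and l: "l \<in> Rn n"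
    and v: "(\<lambda>k. g (X k)) \<longlonglongrightarrow> v"
  shows "g l \<le> v"
proof (rule dense_le)
  fix c assume c: "c < g l"
  have "g l \<le> Liminf (at l within Rn n) g" using assms(1) l by (simp add: lsc_fun_on_def)
  then have "\<forall>\<^sub>F u in at l within Rn n. c < g u" using c by (simp add: le_Liminf_iff)
  then have "\<forall>\<^sub>F u in nhds l. u \<in> Rn n \<longrightarrow> c < g u"
    unfolding eventually_at_filter by (rule eventually_mono) (use c in auto)
  then have "\<forall>\<^sub>F k in sequentially. c < g (X k)"
    using X eventually_compose_filterlim[of _ "nhds l" X] by fastforce
  then have "\<forall>\<^sub>F k in sequentially. c \<le> g (X k)" by (rule eventually_mono) simp
  then show "c \<le> v" using tendsto_lowerbound[OF v] by simp
qed

text \<open>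
Existence of minimizers without compactness: by the midpoint inequality, values close to the
infimum force points close to each other, so a minimizing sequence is Cauchy, and lower
semicontinuity passes to its limit.
\<close>

lemma strongly_convex_lsc_attains_min:
  fixes h :: "fseq \<Rightarrow> ereal" and g :: "fseq \<Rightarrow> real"
  assumes lsc: "lsc_fun_on n h" and proper: "proper_on n h" and cont: "continuous_on UNIV g"
    and below: "\<And>u. u \<in> edom n h \<Longrightarrow> m \<le> g u + real_of_ereal (h u)"
    and midpoint: "\<And>u v. u \<in> edom n h \<Longrightarrow> v \<in> edom n h \<Longrightarrow> \<exists>w\<in>edom n h.
      g w + real_of_ereal (h w) + \<sigma> * (norm (u - v))\<^sup>2
      \<le> (g u + real_of_ereal (h u) + (g v + real_of_ereal (h v))) / 2"
    and "\<sigma> > 0"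
  shows "\<exists>y\<in>edom n h. \<forall>u\<in>edom n h. g y + real_of_ereal (h y) \<le> g u + real_of_ereal (h u)"
proof -
  let ?D = "edom n h"
  define G where "G u = g u + real_of_ereal (h u)" for u
  have ne: "?D \<noteq> {}" using proper by (simp add: proper_on_def)
  have fin: "h u = ereal (real_of_ereal (h u))" if "u \<in> ?D" for u
    using that proper by (auto simp: edom_def proper_on_def ereal_real)
  define I where "I = Inf (G ` ?D)"
  have bdd: "bdd_below (G ` ?D)" using below by (auto simp: G_def intro!: bdd_belowI[of _ m])
  have I_le: "I \<le> G u" if "u \<in> ?D" for u
    unfolding I_def using bdd that by (simp add: cInf_lower)
  have "\<exists>u\<in>?D. G u < I + 1 / Suc k" for k
    using cInf_lessD[of "G ` ?D" "I + 1 / Suc k"] ne by (auto simp: I_def)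
  then obtain X where X: "\<And>k. X k \<in> ?D" "\<And>k. G (X k) < I + 1 / Suc k" by metis
  have XR: "X k \<in> Rn n" for k using X(1) by (simp add: edom_def)
  have close: "\<sigma> * (norm (X k - X j))\<^sup>2 \<le> (1 / Suc k + 1 / Suc j) / 2" for k j
  proof -
    obtain w where "w \<in> ?D" "G w + \<sigma> * (norm (X k - X j))\<^sup>2 \<le> (G (X k) + G (X j)) / 2"
      using midpoint[OF X(1) X(1), of k j] unfolding G_def by blast
    then show ?thesis using I_le[of w] X(2)[of k] X(2)[of j] by argo
  qed
  have "Cauchy X"
  proof (rule metric_CauchyI)
    fix e :: real assume "e > 0"
    then obtain N where N: "1 / Suc N < \<sigma> * e\<^sup>2"
      using reals_Archimedean[of "\<sigma> * e\<^sup>2"] \<open>\<sigma> > 0\<close> by (auto simp: inverse_eq_divide)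
    have "dist (X k) (X j) < e" if "k \<ge> N" "j \<ge> N" for k j
    proof -
      have "1 / Suc k \<le> 1 / Suc N" "1 / Suc j \<le> 1 / Suc N" using that by (auto simp: frac_le)
      then have "\<sigma> * (norm (X k - X j))\<^sup>2 < \<sigma> * e\<^sup>2" using close[of k j] N by argo
      then have "(norm (X k - X j))\<^sup>2 < e\<^sup>2" using \<open>\<sigma> > 0\<close> by simp
      then show ?thesis using \<open>e > 0\<close> by (simp add: dist_norm power_less_imp_less_base)
    qed
    then show "\<exists>N. \<forall>k\<ge>N. \<forall>j\<ge>N. dist (X k) (X j) < e" by blast
  qed
  then obtain l where l: "l \<in> Rn n" "X \<longlonglongrightarrow> l" using Rn_Cauchy_convergent XR by blast
  have "(\<lambda>k. I + 1 / Suc k) \<longlonglongrightarrow> I + 0"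
    by (rule tendsto_add[OF tendsto_const LIMSEQ_Suc[OF lim_1_over_n]])
  then have up: "(\<lambda>k. I + 1 / Suc k) \<longlonglongrightarrow> I" by simp
  have GI: "(\<lambda>k. G (X k)) \<longlonglongrightarrow> I"
  proof (rule tendsto_sandwich[OF _ _ tendsto_const up])
    show "\<forall>\<^sub>F k in sequentially. I \<le> G (X k)" using I_le X(1) by simp
    show "\<forall>\<^sub>F k in sequentially. G (X k) \<le> I + 1 / Suc k"
      by (intro always_eventually allI less_imp_le X(2))
  qed
  have "(\<lambda>k. g (X k)) \<longlonglongrightarrow> g l"
    by (rule continuous_on_tendsto_compose[OF cont l(2)]) auto
  then have "(\<lambda>k. G (X k) - g (X k)) \<longlonglongrightarrow> I - g l" by (intro tendsto_intros GI)
  then have "(\<lambda>k. real_of_ereal (h (X k))) \<longlonglongrightarrow> I - g l" by (simp add: G_def)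
  then have "(\<lambda>k. ereal (real_of_ereal (h (X k)))) \<longlonglongrightarrow> ereal (I - g l)" by simp
  then have "(\<lambda>k. h (X k)) \<longlonglongrightarrow> ereal (I - g l)" using fin[OF X(1)] by simp
  then have hl: "h l \<le> ereal (I - g l)" using lsc_fun_on_sequence lsc XR l by blast
  then have lD: "l \<in> ?D" using l by (auto simp: edom_def)
  then have "G l \<le> I" using hl fin[OF lD] by (metis G_def add.commute ereal_less_eq(3) le_diff_eq)
  then show ?thesis using lD I_le unfolding G_def by (meson order_trans)
qed


section \<open>Reduction of an instance to real-valued functions\<close>

abbreviation hdom :: "problem \<Rightarrow> fseq set" where
  "hdom P \<equiv> edom (dimn P) (hreg P)"

abbreviation f_real :: "problem \<Rightarrow> fseq \<Rightarrow> real" where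
  "f_real P u \<equiv> real_of_ereal (fobj P u)"

abbreviation h_real :: "problem \<Rightarrow> fseq \<Rightarrow> real" where
  "h_real P u \<equiv> real_of_ereal (hreg P u)"

text \<open>
Everything happens on the domain of \<open>h\<close>, where all values are finite; outside of it the objectives are
infinite. So each notion about extended real functions has a real counterpart there, and the
analysis above applies.
\<close>

locale instance_in_class =
  fixes P :: problem and \<mu> M R0 :: real and z :: fseq
  assumes in_class: "P \<in> inst_class \<mu> M R0"
    and M_gt_0: "0 < M" and mu_ge_0: "0 \<le> \<mu>"
    and z_minimizer: "z \<in> minimizers P"
begin

lemma hdom_Rn: "u \<in> hdom P \<Longrightarrow> u \<in> Rn (dimn P)"
  by (simp add: edom_def)

lemma h_ereal: "u \<in> hdom P \<Longrightarrow> hreg P u = ereal (h_real P u)"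
  using in_class by (auto simp: inst_class_def A1_def edom_def proper_on_def ereal_real)

lemma f_ereal: "u \<in> hdom P \<Longrightarrow> fobj P u = ereal (f_real P u)"
  using in_class by (auto simp: inst_class_def A1_def edom_def proper_on_def ereal_real subset_iff)

lemma f_not_MInf: "u \<in> Rn (dimn P) \<Longrightarrow> fobj P u \<noteq> -\<infinity>"
  using in_class by (auto simp: inst_class_def A1_def proper_on_def)

lemma h_outside: "u \<in> Rn (dimn P) \<Longrightarrow> u \<notin> hdom P \<Longrightarrow> hreg P u = \<infinity>"
  by (auto simp: edom_def)

lemma phi_ereal: "u \<in> hdom P \<Longrightarrow> phi P u = ereal (f_real P u + h_real P u)"
  using f_ereal h_ereal by (simp add: phi_def) (metis plus_ereal.simps(1))

lemma phi_outside: "u \<in> Rn (dimn P) \<Longrightarrow> u \<notin> hdom P \<Longrightarrow> phi P u = \<infinity>"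
  using h_outside f_not_MInf by (simp add: phi_def)

lemma start_hdom: "start P \<in> hdom P"
  using in_class by (simp add: inst_class_def)

lemma z_phi_min: "u \<in> Rn (dimn P) \<Longrightarrow> phi P z \<le> phi P u"
  using z_minimizer by (simp add: minimizers_def argmin_on_def)

lemma z_hdom: "z \<in> hdom P"
proof (rule ccontr)
  assume "z \<notin> hdom P"
  then have "phi P z = \<infinity>" using phi_outside z_minimizer by (simp add: minimizers_def argmin_on_def)
  then show False using z_phi_min[of "start P"] phi_ereal[OF start_hdom] hdom_Rn[OF start_hdom] by simp
qed

sublocale composite_problem "hdom P" "f_real P" "h_real P" "fsub P" M \<mu> z
proof
  have conv: "econvex_on (dimn P) (hreg P)" and mu: "mu_convex_on (dimn P) \<mu> (hreg P)"
    using in_class by (auto simp: inst_class_def A1_def A3_def)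
  have comb: "\<alpha> *\<^sub>R u + (1 - \<alpha>) *\<^sub>R v \<in> hdom P"
    if "u \<in> hdom P" "v \<in> hdom P" "0 \<le> \<alpha>" "\<alpha> \<le> 1" for u v \<alpha>
  proof -
    have "hreg P (\<alpha> *\<^sub>R u + (1 - \<alpha>) *\<^sub>R v) \<le> ereal \<alpha> * hreg P u + ereal (1 - \<alpha>) * hreg P v"
      using conv hdom_Rn[OF that(1)] hdom_Rn[OF that(2)] that(3,4) by (simp add: econvex_on_def)
    also have "\<dots> = ereal (\<alpha> * h_real P u + (1 - \<alpha>) * h_real P v)"
      using h_ereal[OF that(1)] h_ereal[OF that(2)] by (metis plus_ereal.simps(1) times_ereal.simps(1))
    also have "\<dots> < \<infinity>" by simp
    finally show ?thesis using that subspace_Rn[of "dimn P"]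
      by (simp add: edom_def subspace_add subspace_scale)
  qed
  show "convex (hdom P)"
  proof (rule convexI)
    fix u v :: fseq and a b :: real
    assume uv: "u \<in> hdom P" "v \<in> hdom P" and ab: "0 \<le> a" "0 \<le> b" "a + b = 1"
    then have b: "b = 1 - a" and "a \<le> 1" by auto
    then show "a *\<^sub>R u + b *\<^sub>R v \<in> hdom P" unfolding b using comb uv ab by blast
  qed
  show "f_real P x + fsub P x \<bullet> (u - x) \<le> f_real P u" if "x \<in> hdom P" "u \<in> hdom P" for x u
  proof -
    have "fsub P x \<in> subdifferential (dimn P) (fobj P) x"
      using in_class that by (simp add: inst_class_def A1_def)
    then have "fobj P x + ereal (fsub P x \<bullet> (u - x)) \<le> fobj P u"
      using hdom_Rn that by (simp add: subdifferential_def)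
    then show ?thesis using f_ereal[OF that(1)] f_ereal[OF that(2)]
      by (metis ereal_less_eq(3) plus_ereal.simps(1))
  qed
  show "norm (fsub P x) \<le> M" if "x \<in> hdom P" for x
    using in_class that by (simp add: inst_class_def A3_def)
  show "h_real P (\<alpha> *\<^sub>R u + (1 - \<alpha>) *\<^sub>R v)
    \<le> \<alpha> * h_real P u + (1 - \<alpha>) * h_real P v - \<alpha> * (1 - \<alpha>) * \<mu> / 2 * (norm (u - v))\<^sup>2"
    if "u \<in> hdom P" "v \<in> hdom P" "0 \<le> \<alpha>" "\<alpha> \<le> 1" for u v \<alpha>
  proof -
    have "hreg P (\<alpha> *\<^sub>R u + (1 - \<alpha>) *\<^sub>R v) \<le> ereal \<alpha> * hreg P u + ereal (1 - \<alpha>) * hreg P v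
      - ereal (\<alpha> * (1 - \<alpha>) * \<mu> / 2 * (norm (u - v))\<^sup>2)"
      using mu that by (auto simp: mu_convex_on_def)
    then have "ereal (h_real P (\<alpha> *\<^sub>R u + (1 - \<alpha>) *\<^sub>R v)) \<le> ereal \<alpha> * ereal (h_real P u)
      + ereal (1 - \<alpha>) * ereal (h_real P v) - ereal (\<alpha> * (1 - \<alpha>) * \<mu> / 2 * (norm (u - v))\<^sup>2)"
      using h_ereal[OF comb[OF that]] h_ereal[OF that(1)] h_ereal[OF that(2)] by metis
    then show ?thesis by simp
  qed
  show "z \<in> hdom P" by (rule z_hdom)
  show "f_real P z + h_real P z \<le> f_real P u + h_real P u" if "u \<in> hdom P" for u
    using z_phi_min[OF hdom_Rn[OF that]] phi_ereal[OF that] phi_ereal[OF z_hdom] by simp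
  show "0 < M" "0 \<le> \<mu>" using M_gt_0 mu_ge_0 by auto
qed

lemma phi_star_eq: "phi_star P = ereal (f_real P z + h_real P z)"
proof -
  have "phi_star P = phi P z" unfolding phi_star_def
    by (rule INF_eqI) (use z_phi_min hdom_Rn[OF z_hdom] in auto)
  then show ?thesis using phi_ereal[OF z_hdom] by simp
qed

lemma eps_solution_iff:
  assumes "u \<in> hdom P"
  shows "eps_solution \<epsilon> P u \<longleftrightarrow> f_real P u + h_real P u \<le> f_real P z + h_real P z + \<epsilon>"
  using hdom_Rn[OF assms] by (auto simp: eps_solution_def phi_star_eq phi_ereal[OF assms])

lemma linearization_ereal: "y \<in> hdom P \<Longrightarrow> linearization P y u = ereal (lin y u)"
  unfolding linearization_def lin_def by (metis f_ereal plus_ereal.simps(1))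

lemma bundle_model_ereal:
  assumes "finite B" "B \<noteq> {}" "B \<subseteq> hdom P"
  shows "bundle_model P B u = ereal (cutting_model B u)"
proof -
  have "(\<lambda>x. linearization P x u) ` B = ereal ` ((\<lambda>x. lin x u) ` B)"
    unfolding image_image using assms linearization_ereal by (intro image_cong) auto
  then show ?thesis unfolding bundle_model_def cutting_model_def
    using mono_Max_commute[of ereal "(\<lambda>x. lin x u) ` B"] assms by (simp add: mono_def)
qed

definition ereal_model :: "real \<Rightarrow> fseq set \<Rightarrow> fseq \<Rightarrow> fseq \<Rightarrow> ereal" where
  "ereal_model lam B c u = bundle_model P B u + hreg P u + prox_term lam c u"

lemma ereal_model_eq:
  assumes "finite B" "B \<noteq> {}" "B \<subseteq> hdom P" "u \<in> Rn (dimn P)"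
  shows "ereal_model lam B c u = (if u \<in> hdom P then ereal (prox_model lam B c u) else \<infinity>)"
proof (cases "u \<in> hdom P")
  case True
  show ?thesis
    unfolding ereal_model_def prox_term_def prox_model_def bundle_model_ereal[OF assms(1-3)]
    using True h_ereal[OF True] by (metis plus_ereal.simps(1))
next
  case False
  then show ?thesis
    unfolding ereal_model_def prox_term_def bundle_model_ereal[OF assms(1-3)]
    using h_outside[OF assms(4)] by simp
qed

lemma prox_obj_ereal: "u \<in> hdom P \<Longrightarrow> phi P u + prox_term lam c u = ereal (prox_obj lam c u)"
  by (simp add: phi_ereal prox_term_def prox_obj_def)

lemma argmin_model_iff:
  assumes B: "finite B" "B \<noteq> {}" "B \<subseteq> hdom P" and "lam > 0"
  shows "argmin_on (Rn (dimn P)) (ereal_model lam B c) = {y} \<longleftrightarrow>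
    y \<in> hdom P \<and> (\<forall>v\<in>hdom P. prox_model lam B c y \<le> prox_model lam B c v)"
    (is "?L \<longleftrightarrow> ?R")
proof -
  have mem: "w \<in> argmin_on (Rn (dimn P)) (ereal_model lam B c) \<longleftrightarrow>
    w \<in> hdom P \<and> (\<forall>v\<in>hdom P. prox_model lam B c w \<le> prox_model lam B c v)" for w
  proof
    assume w: "w \<in> argmin_on (Rn (dimn P)) (ereal_model lam B c)"
    then have wR: "w \<in> Rn (dimn P)"
      and le: "\<And>v. v \<in> Rn (dimn P) \<Longrightarrow> ereal_model lam B c w \<le> ereal_model lam B c v"
      by (auto simp: argmin_on_def)
    have "w \<in> hdom P"
      using le[OF hdom_Rn[OF z_hdom]] ereal_model_eq[OF B wR] ereal_model_eq[OF B hdom_Rn[OF z_hdom]] z_hdom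
      by (auto split: if_splits)
    then show "w \<in> hdom P \<and> (\<forall>v\<in>hdom P. prox_model lam B c w \<le> prox_model lam B c v)"
      using le hdom_Rn ereal_model_eq[OF B] by (metis ereal_less_eq(3))
  next
    assume "w \<in> hdom P \<and> (\<forall>v\<in>hdom P. prox_model lam B c w \<le> prox_model lam B c v)"
    then show "w \<in> argmin_on (Rn (dimn P)) (ereal_model lam B c)"
      using hdom_Rn ereal_model_eq[OF B] by (auto simp: argmin_on_def)
  qed
  have uniq: "w = y" if "w \<in> hdom P" "y \<in> hdom P"
    "\<forall>v\<in>hdom P. prox_model lam B c w \<le> prox_model lam B c v" "\<forall>v\<in>hdom P. prox_model lam B c y \<le> prox_model lam B c v"
    for w
  proof -
    have "prox_model lam B c w + (1 / lam + \<mu>) / 2 * (norm (y - w))\<^sup>2 \<le> prox_model lam B c y"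
      using prox_model_growth_self[OF B \<open>w \<in> hdom P\<close> \<open>lam > 0\<close>] that by blast
    then have "(1 / lam + \<mu>) / 2 * (norm (y - w))\<^sup>2 \<le> 0" using that by fastforce
    moreover have "0 < 1 / lam + \<mu>" using \<open>lam > 0\<close> mu_ge_0 by (simp add: add_pos_nonneg)
    ultimately show ?thesis by (simp add: mult_le_0_iff)
  qed
  show ?thesis using mem uniq by blast
qed

text \<open>
The subproblems are solvable, so that the method is well defined on every instance. The
midpoint inequality has modulus \<open>\<kappa> / 8\<close>, the value of \<open>\<alpha> (1 - \<alpha>) \<kappa> / 2\<close> at \<open>\<alpha> = 1 / 2\<close>.
\<close>

lemma prox_model_attains_min:
  assumes B: "finite B" "B \<noteq> {}" "B \<subseteq> hdom P" and "lam > 0"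
  shows "\<exists>y\<in>hdom P. \<forall>u\<in>hdom P. prox_model lam B c y \<le> prox_model lam B c u"
proof -
  define g where "g u = cutting_model B u + (norm (u - c))\<^sup>2 / (2 * lam)" for u
  have gm: "g u + h_real P u = prox_model lam B c u" for u by (simp add: g_def prox_model_def)
  have "M-lipschitz_on UNIV (cutting_model B)"
  proof (rule lipschitz_onI)
    show "dist (cutting_model B u) (cutting_model B v) \<le> M * dist u v" for u v
      using cutting_model_lipschitz[OF B, of u v] cutting_model_lipschitz[OF B, of v u]
      by (auto simp: dist_norm norm_minus_commute abs_le_iff)
  qed (use M_gt_0 in simp)
  then have cont: "continuous_on UNIV g" unfolding g_def
    by (intro continuous_intros lipschitz_on_continuous_on) (use \<open>lam > 0\<close> in auto)
  obtain m where m: "\<And>u. u \<in> hdom P \<Longrightarrow> m \<le> prox_model lam B c u"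
    using prox_model_bounded_below[OF B \<open>lam > 0\<close>] by metis
  have mid: "\<exists>w\<in>hdom P. g w + h_real P w + (1 / lam + \<mu>) / 8 * (norm (u - v))\<^sup>2
      \<le> (g u + h_real P u + (g v + h_real P v)) / 2" if uv: "u \<in> hdom P" "v \<in> hdom P" for u v
  proof
    let ?w = "(1 / 2) *\<^sub>R u + (1 - 1 / 2) *\<^sub>R v"
    show "?w \<in> hdom P" using convexD[OF convex_D uv, of "1/2" "1/2"] by simp
    have 1: "cutting_model B ?w \<le> 1 / 2 * cutting_model B u + (1 - 1 / 2) * cutting_model B v"
    proof (rule cutting_model_leI[OF B(1,2)])
      fix x assume "x \<in> B"
      then show "lin x ?w \<le> 1 / 2 * cutting_model B u + (1 - 1 / 2) * cutting_model B v"
        unfolding lin_affine using lin_le_cutting_model[OF B(1), of x u] lin_le_cutting_model[OF B(1), of x v] by simp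
    qed
    have 2: "h_real P ?w + (norm (?w - c))\<^sup>2 / (2 * lam)
      \<le> 1 / 2 * (h_real P u + (norm (u - c))\<^sup>2 / (2 * lam))
        + (1 - 1 / 2) * (h_real P v + (norm (v - c))\<^sup>2 / (2 * lam))
        - 1 / 2 * (1 - 1 / 2) * (1 / lam + \<mu>) / 2 * (norm (u - v))\<^sup>2"
      by (rule prox_regularizer_convex) (use uv \<open>lam > 0\<close> in auto)
    have "1 / 2 * (1 - 1 / 2) * (1 / lam + \<mu>) / 2 * (norm (u - v))\<^sup>2
      = (1 / lam + \<mu>) / 8 * (norm (u - v))\<^sup>2" by simp
    with 1 2 show "g ?w + h_real P ?w + (1 / lam + \<mu>) / 8 * (norm (u - v))\<^sup>2
      \<le> (g u + h_real P u + (g v + h_real P v)) / 2"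
      unfolding g_def by argo
  qed
  have "lsc_fun_on (dimn P) (hreg P)" "proper_on (dimn P) (hreg P)"
    using in_class by (auto simp: inst_class_def A1_def)
  moreover have "0 < (1 / lam + \<mu>) / 8" using \<open>lam > 0\<close> mu_ge_0 by (simp add: add_pos_nonneg)
  ultimately show ?thesis
    using strongly_convex_lsc_attains_min[OF _ _ cont _ mid, of m] m unfolding gm by blast
qed

end


section \<open>Gradients and spans\<close>

text \<open>
The Gram-Schmidt step: one further generator is orthogonalized against the span of the others. A
zero residual \<open>r\<close> causes no problem, since \<open>\<beta> = 0\<close> then by the convention on division by zero.
\<close>

lemma orthogonal_projection_finite_span:
  fixes S :: "'a::real_inner set"
  assumes "finite S"
  shows "\<exists>p\<in>span S. \<forall>v\<in>span S. (y - p) \<bullet> v = 0"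
  using assms
proof (induction S arbitrary: y rule: finite_induct)
  case empty
  show ?case by simp
next
  case (insert a S)
  obtain q where q: "q \<in> span S" "\<forall>v\<in>span S. (a - q) \<bullet> v = 0" using insert.IH by blast
  obtain p where p: "p \<in> span S" "\<forall>v\<in>span S. (y - p) \<bullet> v = 0" using insert.IH by blast
  define r where "r = a - q"
  define \<beta> where "\<beta> = ((y - p) \<bullet> r) / (r \<bullet> r)"
  have sub: "span S \<subseteq> span (insert a S)" by (rule span_mono) auto
  have r: "r \<in> span (insert a S)" unfolding r_def
    using q sub by (intro span_diff) (auto intro: span_base)
  have orth: "(y - (p + \<beta> *\<^sub>R r)) \<bullet> v = 0" if v: "v \<in> span S" for v
    using p(2) q(2) v by (simp add: r_def[symmetric] inner_diff_left inner_add_left)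
  have "(y - (p + \<beta> *\<^sub>R r)) \<bullet> r = (y - p) \<bullet> r - \<beta> * (r \<bullet> r)"
    by (simp add: inner_diff_left inner_add_left)
  also have "\<dots> = 0" by (cases "r = 0") (auto simp: \<beta>_def)
  finally have "(y - (p + \<beta> *\<^sub>R r)) \<bullet> a = 0"
    using orth[OF q(1)] by (simp add: r_def inner_diff_right)
  then have gen: "(y - (p + \<beta> *\<^sub>R r)) \<bullet> w = 0" if "w \<in> insert a S" for w
    using that orth by (auto intro: span_base)
  have "(y - (p + \<beta> *\<^sub>R r)) \<bullet> v = 0" if "v \<in> span (insert a S)" for v
    using that
  proof (induction rule: span_induct_alt)
    case (step c w v)
    then show ?case using gen by (simp add: inner_add_right)
  qed simp
  moreover have "p + \<beta> *\<^sub>R r \<in> span (insert a S)"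
    using p sub r by (intro span_add span_scale) auto
  ultimately show ?case by blast
qed

text \<open>
Derivatives within a proper subspace are not unique as linear maps on the whole space. Their
representing vectors are, once they are taken in the subspace: restrict to the line in direction of
the difference. This identifies \<open>grad\<close>.
\<close>

lemma has_derivative_within_Rn_unique:
  assumes d1: "(F has_derivative (\<lambda>v. v \<bullet> s1)) (at x within Rn n)"
    and d2: "(F has_derivative (\<lambda>v. v \<bullet> s2)) (at x within Rn n)"
    and mem: "x \<in> Rn n" "s1 \<in> Rn n" "s2 \<in> Rn n"
  shows "s1 = s2"
proof -
  define d where "d = s1 - s2"
  define l where "l r = x + r *\<^sub>R d" for r :: real
  have lR: "l r \<in> Rn n" for r
    unfolding l_def d_def using mem subspace_Rn[of n]
    by (intro subspace_add subspace_scale subspace_diff)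
  have l': "(l has_derivative (\<lambda>r. r *\<^sub>R d)) (at 0)"
    unfolding l_def by (auto intro!: derivative_eq_intros)
  have line: "(F \<circ> l has_derivative (\<lambda>r. (r *\<^sub>R d) \<bullet> s)) (at 0)"
    if "(F has_derivative (\<lambda>v. v \<bullet> s)) (at x within Rn n)" for s
  proof -
    have "(F has_derivative (\<lambda>v. v \<bullet> s)) (at (l 0) within range l)"
      using has_derivative_subset[OF that, of "range l"] lR by (auto simp: l_def)
    from diff_chain_within[OF l' this] show ?thesis by (simp add: o_def)
  qed
  have "(\<lambda>r. (r *\<^sub>R d) \<bullet> s1) = (\<lambda>r. (r *\<^sub>R d) \<bullet> s2)"
    using has_derivative_unique[OF line[OF d1] line[OF d2]] .
  from fun_cong[OF this, of 1] have "d \<bullet> d = 0" by (simp add: d_def inner_diff_right)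
  then show ?thesis by (simp add: d_def)
qed

lemma grad_scalar_quadratic:
  assumes g: "\<And>u. u \<in> Rn n \<Longrightarrow> g u = ereal (a / 2 * (norm u)\<^sup>2 + b \<bullet> u + c)"
    and mem: "b \<in> Rn n" "x \<in> Rn n"
  shows "grad n g x = a *\<^sub>R x + b"
proof -
  have sR: "a *\<^sub>R x + b \<in> Rn n"
    using mem subspace_Rn[of n] by (intro subspace_add subspace_scale)
  have sq: "((\<lambda>u. u \<bullet> u) has_derivative (\<lambda>v. x \<bullet> v + v \<bullet> x)) (at x within Rn n)"
    by (rule has_derivative_inner[OF has_derivative_ident has_derivative_ident])
  have ln: "((\<lambda>u. b \<bullet> u + c) has_derivative (\<lambda>v. b \<bullet> v)) (at x within Rn n)"
    by (rule has_derivative_add_const[OF has_derivative_inner_right[OF has_derivative_ident]])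
  have eq: "(\<lambda>v. a / 2 * (x \<bullet> v + v \<bullet> x) + b \<bullet> v) = (\<lambda>v. v \<bullet> (a *\<^sub>R x + b))"
    by (rule ext) (simp add: inner_add_right inner_commute)
  have "((\<lambda>u. a / 2 * (u \<bullet> u) + (b \<bullet> u + c)) has_derivative (\<lambda>v. v \<bullet> (a *\<^sub>R x + b))) (at x within Rn n)"
    using has_derivative_add[OF has_derivative_mult_right[OF sq, of "a / 2"] ln] unfolding eq .
  then have D: "((\<lambda>u. real_of_ereal (g u)) has_derivative (\<lambda>v. v \<bullet> (a *\<^sub>R x + b))) (at x within Rn n)"
    by (rule has_derivative_transform[OF mem(2), rotated]) (simp add: g power2_norm_eq_inner add.assoc)
  show ?thesis unfolding grad_def
  proof (rule the_equality, intro conjI)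
    fix s
    assume s: "s \<in> Rn n \<and> ((\<lambda>u. real_of_ereal (g u)) has_derivative (\<lambda>v. v \<bullet> s)) (at x within Rn n)"
    show "s = a *\<^sub>R x + b"
      by (rule has_derivative_within_Rn_unique[OF conjunct2[OF s] D mem(2) conjunct1[OF s] sR])
  qed (rule sR D)+
qed


section \<open>Runs of the bundle method\<close>

context instance_in_class
begin

lemma rpb_step_iff:
  assumes B: "finite (B (Suc j))" "B (Suc j) \<noteq> {}" "B (Suc j) \<subseteq> hdom P"
    and xt: "xt j \<in> hdom P" and "lam > 0"
  shows "rpb_step P lam \<delta> x xc xt B (Suc j) \<longleftrightarrow>
    x (Suc j) \<in> hdom P \<and>
    (\<forall>v\<in>hdom P. prox_model lam (B (Suc j)) (xc j) (x (Suc j)) \<le> prox_model lam (B (Suc j)) (xc j) v) \<and>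
    xt (Suc j) \<in> {x (Suc j), xt j} \<and>
    (\<forall>y\<in>{x (Suc j), xt j}. prox_obj lam (xc j) (xt (Suc j)) \<le> prox_obj lam (xc j) y) \<and>
    (if gap lam (B (Suc j)) (xc j) (xt (Suc j)) (x (Suc j)) \<le> \<delta>
     then {x (Suc j)} \<subseteq> B (Suc (Suc j)) \<and> B (Suc (Suc j)) \<subseteq> x ` {0..Suc j} \<and> xc (Suc j) = x (Suc j)
     else {y \<in> B (Suc j). lin y (x (Suc j)) = cutting_model (B (Suc j)) (x (Suc j))} \<union> {x (Suc j)} \<subseteq> B (Suc (Suc j)) \<and>
       B (Suc (Suc j)) \<subseteq> B (Suc j) \<union> {x (Suc j)} \<and> xc (Suc j) = xc j)"
proof -
  let ?B = "B (Suc j)" and ?y = "x (Suc j)"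
  have em: "(\<lambda>u. bundle_model P ?B u + hreg P u + prox_term lam (xc j) u) = ereal_model lam ?B (xc j)"
    by (simp add: ereal_model_def fun_eq_iff)
  note am = argmin_model_iff[OF B \<open>lam > 0\<close>, of "xc j" ?y]
  show ?thesis
  proof (cases "?y \<in> hdom P \<and> (\<forall>v\<in>hdom P. prox_model lam ?B (xc j) ?y \<le> prox_model lam ?B (xc j) v)")
    case False
    then show ?thesis unfolding rpb_step_def Let_def diff_Suc_1 em am by blast
  next
    case True
    then have yD: "?y \<in> hdom P" by blast
    have ph: "phi P w + prox_term lam (xc j) w = ereal (prox_obj lam (xc j) w)" if "w \<in> {?y, xt j}" for w
      using that yD xt prox_obj_ereal by blast
    have arg: "xt (Suc j) \<in> argmin_on {?y, xt j} (\<lambda>u. phi P u + prox_term lam (xc j) u) \<longleftrightarrow>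
      xt (Suc j) \<in> {?y, xt j} \<and> (\<forall>y\<in>{?y, xt j}. prox_obj lam (xc j) (xt (Suc j)) \<le> prox_obj lam (xc j) y)"
      unfolding argmin_on_def using ph[of ?y] ph[of "xt j"] by auto
    have gp: "phi P (xt (Suc j)) + prox_term lam (xc j) (xt (Suc j)) - ereal_model lam ?B (xc j) ?y \<le> ereal \<delta>
      \<longleftrightarrow> gap lam ?B (xc j) (xt (Suc j)) ?y \<le> \<delta>" if "xt (Suc j) \<in> {?y, xt j}"
      unfolding ph[OF that] ereal_model_eq[OF B hdom_Rn[OF yD]] gap_def using yD by simp
    have act: "{y \<in> ?B. linearization P y ?y = bundle_model P ?B ?y} = {y \<in> ?B. lin y ?y = cutting_model ?B ?y}"
      unfolding bundle_model_ereal[OF B] using linearization_ereal B(3) by auto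
    show ?thesis unfolding rpb_step_def Let_def diff_Suc_1 em am arg act
      using True gp by (auto simp del: insert_iff)
  qed
qed

lemma rpb_iterates_bundle_run:
  assumes "rpb_iterates P lam \<delta> x" and "lam > 0" "\<delta> > 0"
  shows "x 0 = start P"
    "\<exists>xc xt B. bundle_run (hdom P) (f_real P) (h_real P) (fsub P) M \<mu> z lam \<delta> x xc xt B"
proof -
  obtain xc xt B where init: "x 0 = start P" "xc 0 = start P" "xt 0 = start P" "B 1 = {start P}"
    and step: "\<And>j. j \<ge> 1 \<Longrightarrow> rpb_step P lam \<delta> x xc xt B j"
    using assms(1) unfolding rpb_iterates_def by metis
  show "x 0 = start P" by (rule init)
  have inv: "x j \<in> hdom P \<and> xt j \<in> hdom P \<and> finite (B (Suc j)) \<and> B (Suc j) \<noteq> {} \<and> B (Suc j) \<subseteq> hdom P \<and> x ` {0..j} \<subseteq> hdom P" for j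
  proof (induction j)
    case 0
    show ?case using init start_hdom by simp
  next
    case (Suc j)
    then have st: "rpb_step P lam \<delta> x xc xt B (Suc j)" and B: "finite (B (Suc j))" "B (Suc j) \<noteq> {}"
      "B (Suc j) \<subseteq> hdom P" and xt: "xt j \<in> hdom P" using step by auto
    note s = st[unfolded rpb_step_iff[where j = j, where B = B, where xt = xt, OF B xt \<open>lam > 0\<close>]]
    have 1: "x (Suc j) \<in> hdom P" "xt (Suc j) \<in> hdom P" using s xt by auto
    have 2: "x ` {0..Suc j} \<subseteq> hdom P" using Suc 1 by (force simp: le_Suc_eq)
    have "x (Suc j) \<in> B (Suc (Suc j))"
      "B (Suc (Suc j)) \<subseteq> x ` {0..Suc j} \<union> (B (Suc j) \<union> {x (Suc j)})"
      using s by (auto split: if_splits)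
    then show ?case using 1 2 B by (auto intro: finite_subset)
  qed
  have facts: "x (Suc j) \<in> hdom P \<and>
    (\<forall>v\<in>hdom P. prox_model lam (B (Suc j)) (xc j) (x (Suc j)) \<le> prox_model lam (B (Suc j)) (xc j) v) \<and>
    xt (Suc j) \<in> {x (Suc j), xt j} \<and>
    (\<forall>y\<in>{x (Suc j), xt j}. prox_obj lam (xc j) (xt (Suc j)) \<le> prox_obj lam (xc j) y) \<and>
    (if gap lam (B (Suc j)) (xc j) (xt (Suc j)) (x (Suc j)) \<le> \<delta>
     then {x (Suc j)} \<subseteq> B (Suc (Suc j)) \<and> B (Suc (Suc j)) \<subseteq> x ` {0..Suc j} \<and> xc (Suc j) = x (Suc j)
     else {y \<in> B (Suc j). lin y (x (Suc j)) = cutting_model (B (Suc j)) (x (Suc j))} \<union> {x (Suc j)} \<subseteq> B (Suc (Suc j)) \<and>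
       B (Suc (Suc j)) \<subseteq> B (Suc j) \<union> {x (Suc j)} \<and> xc (Suc j) = xc j)" for j
  proof -
    have B: "finite (B (Suc j))" "B (Suc j) \<noteq> {}" "B (Suc j) \<subseteq> hdom P" and xt: "xt j \<in> hdom P"
      using inv[of j] by auto
    have "rpb_step P lam \<delta> x xc xt B (Suc j)" using step by simp
    then show ?thesis unfolding rpb_step_iff[where B = B and j = j and xt = xt, OF B xt \<open>lam > 0\<close>] .
  qed
  have "bundle_run (hdom P) (f_real P) (h_real P) (fsub P) M \<mu> z lam \<delta> x xc xt B"
  proof (unfold_locales, goal_cases)
    case (3 j) then show ?case using inv by blast
  next
    case (7 v j) then show ?case using facts by blast
  next
    case (8 j) then show ?case using facts by blast
  next
    case (9 y j) then show ?case using facts by blast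
  next
    case (10 j) then show ?case using facts[of j] by auto
  next
    case (11 j) then show ?case using facts[of j] by (simp del: insert_iff)
  qed (use assms init in auto)
  then show "\<exists>xc xt B. bundle_run (hdom P) (f_real P) (h_real P) (fsub P) M \<mu> z lam \<delta> x xc xt B"
    by blast
qed

text \<open>
Among the admissible bundles, the run constructed here keeps only the latest cut after a serious
iteration and discards nothing after a null iteration, so that the next bundle depends on the current
state only and dependent choice applies.
\<close>

lemma rpb_iterates_exist:
  assumes "lam > 0"
  shows "\<exists>x. rpb_iterates P lam \<delta> x"
proof -
  define valid :: "fseq \<times> fseq \<times> fseq \<times> fseq set \<Rightarrow> bool" where
    "valid s \<longleftrightarrow> (case s of (y, c, b, B) \<Rightarrow> b \<in> hdom P \<and> finite B \<and> B \<noteq> {} \<and> B \<subseteq> hdom P)" for s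
  define next_state :: "fseq \<times> fseq \<times> fseq \<times> fseq set \<Rightarrow> fseq \<times> fseq \<times> fseq \<times> fseq set \<Rightarrow> bool" where
    "next_state s s' \<longleftrightarrow> (case (s, s') of ((y, c, b, B), (y', c', b', B')) \<Rightarrow>
      y' \<in> hdom P \<and> (\<forall>v\<in>hdom P. prox_model lam B c y' \<le> prox_model lam B c v) \<and>
      b' \<in> {y', b} \<and> (\<forall>w\<in>{y', b}. prox_obj lam c b' \<le> prox_obj lam c w) \<and>
      (if gap lam B c b' y' \<le> \<delta> then B' = {y'} \<and> c' = y' else B' = B \<union> {y'} \<and> c' = c))" for s s'
  let ?init = "(start P, start P, start P, {start P})"
  have "\<exists>S. \<forall>n. (valid (S n) \<and> (n = 0 \<longrightarrow> S n = ?init)) \<and> next_state (S n) (S (Suc n))"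
  proof (rule dependent_nat_choice)
    show "\<exists>s. valid s \<and> (0 = (0::nat) \<longrightarrow> s = ?init)"
      by (rule exI[of _ ?init]) (use start_hdom in \<open>simp add: valid_def\<close>)
  next
    fix s and n :: nat assume s: "valid s \<and> (n = 0 \<longrightarrow> s = ?init)"
    obtain y c b B where sd: "s = (y, c, b, B)" by (cases s) auto
    have v: "b \<in> hdom P" "finite B" "B \<noteq> {}" "B \<subseteq> hdom P" using s by (auto simp: valid_def sd)
    obtain y' where y': "y' \<in> hdom P" "\<forall>v\<in>hdom P. prox_model lam B c y' \<le> prox_model lam B c v"
      using prox_model_attains_min[OF v(2-4) assms, of c] by blast
    obtain b' where b': "b' \<in> {y', b}" "\<forall>w\<in>{y', b}. prox_obj lam c b' \<le> prox_obj lam c w"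
      using linear[of "prox_obj lam c y'" "prox_obj lam c b"] by auto
    define ser where "ser \<longleftrightarrow> gap lam B c b' y' \<le> \<delta>"
    let ?s' = "(y', if ser then y' else c, b', if ser then {y'} else B \<union> {y'})"
    have "valid ?s'" using v y' b' by (auto simp: valid_def)
    moreover have "next_state s ?s'" using y' b' by (auto simp: next_state_def sd ser_def)
    ultimately show "\<exists>s'. (valid s' \<and> (Suc n = 0 \<longrightarrow> s' = ?init)) \<and> next_state s s'" by blast
  qed
  then obtain S where S: "\<And>n. valid (S n)" "S 0 = ?init" "\<And>n. next_state (S n) (S (Suc n))" by blast
  define x where "x n = fst (S n)" for n
  define xc where "xc n = fst (snd (S n))" for n
  define xt where "xt n = fst (snd (snd (S n)))" for n
  define B where "B n = (case n of 0 \<Rightarrow> {} | Suc m \<Rightarrow> snd (snd (snd (S m))))" for n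
  have Sd: "S n = (x n, xc n, xt n, B (Suc n))" for n
    by (simp add: x_def xc_def xt_def B_def)
  have "rpb_step P lam \<delta> x xc xt B (Suc j)" for j
  proof -
    have v: "xt j \<in> hdom P" "finite (B (Suc j))" "B (Suc j) \<noteq> {}" "B (Suc j) \<subseteq> hdom P"
      using S(1)[of j] by (auto simp: valid_def Sd)
    show ?thesis
      unfolding rpb_step_iff[where B = B and j = j and xt = xt, OF v(2-4) v(1) assms]
      using S(3)[of j] unfolding Sd next_state_def by (auto simp del: insert_iff split: if_splits)
  qed
  then have "\<forall>j\<ge>1. rpb_step P lam \<delta> x xc xt B j"
    by (metis Suc_le_D One_nat_def)
  moreover have "x 0 = start P" "xc 0 = start P" "xt 0 = start P" "B 1 = {start P}"
    using S(2) by (auto simp: x_def xc_def xt_def B_def)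
  ultimately show ?thesis unfolding rpb_iterates_def by blast
qed

text \<open>
The iteration bound applied to the iterates before the first solution. It also shows that a solution
exists: each serious iteration consumes at least \<open>2 \<lambda> \<delta>\<close> of the initial squared distance, so an unsolved
run would have bounded length. The additive \<open>2\<close> accounts for the solution itself and for index \<open>0\<close>.
\<close>

lemma bundle_run_first_solution:
  fixes x :: "nat \<Rightarrow> fseq" and lam \<delta> a :: real
  assumes run: "bundle_run (hdom P) (f_real P) (h_real P) (fsub P) M \<mu> z lam \<delta> x xc xt B"
    and a: "0 \<le> a"
    and start_gap: "\<And>j. xc j = x j \<Longrightarrow> norm (xc j - z) \<le> norm (x 0 - z) \<Longrightarrow>
      bundle_run.t (f_real P) (h_real P) (fsub P) lam x xc xt B j \<le> a * bundle_run.K M \<mu> lam"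
  defines "W \<equiv> (1 + a) * (8 * M\<^sup>2 / (1 / lam + \<mu>)) / \<delta> + 2"
  obtains k where "eps_solution (2 * \<delta>) P (x k)" "\<And>i. i < k \<Longrightarrow> \<not> eps_solution (2 * \<delta>) P (x i)"
    "\<exists>s::nat. real (Suc k) \<le> W * (real s + 1) + 2 \<and>
      2 * lam * \<delta> * (\<Sum>i<s. (1 + lam * \<mu>) ^ i) \<le> (norm (x 0 - z))\<^sup>2"
proof -
  interpret bundle_run "hdom P" "f_real P" "h_real P" "fsub P" M \<mu> z lam \<delta> x xc xt B by (rule run)
  have W: "W = (1 + a) * K / \<delta> + 2" by (simp add: W_def K_def \<kappa>_def)
  have bound: "\<exists>s::nat. real N \<le> W * (real s + 1) \<and>
      2 * lam * \<delta> * (\<Sum>i<s. (1 + lam * \<mu>) ^ i) \<le> (norm (x 0 - z))\<^sup>2"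
    if "\<And>i. i \<le> N \<Longrightarrow> \<not> eps_solution (2 * \<delta>) P (x i)" for N
    unfolding W
  proof (rule iteration_bound[OF a start_gap])
    show "f_real P z + h_real P z + 2 * \<delta> \<le> f_real P (x i) + h_real P (x i)" if "i \<le> N" for i
      using \<open>\<And>i. i \<le> N \<Longrightarrow> \<not> eps_solution (2 * \<delta>) P (x i)\<close>[OF that] eps_solution_iff[OF x_mem] by simp
  qed
  have W0: "0 < W" using a K_pos delta_pos by (simp add: W add_nonneg_pos)
  have "\<exists>k. eps_solution (2 * \<delta>) P (x k)"
  proof (rule ccontr)
    assume none: "\<not> ?thesis"
    define S where "S = (norm (x 0 - z))\<^sup>2 / (2 * lam * \<delta>)"
    obtain N :: nat where N: "W * (S + 1) < real N" using reals_Archimedean2 by blast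
    obtain s :: nat where s: "real N \<le> W * (real s + 1)"
      "2 * lam * \<delta> * (\<Sum>i<s. (1 + lam * \<mu>) ^ i) \<le> (norm (x 0 - z))\<^sup>2"
      using bound[of N] none by blast
    have "(\<Sum>i<s. 1) \<le> (\<Sum>i<s. (1 + lam * \<mu>) ^ i)"
      using lam_pos mu_nonneg by (intro sum_mono one_le_power) auto
    then have "2 * lam * \<delta> * real s \<le> 2 * lam * \<delta> * (\<Sum>i<s. (1 + lam * \<mu>) ^ i)"
      using lam_pos delta_pos by (intro mult_left_mono) auto
    then have "2 * lam * \<delta> * real s \<le> (norm (x 0 - z))\<^sup>2" using s(2) by linarith
    then have "real s \<le> S" using lam_pos delta_pos by (simp add: S_def field_simps)
    then have "W * (real s + 1) \<le> W * (S + 1)" using W0 by simp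
    then show False using N s(1) by linarith
  qed
  then obtain k where k: "eps_solution (2 * \<delta>) P (x k)" "\<And>i. i < k \<Longrightarrow> \<not> eps_solution (2 * \<delta>) P (x i)"
    using exists_least_iff[of "\<lambda>k. eps_solution (2 * \<delta>) P (x k)"] by blast
  have "\<exists>s::nat. real (Suc k) \<le> W * (real s + 1) + 2 \<and>
      2 * lam * \<delta> * (\<Sum>i<s. (1 + lam * \<mu>) ^ i) \<le> (norm (x 0 - z))\<^sup>2"
  proof (cases k)
    case 0
    then show ?thesis using W0 by (intro exI[of _ 0]) simp
  next
    case (Suc N)
    then have "\<not> eps_solution (2 * \<delta>) P (x i)" if "i \<le> N" for i using k(2) that by simp
    from bound[of N, OF this] Suc show ?thesis by fastforce
  qed
  then show thesis using that k by blast
qed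

text \<open>
Let \<open>d\<close> be the component of \<open>x j - x 0\<close> orthogonal to the span. All cuts have slopes in the span, so
removing \<open>d\<close> leaves the cutting-plane model unchanged. The center and the gradient of \<open>h\<close> at \<open>x 0\<close> lie in
the span (up to \<open>x 0\<close>), so removing \<open>d\<close> lowers \<open>h\<close> and the proximal term by their pure second-order
contributions. Minimality of \<open>x j\<close> forces \<open>d = 0\<close>.
\<close>

lemma iterates_in_gradient_span:
  assumes run: "bundle_run (hdom P) (f_real P) (h_real P) (fsub P) M \<mu> z lam \<delta> x xc xt B"
    and quad: "scalar_quadratic (dimn P) (hreg P)" and "1 \<le> dimn P"
  shows "x j - x 0 \<in> span ((\<lambda>i. fsub P (x i)) ` {..<j} \<union> (\<lambda>i. grad (dimn P) (hreg P) (x i)) ` {..<j})"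
proof (induction j rule: less_induct)
  interpret bundle_run "hdom P" "f_real P" "h_real P" "fsub P" M \<mu> z lam \<delta> x xc xt B by (rule run)
  let ?n = "dimn P"
  obtain a c b where b: "b \<in> Rn ?n"
    and h: "\<And>u. u \<in> Rn ?n \<Longrightarrow> hreg P u = ereal (a / 2 * (norm u)\<^sup>2 + b \<bullet> u + c)"
    using quad unfolding scalar_quadratic_def by blast
  have hdom: "hdom P = Rn ?n" using h by (auto simp: edom_def)
  have hr: "h_real P u = a / 2 * (u \<bullet> u) + b \<bullet> u + c" if "u \<in> Rn ?n" for u
    using h[OF that] by (simp add: power2_norm_eq_inner)
  \<comment> \<open>Strong convexity along a coordinate axis bounds the Hessian factor from below, so \<open>a + 1 / lam\<close> is positive.\<close>
  have a_ge: "\<mu> \<le> a"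
  proof -
    let ?e = "unit_vec 0"
    have e: "?e \<in> Rn ?n" "0 \<in> Rn ?n" "(1 / 2) *\<^sub>R ?e \<in> Rn ?n"
      using \<open>1 \<le> dimn P\<close> subspace_Rn[of ?n] by (auto simp: unit_vec_Rn subspace_0 subspace_scale)
    have "h_real P ((1 / 2) *\<^sub>R ?e + (1 - 1 / 2) *\<^sub>R 0) \<le> 1 / 2 * h_real P ?e + (1 - 1 / 2) * h_real P 0
      - 1 / 2 * (1 - 1 / 2) * \<mu> / 2 * (norm (?e - 0))\<^sup>2"
      by (rule h_mu_convex) (use e in \<open>auto simp: hdom\<close>)
    then have "a / 8 + coord b 0 / 2 + c \<le> (a / 2 + coord b 0 + c) / 2 + c / 2 - \<mu> / 8"
      using e by (simp add: hr coord_unit_vec)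
    then show ?thesis by argo
  qed
  have gr: "grad ?n (hreg P) u = a *\<^sub>R u + b" if "u \<in> Rn ?n" for u
    using grad_scalar_quadratic[OF h b that] .
  fix j
  let ?G = "\<lambda>j. (\<lambda>i. fsub P (x i)) ` {..<j} \<union> (\<lambda>i. grad ?n (hreg P) (x i)) ` {..<j}"
  assume IH: "\<And>i. i < j \<Longrightarrow> x i - x 0 \<in> span (?G i)"
  show "x j - x 0 \<in> span (?G j)"
  proof (cases j)
    case 0
    then show ?thesis by simp
  next
    case (Suc i)
    let ?V = "span (?G j)" and ?y = "x j" and ?B = "B (Suc i)" and ?c = "xc i"
    have xV: "x l - x 0 \<in> ?V" if "l \<le> i" for l
    proof -
      have "l < j" using that Suc by simp
      then have "?G l \<subseteq> ?G j" by (intro Un_mono image_mono) auto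
      then show ?thesis using IH[OF \<open>l < j\<close>] span_mono by blast
    qed
    obtain p where p: "p \<in> ?V" "\<forall>v\<in>?V. (?y - x 0 - p) \<bullet> v = 0"
      using orthogonal_projection_finite_span[of "?G j" "?y - x 0"] by auto
    define d where "d = ?y - x 0 - p"
    have orth: "d \<bullet> v = 0" if "v \<in> ?V" for v using p(2) that by (simp add: d_def)
    have xR: "x l \<in> Rn ?n" for l using x_mem hdom by simp
    have "?G j \<subseteq> Rn ?n"
      using in_class xR subspace_Rn[of ?n] b hdom
      by (auto simp: gr inst_class_def A1_def subdifferential_def subspace_add subspace_scale)
    then have "?V \<subseteq> Rn ?n" by (rule span_minimal[OF _ subspace_Rn])
    then have pR: "x 0 + p \<in> Rn ?n" using p xR subspace_Rn[of ?n] by (auto intro: subspace_add)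
    have y: "?y = x 0 + p + d" by (simp add: d_def)
    have "lin w ?y = lin w (x 0 + p)" if "w \<in> ?B" for w
    proof -
      have "fsub P w \<in> ?V" using that bundle_subset[of i] Suc by (auto intro!: span_base)
      then have "fsub P w \<bullet> d = 0" using orth inner_commute[of d "fsub P w"] by simp
      then show ?thesis unfolding lin_def y by (simp add: inner_add_right inner_diff_right)
    qed
    then have "cutting_model ?B ?y = cutting_model ?B (x 0 + p)" by (simp add: cutting_model_def)
    moreover have "h_real P ?y = h_real P (x 0 + p) + a / 2 * (d \<bullet> d)"
    proof -
      have "grad ?n (hreg P) (x 0) \<in> ?V" using Suc by (auto intro!: span_base)
      then have "d \<bullet> (a *\<^sub>R x 0 + b) = 0" using orth gr[OF xR] by simp
      moreover have "d \<bullet> p = 0" using orth p by simp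
      ultimately have "a * (d \<bullet> (x 0 + p)) + d \<bullet> b = 0"
        by (simp add: inner_add_right algebra_simps)
      moreover have "h_real P (x 0 + p + d) = a / 2 * ((x 0 + p) \<bullet> (x 0 + p)) + b \<bullet> (x 0 + p) + c
        + (a * (d \<bullet> (x 0 + p)) + d \<bullet> b) + a / 2 * (d \<bullet> d)"
        using hr[OF xR[of j]] unfolding y[symmetric] unfolding y inner_add_left[of "x 0 + p" d]
          inner_add_right[of _ "x 0 + p" d] inner_commute[of "x 0 + p" d] inner_commute[of b d]
        by (simp add: algebra_simps)
      ultimately show ?thesis using hr[OF pR] y by simp
    qed
    moreover have "(norm (?y - ?c))\<^sup>2 = (norm (x 0 + p - ?c))\<^sup>2 + d \<bullet> d"
    proof -
      obtain l where l: "l \<le> i" "?c = x l" using xc_mem_iterates[of i] by auto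
      have "p - (?c - x 0) \<in> ?V" using p xV[OF l(1)] l(2) by (simp add: span_diff)
      then have "d \<bullet> (p - (?c - x 0)) = 0" by (rule orth)
      then have o: "d \<bullet> (x 0 + p - ?c) = 0" by (simp add: algebra_simps)
      have "?y - ?c = (x 0 + p - ?c) + d" by (simp add: y)
      then show ?thesis using o
        unfolding power2_norm_eq_inner
        by (simp only: inner_add_left inner_add_right inner_commute[of "x 0 + p - ?c" d])
    qed
    ultimately have "prox_model lam ?B ?c ?y = prox_model lam ?B ?c (x 0 + p) + (a + 1 / lam) / 2 * (d \<bullet> d)"
      using lam_pos by (simp add: prox_model_def field_simps)
    moreover have "prox_model lam ?B ?c ?y \<le> prox_model lam ?B ?c (x 0 + p)"
      using x_min[of "x 0 + p" i] pR Suc by (simp add: hdom)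
    moreover have "0 < (a + 1 / lam) / 2" using a_ge mu_ge_0 lam_pos by (simp add: add_nonneg_pos)
    ultimately have "d \<bullet> d \<le> 0" by (simp add: mult_le_0_iff)
    then have "d = 0" using inner_ge_zero[of d] by simp
    then show ?thesis using p(1) by (simp add: y)
  qed
qed

end


section \<open>The resisting instance\<close>

lemma continuous_lsc_fun_on:
  assumes "continuous_on UNIV (g :: fseq \<Rightarrow> real)"
  shows "lsc_fun_on n (\<lambda>x. ereal (g x))"
  unfolding lsc_fun_on_def
proof
  fix x assume "x \<in> Rn n"
  show "ereal (g x) \<le> Liminf (at x within Rn n) (\<lambda>x. ereal (g x))"
  proof (cases "at x within Rn n = bot")
    case False
    have "(g \<longlongrightarrow> g x) (at x within Rn n)"
      using assms by (metis UNIV_I continuous_on_def tendsto_within_subset subset_UNIV)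
    then have lim: "((\<lambda>x. ereal (g x)) \<longlongrightarrow> ereal (g x)) (at x within Rn n)" by simp
    show ?thesis unfolding lim_imp_Liminf[OF False lim] by simp
  qed simp
qed

lemma Rn_mono: "m \<le> n \<Longrightarrow> Rn m \<subseteq> Rn n"
  by (auto simp: Rn_def)

text \<open>
Including \<open>- \<tau>\<close> in the maximum keeps \<open>f\<close> bounded below, so that minimizers exist for \<open>\<mu> = 0\<close> as well.
\<close>

definition floored_max :: "nat \<Rightarrow> real \<Rightarrow> fseq \<Rightarrow> real" where
  "floored_max n \<tau> x = Max (insert (- \<tau>) (coord x ` {..<n}))"

text \<open>
The choice of the least maximal coordinate is what makes the oracle resisting: at a point that vanishes
from coordinate \<open>i\<close> on, it never points beyond \<open>i\<close>.
\<close>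

definition resisting_problem :: "nat \<Rightarrow> real \<Rightarrow> real \<Rightarrow> real \<Rightarrow> problem" where
  "resisting_problem n M \<tau> \<mu> = \<lparr> dimn = n, start = 0,
     fobj = (\<lambda>x. ereal (M * floored_max n \<tau> x)),
     fsub = (\<lambda>x. if \<exists>i<n. coord x i = floored_max n \<tau> x
       then M *\<^sub>R unit_vec (LEAST i. i < n \<and> coord x i = floored_max n \<tau> x) else 0),
     hreg = (\<lambda>x. ereal (\<mu> * (norm x)\<^sup>2 / 2)) \<rparr>"

lemma floored_max_le_iff: "floored_max n \<tau> x \<le> c \<longleftrightarrow> - \<tau> \<le> c \<and> (\<forall>i<n. coord x i \<le> c)"
  by (auto simp: floored_max_def)

lemma floored_max_ge: "- \<tau> \<le> floored_max n \<tau> x" "i < n \<Longrightarrow> coord x i \<le> floored_max n \<tau> x"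
  using floored_max_le_iff[of n \<tau> x "floored_max n \<tau> x"] by auto

lemma floored_max_cases: "floored_max n \<tau> x = - \<tau> \<or> (\<exists>i<n. coord x i = floored_max n \<tau> x)"
proof -
  have "floored_max n \<tau> x \<in> insert (- \<tau>) (coord x ` {..<n})"
    unfolding floored_max_def by (rule Max_in) auto
  then show ?thesis by auto
qed

lemma abs_coord_le_norm: "\<bar>coord x i\<bar> \<le> norm x"
  using Cauchy_Schwarz_ineq2[of x "unit_vec i"] by simp

lemma floored_max_lipschitz: "floored_max n \<tau> x - floored_max n \<tau> y \<le> norm (x - y)"
proof -
  have "coord x i \<le> floored_max n \<tau> y + norm (x - y)" if "i < n" for i
    using floored_max_ge(2)[OF that, of y \<tau>] abs_coord_le_norm[of "x - y" i] by simp
  moreover have "- \<tau> \<le> floored_max n \<tau> y + norm (x - y)"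
    using floored_max_ge(1)[of \<tau> n y] norm_ge_zero[of "x - y"] by linarith
  ultimately show ?thesis using floored_max_le_iff[of n \<tau> x "floored_max n \<tau> y + norm (x - y)"] by simp
qed

lemma continuous_floored_max: "continuous_on UNIV (floored_max n \<tau>)"
proof -
  have "1-lipschitz_on UNIV (floored_max n \<tau>)"
  proof (rule lipschitz_onI)
    show "dist (floored_max n \<tau> x) (floored_max n \<tau> y) \<le> 1 * dist x y" for x y
      using floored_max_lipschitz[of n \<tau> x y] floored_max_lipschitz[of n \<tau> y x]
      by (simp add: dist_norm norm_minus_commute abs_le_iff)
  qed simp
  then show ?thesis by (rule lipschitz_on_continuous_on)
qed

lemma floored_max_convex:
  assumes "0 \<le> \<alpha>" "\<alpha> \<le> 1"
  shows "floored_max n \<tau> (\<alpha> *\<^sub>R x + (1 - \<alpha>) *\<^sub>R y) \<le> \<alpha> * floored_max n \<tau> x + (1 - \<alpha>) * floored_max n \<tau> y"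
  unfolding floored_max_le_iff
proof (intro conjI allI impI)
  have "\<alpha> * (- \<tau>) + (1 - \<alpha>) * (- \<tau>) \<le> \<alpha> * floored_max n \<tau> x + (1 - \<alpha>) * floored_max n \<tau> y"
    using assms floored_max_ge(1) by (intro add_mono mult_left_mono) auto
  then show "- \<tau> \<le> \<alpha> * floored_max n \<tau> x + (1 - \<alpha>) * floored_max n \<tau> y" by (simp add: algebra_simps)
  show "coord (\<alpha> *\<^sub>R x + (1 - \<alpha>) *\<^sub>R y) i \<le> \<alpha> * floored_max n \<tau> x + (1 - \<alpha>) * floored_max n \<tau> y"
    if "i < n" for i
    using assms floored_max_ge(2)[OF that] by (auto intro!: add_mono mult_left_mono)
qed

text \<open>
A minimizer is the point \<open>w\<close> whose \<open>n\<close> coordinates all equal \<open>- \<tau>\<close>. For this the slope \<open>M\<close> of \<open>f\<close> has to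
outweigh the slope \<open>\<mu> n \<tau>\<close> of \<open>h\<close> at \<open>w\<close>, which is the bound on \<open>\<mu> n \<tau>\<close>; it also ensures that \<open>h\<close>
cancels at most half of \<open>f\<close> at \<open>w\<close>. The bound on \<open>n \<tau>\<^sup>2\<close> places \<open>w\<close> within \<open>R0\<close> of the origin.
\<close>

lemma resisting_problem_in_class:
  fixes n :: nat and M \<tau> \<mu> R0 :: real
  assumes "1 \<le> n" "0 \<le> M" "0 \<le> \<mu>" "0 \<le> \<tau>" "0 \<le> R0" and tau_mu: "\<mu> * n * \<tau> \<le> M" and tau_R: "n * \<tau>\<^sup>2 \<le> R0\<^sup>2"
  shows "resisting_problem n M \<tau> \<mu> \<in> inst_class_u \<mu> M R0"
    "phi_star (resisting_problem n M \<tau> \<mu>) \<le> ereal (- (M * \<tau> / 2))"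
proof -
  let ?P = "resisting_problem n M \<tau> \<mu>" and ?m = "floored_max n \<tau>"
  have sel: "dimn ?P = n" "start ?P = 0" "fobj ?P = (\<lambda>x. ereal (M * ?m x))"
    "hreg ?P = (\<lambda>x. ereal (\<mu> * (norm x)\<^sup>2 / 2))"
    by (auto simp: resisting_problem_def)
  have dom: "edom n (\<lambda>x. ereal (g x)) = Rn n" for g by (simp add: edom_def)
  have proper: "proper_on n (\<lambda>x. ereal (g x))" for g
    using subspace_0[OF subspace_Rn[of n]] by (auto simp: proper_on_def dom)
  have fsub: "fsub ?P x \<in> subdifferential n (fobj ?P) x \<and> norm (fsub ?P x) \<le> M" for x
  proof (cases "\<exists>i<n. coord x i = ?m x")
    case True
    define i where "i = (LEAST i. i < n \<and> coord x i = ?m x)"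
    have i: "i < n" "coord x i = ?m x"
      using LeastI_ex[of "\<lambda>i. i < n \<and> coord x i = ?m x"] True by (auto simp: i_def)
    have s: "fsub ?P x = M *\<^sub>R unit_vec i" using True by (simp add: resisting_problem_def i_def)
    have "M * ?m x + M * (coord u i - coord x i) \<le> M * ?m u" for u
    proof -
      have "M * coord u i \<le> M * ?m u" using floored_max_ge(2)[OF i(1)] \<open>0 \<le> M\<close> by (rule mult_left_mono)
      then show ?thesis by (simp add: i(2) algebra_simps)
    qed
    then show ?thesis using \<open>0 \<le> M\<close> unit_vec_Rn[OF i(1)] subspace_Rn[of n]
      by (simp add: s subdifferential_def sel subspace_scale)
  next
    case False
    then have s: "fsub ?P x = 0" and m: "?m x = - \<tau>"
      using floored_max_cases[of n \<tau> x] by (auto simp: resisting_problem_def)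
    have "M * ?m x \<le> M * ?m u" for u
      unfolding m using floored_max_ge(1) \<open>0 \<le> M\<close> by (rule mult_left_mono)
    then show ?thesis using \<open>0 \<le> M\<close> subspace_0[OF subspace_Rn[of n]]
      by (simp add: s subdifferential_def sel)
  qed
  have convf: "econvex_on n (fobj ?P)"
  proof -
    have "M * ?m (\<alpha> *\<^sub>R x + (1 - \<alpha>) *\<^sub>R y) \<le> \<alpha> * (M * ?m x) + (1 - \<alpha>) * (M * ?m y)"
      if "0 \<le> \<alpha>" "\<alpha> \<le> 1" for \<alpha> x y
      using mult_left_mono[OF floored_max_convex[OF that, of n \<tau> x y] \<open>0 \<le> M\<close>] by (simp add: algebra_simps)
    then show ?thesis by (simp add: econvex_on_def sel)
  qed
  have hmu: "\<mu> * (norm (\<alpha> *\<^sub>R x + (1 - \<alpha>) *\<^sub>R y))\<^sup>2 / 2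
    = \<alpha> * (\<mu> * (norm x)\<^sup>2 / 2) + (1 - \<alpha>) * (\<mu> * (norm y)\<^sup>2 / 2) - \<alpha> * (1 - \<alpha>) * \<mu> / 2 * (norm (x - y))\<^sup>2"
    for \<alpha> and x y :: fseq
    unfolding norm_sq_convex_combination[of \<alpha> x y 0, unfolded diff_0_right]
    by (simp add: algebra_simps add_divide_distrib diff_divide_distrib)
  have convh: "econvex_on n (hreg ?P)"
  proof -
    have "0 \<le> \<alpha> * (1 - \<alpha>) * \<mu> / 2 * (norm (x - y))\<^sup>2" if "0 \<le> \<alpha>" "\<alpha> \<le> 1" for \<alpha> and x y :: fseq
      using that \<open>0 \<le> \<mu>\<close> by simp
    then show ?thesis by (simp add: econvex_on_def sel hmu)
  qed
  have muh: "mu_convex_on n \<mu> (hreg ?P)" by (simp add: mu_convex_on_def sel hmu)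
  have lsc: "lsc_fun_on n (fobj ?P)" "lsc_fun_on n (hreg ?P)"
    unfolding sel by (auto intro!: continuous_lsc_fun_on continuous_intros continuous_floored_max)
  define w where "w = (\<Sum>i<n. (- \<tau>) *\<^sub>R unit_vec i)"
  have cw: "coord w i = (if i < n then - \<tau> else 0)" for i
    by (simp add: w_def coord_sum coord_unit_vec if_distrib cong: if_cong)
  have wR: "w \<in> Rn n" by (simp add: Rn_def cw)
  have nw: "(norm w)\<^sup>2 = n * \<tau>\<^sup>2" by (simp add: norm_Rn[OF wR] cw)
  have mw: "?m w = - \<tau>"
    by (rule antisym) (auto simp: floored_max_le_iff cw floored_max_ge)
  have wmin: "M * ?m w + \<mu> * (norm w)\<^sup>2 / 2 \<le> M * ?m u + \<mu> * (norm u)\<^sup>2 / 2" if u: "u \<in> Rn n" for u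
  proof -
    have "(norm u)\<^sup>2 = (norm w)\<^sup>2 + 2 * (w \<bullet> (u - w)) + (norm (u - w))\<^sup>2"
      by (simp add: power2_norm_eq_inner algebra_simps inner_commute)
    then have "(norm w)\<^sup>2 + 2 * (w \<bullet> (u - w)) \<le> (norm u)\<^sup>2" by simp
    then have "\<mu> * ((norm w)\<^sup>2 + 2 * (w \<bullet> (u - w))) \<le> \<mu> * (norm u)\<^sup>2" using \<open>0 \<le> \<mu>\<close> by (rule mult_left_mono)
    then have 1: "\<mu> * (norm w)\<^sup>2 / 2 + \<mu> * (w \<bullet> (u - w)) \<le> \<mu> * (norm u)\<^sup>2 / 2" by (simp add: algebra_simps)
    have "w \<bullet> (u - w) = (\<Sum>i<n. - \<tau> * (coord u i + \<tau>))"
      unfolding inner_Rn[OF wR] by (intro sum.cong) (auto simp: cw)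
    moreover have "(\<Sum>i<n. - \<tau> * (?m u + \<tau>)) \<le> (\<Sum>i<n. - \<tau> * (coord u i + \<tau>))"
      using floored_max_ge(2) \<open>0 \<le> \<tau>\<close> by (intro sum_mono mult_left_mono_neg) auto
    ultimately have "- (n * \<tau> * (?m u + \<tau>)) \<le> w \<bullet> (u - w)" by simp
    then have "\<mu> * - (n * \<tau> * (?m u + \<tau>)) \<le> \<mu> * (w \<bullet> (u - w))" using \<open>0 \<le> \<mu>\<close> by (rule mult_left_mono)
    moreover have "\<mu> * n * \<tau> * (?m u + \<tau>) \<le> M * (?m u + \<tau>)"
      using tau_mu floored_max_ge(1)[of \<tau> n u] by (intro mult_right_mono) auto
    ultimately show ?thesis using 1 by (simp add: mw algebra_simps)
  qed
  have phi: "phi ?P u = ereal (M * ?m u + \<mu> * (norm u)\<^sup>2 / 2)" for u by (simp add: phi_def sel)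
  have wM: "w \<in> minimizers ?P" using wR wmin by (simp add: minimizers_def argmin_on_def sel phi)
  have "dist0 ?P \<le> dist 0 w" unfolding dist0_def sel using wM by (rule infdist_le)
  also have "dist 0 w = norm w" by (simp add: dist_norm)
  also have "norm w \<le> R0"
    by (rule power2_le_imp_le[OF _ \<open>0 \<le> R0\<close>]) (use tau_R in \<open>simp only: nw\<close>)
  finally have "dist0 ?P \<le> R0" .
  moreover have "proper_on n (fobj ?P)" "proper_on n (hreg ?P)" unfolding sel by (rule proper)+
  then have "A1 ?P" using lsc convf convh fsub by (simp add: A1_def sel(1)) (simp add: sel dom)
  moreover have "A3 \<mu> M ?P" unfolding A3_def sel(1) using muh fsub by blast
  moreover have "A2 ?P" using wM by (auto simp: A2_def)
  ultimately show "?P \<in> inst_class_u \<mu> M R0"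
    using \<open>1 \<le> n\<close> subspace_0[OF subspace_Rn[of n]] by (simp add: inst_class_u_def inst_class_def sel dom)
  have "phi_star ?P \<le> phi ?P w" unfolding phi_star_def sel by (rule INF_lower[OF wR])
  also have "\<dots> \<le> ereal (- (M * \<tau> / 2))"
    unfolding phi mw nw using mult_right_mono[OF tau_mu \<open>0 \<le> \<tau>\<close>]
    by (simp add: power2_eq_square mult.assoc)
  finally show "phi_star ?P \<le> ereal (- (M * \<tau> / 2))" .
qed

text \<open>
Each iterate is supported on one coordinate more than the preceding ones at most, so the last point of
a run of at most \<open>n\<close> points has a vanishing coordinate, and there \<open>\<phi> \<ge> 0\<close> exceeds \<open>\<phi>\<^sup>* + \<epsilon>\<close>.
\<close>

lemma resisting_problem_run_length:
  fixes n :: nat and M \<tau> \<mu> :: real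
  assumes "0 \<le> M" "0 \<le> \<mu>" "0 \<le> \<tau>" and eps: "\<epsilon> < M * \<tau> / 2"
    and star: "phi_star (resisting_problem n M \<tau> \<mu>) \<le> ereal (- (M * \<tau> / 2))"
    and run: "admissible_run \<epsilon> (resisting_problem n M \<tau> \<mu>) xs"
  shows "n + 1 \<le> length xs"
proof (rule ccontr)
  assume "\<not> ?thesis"
  then have len: "length xs \<le> n" by simp
  let ?P = "resisting_problem n M \<tau> \<mu>" and ?m = "floored_max n \<tau>"
  have sel: "dimn ?P = n" "start ?P = 0" "fobj ?P = (\<lambda>x. ereal (M * ?m x))"
    "hreg ?P = (\<lambda>x. ereal (\<mu> * (norm x)\<^sup>2 / 2))"
    by (auto simp: resisting_problem_def)
  have quad: "scalar_quadratic n (hreg ?P)"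
    unfolding scalar_quadratic_def sel
    by (rule exI[of _ \<mu>], rule exI[of _ 0], rule bexI[of _ 0]) (auto simp: subspace_0[OF subspace_Rn])
  have ne: "xs \<noteq> []" and x0: "xs ! 0 = 0" and xR: "set xs \<subseteq> Rn n"
    and sol: "\<And>j. j < length xs \<Longrightarrow> eps_solution \<epsilon> ?P (xs ! j) \<longleftrightarrow> j = length xs - 1"
    and spn: "\<And>j. j \<in> {1..<length xs} \<Longrightarrow> \<exists>v\<in>span ((\<lambda>i. fsub ?P (xs ! i)) ` {..<j} \<union>
        (\<lambda>i. grad n (hreg ?P) (xs ! i)) ` {..<j}). xs ! j = 0 + v"
    using run quad by (auto simp: admissible_run_def sel)
  have nonneg: "0 \<le> ?m u" if "u \<in> Rn j" "j < n" for u j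
    using floored_max_ge(2)[OF that(2), of u \<tau>] that(1) by (simp add: Rn_def)
  have supp: "xs ! j \<in> Rn j" if "j < length xs" for j
    using that
  proof (induction j rule: less_induct)
    case (less j)
    show ?case
    proof (cases "j = 0")
      case True
      then show ?thesis using x0 subspace_0[OF subspace_Rn] by simp
    next
      case False
      have gen: "fsub ?P (xs ! i) \<in> Rn j" "grad n (hreg ?P) (xs ! i) \<in> Rn j" if i: "i < j" for i
      proof -
        let ?u = "xs ! i"
        have uR: "?u \<in> Rn i" using less i by simp
        have un: "?u \<in> Rn n" using xR less i by auto
        have in_n: "i < n" using i less.prems len by simp
        have "grad n (hreg ?P) ?u = \<mu> *\<^sub>R ?u + 0"
          by (rule grad_scalar_quadratic[where c = 0]) (auto simp: sel subspace_0[OF subspace_Rn] un)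
        moreover have "?u \<in> Rn j" using uR Rn_mono[of i j] i by auto
        ultimately show "grad n (hreg ?P) ?u \<in> Rn j" using subspace_Rn[of j] by (simp add: subspace_scale)
        have ui: "coord ?u i = 0" using uR by (simp add: Rn_def)
        show "fsub ?P ?u \<in> Rn j"
        proof (cases "\<exists>l<n. coord ?u l = ?m ?u")
          case True
          define l where "l = (LEAST l. l < n \<and> coord ?u l = ?m ?u)"
          have l: "l < n" "coord ?u l = ?m ?u"
            using LeastI_ex[of "\<lambda>l. l < n \<and> coord ?u l = ?m ?u"] True by (auto simp: l_def)
          \<comment> \<open>If the maximum is zero, coordinate \<open>i\<close> attains it; otherwise only coordinates in the support can.\<close>
          have "l \<le> i"
          proof (cases "?m ?u = 0")
            case True
            then show ?thesis unfolding l_def using ui in_n by (intro Least_le) simp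
          next
            case False
            then have "coord ?u l \<noteq> 0" using l by simp
            then show ?thesis using uR by (auto simp: Rn_def intro: ccontr)
          qed
          then have "unit_vec l \<in> Rn j" using i by (intro unit_vec_Rn) simp
          then show ?thesis using True subspace_Rn[of j]
            by (simp add: resisting_problem_def l_def[symmetric] subspace_scale)
        next
          case False
          then show ?thesis by (auto simp: resisting_problem_def subspace_0[OF subspace_Rn])
        qed
      qed
      obtain v where v: "v \<in> span ((\<lambda>i. fsub ?P (xs ! i)) ` {..<j} \<union>
          (\<lambda>i. grad n (hreg ?P) (xs ! i)) ` {..<j})" "xs ! j = 0 + v"
        using spn[of j] False less.prems by auto
      have "span ((\<lambda>i. fsub ?P (xs ! i)) ` {..<j} \<union> (\<lambda>i. grad n (hreg ?P) (xs ! i)) ` {..<j}) \<subseteq> Rn j"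
        by (rule span_minimal[OF _ subspace_Rn]) (use gen in auto)
      then show ?thesis using v by auto
    qed
  qed
  define j where "j = length xs - 1"
  have j: "j < length xs" "j < n" using ne len by (cases xs; auto simp: j_def)+
  define y where "y = xs ! j"
  have "eps_solution \<epsilon> ?P y" using sol[OF j(1)] by (simp add: j_def y_def)
  then have "phi ?P y - phi_star ?P \<le> ereal \<epsilon>" by (simp add: eps_solution_def)
  moreover have "phi ?P y = ereal (M * ?m y + \<mu> * (norm y)\<^sup>2 / 2)" by (simp add: phi_def sel)
  moreover have "0 \<le> M * ?m y + \<mu> * (norm y)\<^sup>2 / 2"
    using nonneg[OF supp[OF j(1)] j(2)] assms by (simp add: y_def)
  ultimately show False using star eps by (cases "phi_star ?P") auto
qed

text \<open>
With \<open>\<tau> = 3 \<epsilon> / M\<close> the optimal value lies \<open>3 \<epsilon> / 2 > \<epsilon>\<close> below zero, and the two conditions on \<open>n\<close> are exactly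
those of the resisting instance. For \<open>n = 0\<close> any instance serves, since every run has a point; the
resisting one with \<open>\<tau> = 0\<close> in dimension one shows that the class is inhabited.
\<close>

lemma lower_complexity_bound_of_class:
  fixes n :: nat and M \<mu> R0 \<epsilon> :: real
  assumes pos: "0 < M" "0 \<le> \<mu>" "0 < R0" "0 < \<epsilon>"
    and n_R: "9 * \<epsilon>\<^sup>2 * n \<le> M\<^sup>2 * R0\<^sup>2" and n_mu: "3 * \<mu> * \<epsilon> * n \<le> M\<^sup>2"
    and sub: "inst_class_u \<mu> M R0 \<subseteq> I"
  shows "lower_complexity_bound I \<epsilon> (real n + 1)"
proof (cases "n = 0")
  case True
  have "resisting_problem 1 M 0 \<mu> \<in> I"
    using resisting_problem_in_class(1)[of 1 M \<mu> 0 R0] pos sub by auto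
  moreover have "1 \<le> length (alg P)" if "alg \<in> alg_class I \<epsilon>" "P \<in> I" for alg P
    using that by (cases "alg P") (auto simp: alg_class_def admissible_run_def)
  ultimately show ?thesis using True unfolding lower_complexity_bound_def by fastforce
next
  case False
  define \<tau> where "\<tau> = 3 * \<epsilon> / M"
  let ?P = "resisting_problem n M \<tau> \<mu>"
  have tau: "0 \<le> \<tau>" "\<epsilon> < M * \<tau> / 2" using pos by (auto simp: \<tau>_def)
  have "\<mu> * n * \<tau> \<le> M" using n_mu pos by (simp add: \<tau>_def field_simps power2_eq_square)
  moreover have "n * \<tau>\<^sup>2 \<le> R0\<^sup>2"
    using n_R pos by (simp add: \<tau>_def field_simps power_mult_distrib power_divide)
  ultimately have P: "?P \<in> inst_class_u \<mu> M R0" "phi_star ?P \<le> ereal (- (M * \<tau> / 2))"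
    using resisting_problem_in_class[of n M \<mu> \<tau> R0] False pos tau by auto
  have "real n + 1 \<le> length (alg ?P)" if "alg \<in> alg_class I \<epsilon>" for alg
  proof -
    have "admissible_run \<epsilon> ?P (alg ?P)" using that P(1) sub by (auto simp: alg_class_def)
    then have "n + 1 \<le> length (alg ?P)"
      using resisting_problem_run_length[OF _ _ tau P(2)] pos by simp
    then show ?thesis by linarith
  qed
  then show ?thesis using P(1) sub unfolding lower_complexity_bound_def by blast
qed


section \<open>Length of the runs in the instance classes\<close>

context instance_in_class
begin

lemma stop_at_first_admissible:
  assumes run: "bundle_run (hdom P) (f_real P) (h_real P) (fsub P) M \<mu> z lam \<delta> x xc xt B"
    and x0: "x 0 = start P"
    and k: "eps_solution \<epsilon> P (x k)" "\<And>i. i < k \<Longrightarrow> \<not> eps_solution \<epsilon> P (x i)"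
  shows "admissible_run \<epsilon> P (stop_at_first \<epsilon> P x)" "length (stop_at_first \<epsilon> P x) = Suc k"
proof -
  interpret bundle_run "hdom P" "f_real P" "h_real P" "fsub P" M \<mu> z lam \<delta> x xc xt B by (rule run)
  have "(LEAST k. eps_solution \<epsilon> P (x k)) = k"
    by (rule Least_equality) (use k not_le in blast)+
  then have eq: "stop_at_first \<epsilon> P x = map x [0..<Suc k]" by (simp add: stop_at_first_def)
  show "length (stop_at_first \<epsilon> P x) = Suc k" by (simp add: eq)
  have nth: "map x [0..<Suc k] ! i = x i" if "i < Suc k" for i
    using that by (simp del: upt_Suc)
  have span: "\<exists>v\<in>span ((\<lambda>i. fsub P (map x [0..<Suc k] ! i)) ` {..<j} \<union>
      (\<lambda>i. grad (dimn P) (hreg P) (map x [0..<Suc k] ! i)) ` {..<j}). map x [0..<Suc k] ! j = start P + v"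
    if "scalar_quadratic (dimn P) (hreg P)" "j \<in> {1..<Suc k}" for j
  proof (rule bexI[of _ "x j - x 0"])
    show "map x [0..<Suc k] ! j = start P + (x j - x 0)" using that x0 by (simp add: nth del: upt_Suc)
    have "1 \<le> dimn P" using in_class by (simp add: inst_class_def)
    have "x j - x 0 \<in> span ((\<lambda>i. fsub P (x i)) ` {..<j} \<union> (\<lambda>i. grad (dimn P) (hreg P) (x i)) ` {..<j})"
      by (rule iterates_in_gradient_span[OF run that(1) \<open>1 \<le> dimn P\<close>])
    moreover have "(\<lambda>i. fsub P (map x [0..<Suc k] ! i)) ` {..<j} = (\<lambda>i. fsub P (x i)) ` {..<j}"
      "(\<lambda>i. grad (dimn P) (hreg P) (map x [0..<Suc k] ! i)) ` {..<j} = (\<lambda>i. grad (dimn P) (hreg P) (x i)) ` {..<j}"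
      using that(2) by (auto intro!: image_cong simp: nth simp del: upt_Suc)
    ultimately show "x j - x 0 \<in> span ((\<lambda>i. fsub P (map x [0..<Suc k] ! i)) ` {..<j} \<union>
      (\<lambda>i. grad (dimn P) (hreg P) (map x [0..<Suc k] ! i)) ` {..<j})" by simp
  qed
  have "set (map x [0..<Suc k]) \<subseteq> Rn (dimn P)" using x_mem hdom_Rn by auto
  moreover have "eps_solution \<epsilon> P (map x [0..<Suc k] ! j) \<longleftrightarrow> j = k" if "j < Suc k" for j
    using k that by (cases "j = k") (auto simp: nth simp del: upt_Suc)
  ultimately show "admissible_run \<epsilon> P (stop_at_first \<epsilon> P x)"
    unfolding admissible_run_def eq using span x0 nth[of 0] by (simp del: upt_Suc)
qed

text \<open>
The quantity \<open>a\<close> is the bound for the first gap of a cycle in units of \<open>K\<close>, for which the two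
parameter regimes supply different values.
\<close>

lemma rpb_run_length:
  assumes iter: "rpb_iterates P lam (\<epsilon> / 2) x" and pos: "0 < lam" "0 < \<epsilon>" and a: "0 \<le> a"
    and z: "norm (start P - z) \<le> 2 * R0"
    and start_gap: "\<And>xc xt B j. bundle_run (hdom P) (f_real P) (h_real P) (fsub P) M \<mu> z lam (\<epsilon> / 2) x xc xt B \<Longrightarrow>
      xc j = x j \<Longrightarrow> norm (xc j - z) \<le> norm (x 0 - z) \<Longrightarrow>
      bundle_run.t (f_real P) (h_real P) (fsub P) lam x xc xt B j \<le> a * bundle_run.K M \<mu> lam"
  shows "admissible_run \<epsilon> P (stop_at_first \<epsilon> P x)"
    "\<exists>s::nat. real (length (stop_at_first \<epsilon> P x))
        \<le> (16 * (1 + a) * (M\<^sup>2 / ((1 / lam + \<mu>) * \<epsilon>)) + 2) * (real s + 1) + 2 \<and>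
      lam * \<epsilon> * (\<Sum>i<s. (1 + lam * \<mu>) ^ i) \<le> 4 * R0\<^sup>2"
proof -
  obtain xc xt B where run: "bundle_run (hdom P) (f_real P) (h_real P) (fsub P) M \<mu> z lam (\<epsilon> / 2) x xc xt B"
    and x0: "x 0 = start P"
    using rpb_iterates_bundle_run[OF iter] pos by auto
  obtain k where k: "eps_solution (2 * (\<epsilon> / 2)) P (x k)" "\<And>i. i < k \<Longrightarrow> \<not> eps_solution (2 * (\<epsilon> / 2)) P (x i)"
    "\<exists>s::nat. real (Suc k) \<le> ((1 + a) * (8 * M\<^sup>2 / (1 / lam + \<mu>)) / (\<epsilon> / 2) + 2) * (real s + 1) + 2 \<and>
      2 * lam * (\<epsilon> / 2) * (\<Sum>i<s. (1 + lam * \<mu>) ^ i) \<le> (norm (x 0 - z))\<^sup>2"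
    using bundle_run_first_solution[OF run a start_gap[OF run]] by blast
  have k': "eps_solution \<epsilon> P (x k)" "\<And>i. i < k \<Longrightarrow> \<not> eps_solution \<epsilon> P (x i)" using k by auto
  show "admissible_run \<epsilon> P (stop_at_first \<epsilon> P x)"
    by (rule stop_at_first_admissible(1)[OF run x0 k'])
  have len: "length (stop_at_first \<epsilon> P x) = Suc k"
    by (rule stop_at_first_admissible(2)[OF run x0 k'])
  have "(norm (x 0 - z))\<^sup>2 \<le> (2 * R0)\<^sup>2" using z x0 by (intro power_mono) auto
  then have sq: "(norm (x 0 - z))\<^sup>2 \<le> 4 * R0\<^sup>2" by (simp add: power_mult_distrib)
  have W: "(1 + a) * (8 * M\<^sup>2 / (1 / lam + \<mu>)) / (\<epsilon> / 2) + 2 = 16 * (1 + a) * (M\<^sup>2 / ((1 / lam + \<mu>) * \<epsilon>)) + 2"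
    by simp
  obtain s :: nat where "real (Suc k) \<le> ((1 + a) * (8 * M\<^sup>2 / (1 / lam + \<mu>)) / (\<epsilon> / 2) + 2) * (real s + 1) + 2"
    "2 * lam * (\<epsilon> / 2) * (\<Sum>i<s. (1 + lam * \<mu>) ^ i) \<le> (norm (x 0 - z))\<^sup>2" using k(3) by blast
  then show "\<exists>s::nat. real (length (stop_at_first \<epsilon> P x))
        \<le> (16 * (1 + a) * (M\<^sup>2 / ((1 / lam + \<mu>) * \<epsilon>)) + 2) * (real s + 1) + 2 \<and>
      lam * \<epsilon> * (\<Sum>i<s. (1 + lam * \<mu>) ^ i) \<le> 4 * R0\<^sup>2"
    using sq unfolding W len by (intro exI[of _ s]) auto
qed

end

text \<open>
The factor \<open>2\<close> leaves room for approximating the infimum that defines the distance.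
\<close>

lemma near_minimizer:
  assumes "P \<in> inst_class \<mu> M R0" "0 < R0"
  obtains z where "z \<in> minimizers P" "norm (start P - z) \<le> 2 * R0"
proof -
  have ne: "minimizers P \<noteq> {}" and d: "infdist (start P) (minimizers P) < 2 * R0"
    using assms by (auto simp: inst_class_def A2_def dist0_def)
  have "(INF y\<in>minimizers P. dist (start P) y) < 2 * R0" using d ne by (simp add: infdist_notempty)
  then obtain z where "z \<in> minimizers P" "dist (start P) z < 2 * R0"
    using cInf_lessD[of "dist (start P) ` minimizers P"] ne by auto
  then show thesis using that by (auto simp: dist_norm)
qed

lemma rpb_algorithms_nonempty:
  assumes "I \<subseteq> inst_class \<mu> M R0" "0 < M" "0 \<le> \<mu>" "0 < R0" "0 < lam"
  shows "rpb_algorithms I \<epsilon> lam \<delta> \<noteq> {}"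
proof -
  have "\<exists>x. rpb_iterates P lam \<delta> x" if "P \<in> I" for P
  proof -
    have P: "P \<in> inst_class \<mu> M R0" using that assms by blast
    obtain z where "z \<in> minimizers P" using near_minimizer[OF P \<open>0 < R0\<close>] by blast
    then interpret instance_in_class P \<mu> M R0 z
      using P assms by unfold_locales auto
    show ?thesis by (rule rpb_iterates_exist[OF \<open>0 < lam\<close>])
  qed
  then obtain X where "\<And>P. P \<in> I \<Longrightarrow> rpb_iterates P lam \<delta> (X P)" by metis
  then have "(\<lambda>P. stop_at_first \<epsilon> P (X P)) \<in> rpb_algorithms I \<epsilon> lam \<delta>"
    unfolding rpb_algorithms_def by blast
  then show ?thesis by blast
qed

text \<open>
The stepsize and convexity conditions give \<open>\<kappa> \<le> (1 + C') M / R0\<close>. So \<open>2 R0\<close>, which bounds the distance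
of all centers to \<open>z\<close>, is at most \<open>2 (1 + C') M / \<kappa>\<close>, and first gaps are at most \<open>(2 + C') K\<close>.
\<close>

lemma rpb_length_large_stepsize:
  assumes P: "P \<in> inst_class \<mu> M R0" and pos: "0 < M" "0 \<le> \<mu>" "0 < R0" "0 < \<epsilon>" "0 < lam" "0 \<le> C'"
    and lam: "R0 / M \<le> lam" and mu: "\<mu> \<le> C' * M / R0"
    and iter: "rpb_iterates P lam (\<epsilon> / 2) x"
  shows "admissible_run \<epsilon> P (stop_at_first \<epsilon> P x)"
    "\<exists>s::nat. real (length (stop_at_first \<epsilon> P x))
        \<le> (16 * (3 + C') * (M\<^sup>2 / ((1 / lam + \<mu>) * \<epsilon>)) + 2) * (real s + 1) + 2 \<and>
      lam * \<epsilon> * (\<Sum>i<s. (1 + lam * \<mu>) ^ i) \<le> 4 * R0\<^sup>2"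
proof -
  obtain z where z: "z \<in> minimizers P" "norm (start P - z) \<le> 2 * R0"
    using near_minimizer[OF P \<open>0 < R0\<close>] by blast
  interpret instance_in_class P \<mu> M R0 z
    using P pos z by unfold_locales auto
  have "1 / lam \<le> M / R0" using lam pos by (simp add: field_simps)
  then have kap: "1 / lam + \<mu> \<le> (1 + C') * M / R0" using mu by (simp add: field_simps add_divide_distrib)
  have kap0: "0 < 1 / lam + \<mu>" using pos by (simp add: add_pos_nonneg)
  have radius: "2 * R0 \<le> (2 * (1 + C')) * M / (1 / lam + \<mu>)"
    using kap kap0 pos by (simp add: pos_le_divide_eq) (simp add: field_simps)
  have gap: "bundle_run.t (f_real P) (h_real P) (fsub P) lam x xc xt B j \<le> (2 + C') * bundle_run.K M \<mu> lam"
    if run: "bundle_run (hdom P) (f_real P) (h_real P) (fsub P) M \<mu> z lam (\<epsilon> / 2) x xc xt B"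
      and c: "xc j = x j" and d: "norm (xc j - z) \<le> norm (x 0 - z)" for xc xt B j
  proof -
    interpret bundle_run "hdom P" "f_real P" "h_real P" "fsub P" M \<mu> z lam "\<epsilon> / 2" x xc xt B by (rule run)
    have x0: "x 0 = start P" using rpb_iterates_bundle_run(1)[OF iter] pos by simp
    have "norm (xc j - z) \<le> 2 * R0" using d z x0 by simp
    from start_gap_strongly_convex[OF c this radius[folded \<kappa>_def]]
    have "t j \<le> (1 + (2 * (1 + C')) / 2) * K" .
    also have "1 + (2 * (1 + C')) / 2 = 2 + C'" by (simp add: field_simps)
    finally show ?thesis .
  qed
  note R = rpb_run_length[OF iter \<open>0 < lam\<close> \<open>0 < \<epsilon>\<close> _ z(2) gap]
  show "admissible_run \<epsilon> P (stop_at_first \<epsilon> P x)" using R(1) pos by simp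
  have "1 + (2 + C') = 3 + C'" by simp
  then show "\<exists>s::nat. real (length (stop_at_first \<epsilon> P x))
        \<le> (16 * (3 + C') * (M\<^sup>2 / ((1 / lam + \<mu>) * \<epsilon>)) + 2) * (real s + 1) + 2 \<and>
      lam * \<epsilon> * (\<Sum>i<s. (1 + lam * \<mu>) ^ i) \<le> 4 * R0\<^sup>2" using R(2) pos by simp
qed

lemma rpb_length_Lipschitz:
  assumes P: "P \<in> inst_class_0_Lip M R0 C" and pos: "0 < M" "0 < R0" "0 < \<epsilon>" "0 < lam" "0 \<le> C"
    and iter: "rpb_iterates P lam (\<epsilon> / 2) x"
  shows "admissible_run \<epsilon> P (stop_at_first \<epsilon> P x)"
    "\<exists>s::nat. real (length (stop_at_first \<epsilon> P x))
        \<le> (4 * (5 + C) * (lam * M\<^sup>2 / \<epsilon>) + 2) * (real s + 1) + 2 \<and>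
      lam * \<epsilon> * s \<le> 4 * R0\<^sup>2"
proof -
  have P0: "P \<in> inst_class 0 M R0" using P by (simp add: inst_class_0_Lip_def)
  obtain z where z: "z \<in> minimizers P" "norm (start P - z) \<le> 2 * R0"
    using near_minimizer[OF P0 \<open>0 < R0\<close>] by blast
  interpret instance_in_class P 0 M R0 z
    using P0 pos z by unfold_locales auto
  have Lip: "h_real P u - h_real P v \<le> C * M * norm (u - v)" if uv: "u \<in> hdom P" "v \<in> hdom P" for u v
  proof -
    obtain Mh where "Mh \<le> C * M" "A4 Mh P" using P by (auto simp: inst_class_0_Lip_def)
    then have "\<bar>hreg P u - hreg P v\<bar> \<le> ereal (Mh * norm (u - v))" using uv by (simp add: A4_def)
    then have "\<bar>ereal (h_real P u) - ereal (h_real P v)\<bar> \<le> ereal (Mh * norm (u - v))"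
      using h_ereal[OF uv(1)] h_ereal[OF uv(2)] by metis
    then have "h_real P u - h_real P v \<le> Mh * norm (u - v)" by simp
    also have "\<dots> \<le> C * M * norm (u - v)" using \<open>Mh \<le> C * M\<close> by (simp add: mult_right_mono)
    finally show ?thesis .
  qed
  have gap: "bundle_run.t (f_real P) (h_real P) (fsub P) lam x xc xt B j \<le> (1 + C) / 4 * bundle_run.K M 0 lam"
    if run: "bundle_run (hdom P) (f_real P) (h_real P) (fsub P) M 0 z lam (\<epsilon> / 2) x xc xt B"
      and c: "xc j = x j" for xc xt B j
    by (rule bundle_run.start_gap_Lipschitz[OF run c _ \<open>0 \<le> C\<close> Lip]) auto
  note R = rpb_run_length[OF iter \<open>0 < lam\<close> \<open>0 < \<epsilon>\<close> _ z(2) gap]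
  have C0: "0 \<le> (1 + C) / 4" using pos by simp
  show "admissible_run \<epsilon> P (stop_at_first \<epsilon> P x)" by (rule R(1)[OF C0])
  have eq: "16 * (1 + (1 + C) / 4) * (M\<^sup>2 / ((1 / lam + 0) * \<epsilon>)) = 4 * (5 + C) * (lam * M\<^sup>2 / \<epsilon>)"
    using pos by (simp add: field_simps)
  show "\<exists>s::nat. real (length (stop_at_first \<epsilon> P x))
        \<le> (4 * (5 + C) * (lam * M\<^sup>2 / \<epsilon>) + 2) * (real s + 1) + 2 \<and>
      lam * \<epsilon> * s \<le> 4 * R0\<^sup>2" using R(2)[OF C0] unfolding eq by simp
qed

text \<open>
The product of the length \<open>W\<close> of a cycle and the number \<open>s + 1\<close> of cycles, the last of which may be
incomplete. The stepsize-dependent parts \<open>A\<close> and \<open>b\<close> combine to the complexity \<open>Q\<close>.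
\<close>

lemma cycles_times_length_bound:
  fixes A b Q w v C W s n :: real
  assumes "0 \<le> A" "0 \<le> b" "0 \<le> w" "0 \<le> v" "0 \<le> C" "0 \<le> s"
    and W: "W \<le> w * A" and s: "s + 1 \<le> v * b" and AB: "A * b \<le> Q" and Q: "2 \<le> C * Q"
    and n: "n \<le> W * (s + 1) + 2"
  shows "n \<le> (w * v + C) * Q"
proof -
  have "W * (s + 1) \<le> (w * A) * (s + 1)" using W \<open>0 \<le> s\<close> by (intro mult_right_mono) auto
  also have "\<dots> \<le> (w * A) * (v * b)" using s assms by (intro mult_left_mono) auto
  also have "\<dots> = (w * v) * (A * b)" by simp
  also have "\<dots> \<le> (w * v) * Q" using AB assms by (intro mult_left_mono) auto
  finally show ?thesis using n Q by (simp add: distrib_right)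
qed

text \<open>
Summing the geometric series gives \<open>q\<^sup>s \<le> 1 + 4 \<mu> R\<^sup>2 / \<epsilon>\<close> for \<open>q = 1 + \<lambda> \<mu>\<close>. Taking logarithms, with
\<open>ln q \<ge> 1 - 1 / q = \<mu> / (1 / \<lambda> + \<mu>)\<close>, gives the logarithmic count of serious iterations.
\<close>

lemma geometric_cycle_bound:
  fixes lam \<mu> \<epsilon> R :: real and s :: nat
  assumes "0 < lam" "0 < \<mu>" "0 < \<epsilon>"
    and sum: "lam * \<epsilon> * (\<Sum>i<s. (1 + lam * \<mu>) ^ i) \<le> 4 * R\<^sup>2"
  shows "s \<le> 2 * (1 + ln (\<mu> * R\<^sup>2 / \<epsilon> + 1)) * ((1 / lam + \<mu>) / \<mu>)"
proof -
  define q where "q = 1 + lam * \<mu>"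
  define X where "X = \<mu> * R\<^sup>2 / \<epsilon>"
  have q: "1 < q" using assms by (simp add: q_def)
  have X: "0 \<le> X" using assms by (simp add: X_def)
  have "(\<Sum>i<s. q ^ i) = (q ^ s - 1) / (lam * \<mu>)"
    using geometric_sum[of q s] q assms by (simp add: q_def)
  then have "\<epsilon> * (q ^ s - 1) / \<mu> \<le> 4 * R\<^sup>2" using sum assms by (simp add: q_def)
  then have "q ^ s \<le> 1 + 4 * X" using assms by (simp add: X_def field_simps)
  also have "\<dots> \<le> 4 * (X + 1)" by simp
  finally have "ln (q ^ s) \<le> ln (4 * (X + 1))" using q X by (intro ln_mono) auto
  also have "\<dots> = 2 * ln 2 + ln (X + 1)"
  proof -
    have "ln (4::real) = ln (2 ^ 2)" by simp
    also have "\<dots> = 2 * ln 2" by (simp only: ln_realpow)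
    finally show ?thesis using ln_mult[of 4 "X + 1"] X by simp
  qed
  also have "\<dots> \<le> 2 * (1 + ln (X + 1))"
    using ln_le_minus_one[of "2::real"] ln_ge_zero[of "X + 1"] X by argo
  finally have s: "s * ln q \<le> 2 * (1 + ln (X + 1))" using q by (simp add: ln_realpow)
  have "1 / lam + \<mu> = q / lam" using assms by (simp add: q_def field_simps)
  then have "\<mu> / (1 / lam + \<mu>) = (q - 1) / q" by (simp add: q_def mult.commute)
  also have "\<dots> = 1 - 1 / q" using q by (simp add: diff_divide_distrib)
  also have "\<dots> \<le> ln q" using ln_le_minus_one[of "1 / q"] q by (simp add: ln_div)
  finally have "s * (\<mu> / (1 / lam + \<mu>)) \<le> s * ln q" by (rule mult_left_mono) simp
  with s have "s * (\<mu> / (1 / lam + \<mu>)) \<le> 2 * (1 + ln (X + 1))" by linarith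
  moreover have "0 < \<mu> / (1 / lam + \<mu>)" using assms by (simp add: add_pos_pos)
  ultimately have "s \<le> 2 * (1 + ln (X + 1)) / (\<mu> / (1 / lam + \<mu>))"
    by (intro mult_imp_le_div_pos)
  then show ?thesis by (simp add: X_def)
qed


section \<open>Optimality\<close>

text \<open>
Rounding \<open>min (Q / 9) (T / 3)\<close> down gives an admissible dimension. The disjunction tells which of the two
upper bounds has to be matched; for \<open>\<mu> = 0\<close> the second one is void.
\<close>

lemma lower_complexity_bound_exists:
  fixes M \<mu> R0 \<epsilon> :: real
  assumes pos: "0 < M" "0 \<le> \<mu>" "0 < R0" "0 < \<epsilon>" and sub: "inst_class_u \<mu> M R0 \<subseteq> I"
  obtains M1 where "lower_complexity_bound I \<epsilon> M1"
    "M\<^sup>2 * R0\<^sup>2 / \<epsilon>\<^sup>2 \<le> 9 * M1 \<or> 0 < \<mu> \<and> M\<^sup>2 / (\<mu> * \<epsilon>) \<le> 9 * M1"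
proof -
  define Q where "Q = M\<^sup>2 * R0\<^sup>2 / \<epsilon>\<^sup>2"
  define T where "T = M\<^sup>2 / (\<mu> * \<epsilon>)"
  define B where "B = (if \<mu> = 0 then Q / 9 else min (Q / 9) (T / 3))"
  define n where "n = nat \<lfloor>B\<rfloor>"
  have B0: "0 \<le> B" using pos by (simp add: B_def Q_def T_def)
  have n: "real n \<le> B" "B \<le> real n + 1" using B0 by (auto simp: n_def)
  have "real n \<le> Q / 9" using n(1) by (auto simp: B_def split: if_splits)
  then have 1: "9 * \<epsilon>\<^sup>2 * n \<le> M\<^sup>2 * R0\<^sup>2" using pos by (simp add: Q_def field_simps)
  have 2: "3 * \<mu> * \<epsilon> * n \<le> M\<^sup>2"
  proof (cases "\<mu> = 0")
    case False
    then have "real n \<le> T / 3" using n(1) by (auto simp: B_def)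
    then show ?thesis using False pos by (simp add: T_def field_simps)
  qed simp
  have "Q \<le> 9 * (real n + 1) \<or> 0 < \<mu> \<and> T \<le> 9 * (real n + 1)"
    using n(2) pos by (auto simp: B_def min_def split: if_splits)
  then show thesis
    using that[of "real n + 1"] lower_complexity_bound_of_class[OF pos 1 2 sub] by (simp add: Q_def T_def)
qed

text \<open>
Any bound that holds for all runs of the method serves both as an upper complexity bound of the class
and as the bound for the given algorithm.
\<close>

lemma eps_optimal_of_run_bounds:
  assumes run: "\<And>P x. P \<in> I \<Longrightarrow> rpb_iterates P lam \<delta> x \<Longrightarrow>
      admissible_run \<epsilon> P (stop_at_first \<epsilon> P x) \<and> real (length (stop_at_first \<epsilon> P x)) \<le> M2"
    and low: "lower_complexity_bound I \<epsilon> M1" and M2: "0 \<le> M2" "M2 \<le> c * L * M1" and "1 \<le> c"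
    and alg: "alg \<in> rpb_algorithms I \<epsilon> lam \<delta>"
  shows "eps_optimal c L I \<epsilon> alg"
proof -
  have r: "admissible_run \<epsilon> P (alg P) \<and> real (length (alg P)) \<le> M2" if P: "P \<in> I" for P
  proof -
    have "\<exists>x. rpb_iterates P lam \<delta> x \<and> alg P = stop_at_first \<epsilon> P x"
      using alg P by (simp add: rpb_algorithms_def)
    then obtain x where "rpb_iterates P lam \<delta> x" "alg P = stop_at_first \<epsilon> P x" by blast
    then show ?thesis using run[OF P] by simp
  qed
  have "1 * M2 \<le> c * M2" using \<open>1 \<le> c\<close> M2(1) by (rule mult_right_mono)
  then have "alg_upper_bound I alg (c * M2)" using r by (fastforce simp: alg_upper_bound_def)
  moreover have "alg \<in> alg_class I \<epsilon>" using r by (simp add: alg_class_def)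
  moreover have "upper_complexity_bound I \<epsilon> M2"
    unfolding upper_complexity_bound_def
    by (rule bexI[OF _ \<open>alg \<in> alg_class I \<epsilon>\<close>]) (use r in \<open>simp add: alg_upper_bound_def\<close>)
  ultimately show ?thesis using low M2(2) unfolding eps_optimal_def by blast
qed

text \<open>
Here \<open>w A\<close> bounds the length of a cycle, \<open>A = M\<^sup>2 / (\<kappa> \<epsilon>)\<close>. Since \<open>\<kappa> \<le> (1 + C') M / R0\<close> and \<open>C M R0 \<ge> \<epsilon>\<close>, the
quantity \<open>A\<close> is bounded below, which absorbs the additive constants in the cycle length. Multiplying
with the linear count of cycles gives \<open>Q\<close>, by \<open>1 / \<kappa> \<le> \<lambda>\<close>; multiplying with the logarithmic count
\<open>L \<kappa> / \<mu>\<close> gives \<open>L T\<close>, in which \<open>\<kappa>\<close> cancels. The factor \<open>9\<close> comes from the lower bound.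
\<close>

lemma rpb_optimal_strongly_convex:
  fixes C C' \<epsilon> M R0 lam \<mu> :: real
  defines "w \<equiv> 16 * (3 + C') + 2 * C * (1 + C')"
  defines "c \<equiv> 9 * (1 + (w * (4 + C) + 2 * C\<^sup>2) + (w * 3 + 2 * C * C'))"
  assumes C: "0 < C" "0 < C'" and eps: "0 < \<epsilon>" and M0: "0 \<le> M" and R0: "0 < R0"
    and CMR: "1 \<le> C * M * R0 / \<epsilon>" and lam1: "R0 / M \<le> lam" and lam2: "lam \<le> C * R0\<^sup>2 / \<epsilon>"
    and mu0: "0 \<le> \<mu>" and mu1: "\<mu> \<le> C' * M / R0"
    and lower: "inst_class_u \<mu> M R0 \<subseteq> I" and upper: "I \<subseteq> inst_class \<mu> M R0"
  shows "rpb_eps_optimal c (1 + ln (\<mu> * R0\<^sup>2 / \<epsilon> + 1)) I \<epsilon> lam (\<epsilon> / 2)"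
proof -
  have M: "0 < M" using CMR M0 by (cases "M = 0") auto
  have "0 < R0 / M" using M R0 by simp
  then have lam: "0 < lam" using lam1 by linarith
  define L where "L = 1 + ln (\<mu> * R0\<^sup>2 / \<epsilon> + 1)"
  define \<kappa> where "\<kappa> = 1 / lam + \<mu>"
  define A where "A = M\<^sup>2 / (\<kappa> * \<epsilon>)"
  define Q where "Q = M\<^sup>2 * R0\<^sup>2 / \<epsilon>\<^sup>2"
  define T where "T = M\<^sup>2 / (\<mu> * \<epsilon>)"
  define c1 where "c1 = 1 + (w * (4 + C) + 2 * C\<^sup>2) + (w * 3 + 2 * C * C')"
  have w0: "0 \<le> w" using C by (simp add: w_def)
  have c1_ge: "w * (4 + C) + 2 * C\<^sup>2 \<le> c1" "w * 3 + 2 * C * C' \<le> c1" "1 \<le> c1"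
    using C w0 by (auto simp: c1_def)
  have L1: "1 \<le> L" using mu0 eps by (simp add: L_def)
  have kap: "0 < \<kappa>" "1 / lam \<le> \<kappa>" "\<mu> \<le> \<kappa>" using lam mu0 by (auto simp: \<kappa>_def add_pos_nonneg)
  have "1 / lam \<le> M / R0" using lam1 M R0 lam by (simp add: field_simps)
  then have kap_le: "\<kappa> \<le> (1 + C') * (M / R0)" using mu1 by (simp add: \<kappa>_def distrib_right add_divide_distrib)
  have A0: "0 \<le> A" using kap eps by (simp add: A_def)
  have Q0: "0 \<le> Q" by (simp add: Q_def)
  have A_large: "1 \<le> C * (1 + C') * A"
  proof -
    have "M * R0 / \<epsilon> * \<kappa> \<le> M * R0 / \<epsilon> * ((1 + C') * (M / R0))"
      using kap_le M R0 eps by (intro mult_left_mono) auto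
    also have "\<dots> = (1 + C') * (M\<^sup>2 / \<epsilon>)" using R0 by (simp add: power2_eq_square)
    finally have "M * R0 / \<epsilon> \<le> (1 + C') * (M\<^sup>2 / \<epsilon>) / \<kappa>" by (rule mult_imp_le_div_pos[OF kap(1)])
    also have "\<dots> = (1 + C') * A" by (simp add: A_def)
    finally have "C * (M * R0 / \<epsilon>) \<le> C * ((1 + C') * A)" using C by (intro mult_left_mono) auto
    then show ?thesis using CMR by (simp add: mult.assoc)
  qed
  have W: "16 * (3 + C') * A + 2 \<le> w * A" using A_large by (simp add: w_def algebra_simps)
  have Q_large: "2 \<le> 2 * C\<^sup>2 * Q"
  proof -
    have "1\<^sup>2 \<le> (C * M * R0 / \<epsilon>)\<^sup>2" using CMR by (intro power_mono) auto
    then show ?thesis by (simp add: Q_def power_mult_distrib power_divide)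
  qed
  have bounds: "admissible_run \<epsilon> P (stop_at_first \<epsilon> P x) \<and> real (length (stop_at_first \<epsilon> P x)) \<le> c1 * L * Q \<and>
      (0 < \<mu> \<longrightarrow> real (length (stop_at_first \<epsilon> P x)) \<le> c1 * L * T)"
    if P: "P \<in> I" and iter: "rpb_iterates P lam (\<epsilon> / 2) x" for P x
  proof -
    let ?n = "real (length (stop_at_first \<epsilon> P x))"
    have Pc: "P \<in> inst_class \<mu> M R0" using P upper by blast
    note R = rpb_length_large_stepsize[OF Pc M mu0 R0 eps lam less_imp_le[OF C(2)] lam1 mu1 iter]
    obtain s :: nat where n: "?n \<le> (16 * (3 + C') * A + 2) * (real s + 1) + 2"
      and s: "lam * \<epsilon> * (\<Sum>i<s. (1 + lam * \<mu>) ^ i) \<le> 4 * R0\<^sup>2"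
      using R(2) unfolding A_def \<kappa>_def by blast
    have "?n \<le> (w * (4 + C) + 2 * C\<^sup>2) * Q"
    proof (rule cycles_times_length_bound[OF A0 _ w0 _ _ _ W _ _ Q_large n])
      have "(\<Sum>i<s. 1) \<le> (\<Sum>i<s. (1 + lam * \<mu>) ^ i)"
        using lam mu0 by (intro sum_mono one_le_power) auto
      then have "lam * \<epsilon> * real s \<le> lam * \<epsilon> * (\<Sum>i<s. (1 + lam * \<mu>) ^ i)"
        using lam eps by (intro mult_left_mono) auto
      then have "lam * \<epsilon> * real s \<le> 4 * R0\<^sup>2" using s by linarith
      then have "real s \<le> 4 * (R0\<^sup>2 / (lam * \<epsilon>))" using lam eps by (simp add: field_simps)
      moreover have "1 \<le> C * (R0\<^sup>2 / (lam * \<epsilon>))" using lam2 lam eps by (simp add: field_simps)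
      ultimately show "real s + 1 \<le> (4 + C) * (R0\<^sup>2 / (lam * \<epsilon>))"
        unfolding distrib_right by linarith
      have "1 / \<kappa> \<le> lam" using kap lam by (simp add: field_simps)
      then have "1 / \<kappa> * (M\<^sup>2 * R0\<^sup>2 / (lam * \<epsilon>\<^sup>2)) \<le> lam * (M\<^sup>2 * R0\<^sup>2 / (lam * \<epsilon>\<^sup>2))"
        using lam by (intro mult_right_mono) auto
      then show "A * (R0\<^sup>2 / (lam * \<epsilon>)) \<le> Q"
        using lam by (simp add: A_def Q_def power2_eq_square mult_ac)
    qed (use lam eps C in auto)
    also have "\<dots> \<le> c1 * Q" using c1_ge Q0 by (intro mult_right_mono)
    also have "\<dots> \<le> c1 * L * Q"
      using mult_right_mono[OF L1, of "c1 * Q"] c1_ge Q0 by (simp add: mult_ac)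
    finally have nQ: "?n \<le> c1 * L * Q" .
    have nT: "?n \<le> c1 * L * T" if mu: "0 < \<mu>"
    proof -
      have T0: "0 \<le> T" using mu eps by (simp add: T_def)
      have LT: "T \<le> L * T" using mult_right_mono[OF L1 T0] by simp
      have "?n \<le> (w * 3 + 2 * C * C') * (L * T)"
      proof (rule cycles_times_length_bound[OF A0 _ w0 _ _ _ W _ _ _ n])
        have s2: "s \<le> 2 * L * (\<kappa> / \<mu>)"
          using geometric_cycle_bound[OF lam mu eps s] by (simp add: L_def \<kappa>_def)
        have "1 * 1 \<le> L * (\<kappa> / \<mu>)" using L1 kap mu by (intro mult_mono) auto
        with s2 show "real s + 1 \<le> 3 * (L * (\<kappa> / \<mu>))" by simp
        show "0 \<le> L * (\<kappa> / \<mu>)" using L1 kap mu by simp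
        show "A * (L * (\<kappa> / \<mu>)) \<le> L * T" using kap by (simp add: A_def T_def mult_ac)
        have "M * R0 / \<epsilon> \<le> C' * T"
          using mu1 mu M R0 eps by (simp add: T_def field_simps power2_eq_square)
        then have "C * (M * R0 / \<epsilon>) \<le> C * (C' * T)" using C by (intro mult_left_mono) auto
        moreover have "C * (C' * T) \<le> C * (C' * (L * T))" using LT C by (intro mult_left_mono) auto
        ultimately show "2 \<le> 2 * C * C' * (L * T)" using CMR by (simp add: mult.assoc)
      qed (use C in auto)
      also have "\<dots> \<le> c1 * (L * T)" using c1_ge T0 L1 by (intro mult_right_mono) auto
      finally show ?thesis by (simp add: mult.assoc)
    qed
    show ?thesis using R(1) nQ nT by blast
  qed
  obtain M1 where low: "lower_complexity_bound I \<epsilon> M1"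
    and M1: "Q \<le> 9 * M1 \<or> 0 < \<mu> \<and> T \<le> 9 * M1"
    using lower_complexity_bound_exists[OF M mu0 R0 eps lower] unfolding Q_def T_def by blast
  have c: "c = 9 * c1" by (simp add: c_def c1_def)
  obtain U where U: "0 \<le> U" "U \<le> 9 * M1"
    and run: "\<And>P x. P \<in> I \<Longrightarrow> rpb_iterates P lam (\<epsilon> / 2) x \<Longrightarrow>
      admissible_run \<epsilon> P (stop_at_first \<epsilon> P x) \<and> real (length (stop_at_first \<epsilon> P x)) \<le> c1 * L * U"
    using M1
  proof
    assume "Q \<le> 9 * M1"
    then show thesis using that[of Q] Q0 bounds by blast
  next
    assume "0 < \<mu> \<and> T \<le> 9 * M1"
    then show thesis using that[of T] bounds eps by (simp add: T_def)
  qed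
  have M2: "0 \<le> c1 * L * U" using c1_ge L1 U by simp
  have "c1 * L * U \<le> c1 * L * (9 * M1)" using U c1_ge L1 by (intro mult_left_mono) auto
  then have M2': "c1 * L * U \<le> c * L * M1" by (simp add: c)
  show ?thesis unfolding rpb_eps_optimal_def L_def[symmetric]
    using eps_optimal_of_run_bounds[OF run low M2 M2'] rpb_algorithms_nonempty[OF upper M mu0 R0 lam] c1_ge
    by (simp add: c)
qed

text \<open>
For \<open>\<mu> = 0\<close> the length of a cycle is of order \<open>A = \<lambda> M\<^sup>2 / \<epsilon>\<close> and the number of cycles of order
\<open>R0\<^sup>2 / (\<lambda> \<epsilon>)\<close>. The limits on \<open>\<lambda>\<close> say precisely that both quantities are bounded below by \<open>1 / C\<close>.
\<close>

lemma rpb_optimal_Lipschitz: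
  fixes C \<epsilon> M R0 lam :: real
  defines "w \<equiv> 4 * (5 + C) + 2 * C"
  defines "c \<equiv> 9 * (1 + (w * (4 + C) + 2 * C\<^sup>2))"
  assumes C: "0 < C" and eps: "0 < \<epsilon>" and M0: "0 \<le> M" and R0: "0 < R0"
    and CMR: "1 \<le> C * M * R0 / \<epsilon>" and lam1: "\<epsilon> / (C * M\<^sup>2) \<le> lam" and lam2: "lam \<le> C * R0\<^sup>2 / \<epsilon>"
    and lower: "inst_class_u 0 M R0 \<subseteq> I" and upper: "I \<subseteq> inst_class_0_Lip M R0 C"
  shows "rpb_eps_optimal c 1 I \<epsilon> lam (\<epsilon> / 2)"
proof -
  have M: "0 < M" using CMR M0 by (cases "M = 0") auto
  have "0 < \<epsilon> / (C * M\<^sup>2)" using M C eps by simp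
  then have lam: "0 < lam" using lam1 by linarith
  define A where "A = lam * M\<^sup>2 / \<epsilon>"
  define Q where "Q = M\<^sup>2 * R0\<^sup>2 / \<epsilon>\<^sup>2"
  define c1 where "c1 = 1 + (w * (4 + C) + 2 * C\<^sup>2)"
  have w0: "0 \<le> w" using C by (simp add: w_def)
  have c1_ge: "w * (4 + C) + 2 * C\<^sup>2 \<le> c1" "1 \<le> c1" using C w0 by (auto simp: c1_def)
  have A0: "0 \<le> A" using lam eps by (simp add: A_def)
  have Q0: "0 \<le> Q" by (simp add: Q_def)
  have "1 \<le> C * A" using lam1 C M eps by (simp add: A_def field_simps)
  then have W: "4 * (5 + C) * A + 2 \<le> w * A" by (simp add: w_def algebra_simps)
  have Q_large: "2 \<le> 2 * C\<^sup>2 * Q"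
  proof -
    have "1\<^sup>2 \<le> (C * M * R0 / \<epsilon>)\<^sup>2" using CMR by (intro power_mono) auto
    then show ?thesis by (simp add: Q_def power_mult_distrib power_divide)
  qed
  have run: "admissible_run \<epsilon> P (stop_at_first \<epsilon> P x) \<and> real (length (stop_at_first \<epsilon> P x)) \<le> c1 * Q"
    if P: "P \<in> I" and iter: "rpb_iterates P lam (\<epsilon> / 2) x" for P x
  proof -
    let ?n = "real (length (stop_at_first \<epsilon> P x))"
    have Pc: "P \<in> inst_class_0_Lip M R0 C" using P upper by blast
    note R = rpb_length_Lipschitz[OF Pc M R0 eps lam less_imp_le[OF C] iter]
    obtain s :: nat where n: "?n \<le> (4 * (5 + C) * A + 2) * (real s + 1) + 2"
      and s: "lam * \<epsilon> * real s \<le> 4 * R0\<^sup>2"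
      using R(2) unfolding A_def by blast
    have "?n \<le> (w * (4 + C) + 2 * C\<^sup>2) * Q"
    proof (rule cycles_times_length_bound[OF A0 _ w0 _ _ _ W _ _ Q_large n])
      have "real s \<le> 4 * (R0\<^sup>2 / (lam * \<epsilon>))" using s lam eps by (simp add: field_simps)
      moreover have "1 \<le> C * (R0\<^sup>2 / (lam * \<epsilon>))" using lam2 lam eps by (simp add: field_simps)
      ultimately show "real s + 1 \<le> (4 + C) * (R0\<^sup>2 / (lam * \<epsilon>))"
        unfolding distrib_right by linarith
      show "A * (R0\<^sup>2 / (lam * \<epsilon>)) \<le> Q" using lam by (simp add: A_def Q_def power2_eq_square)
    qed (use lam eps C in auto)
    also have "\<dots> \<le> c1 * Q" using c1_ge Q0 by (intro mult_right_mono)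
    finally show ?thesis using R(1) by blast
  qed
  obtain M1 where low: "lower_complexity_bound I \<epsilon> M1" and M1: "Q \<le> 9 * M1"
    using lower_complexity_bound_exists[OF M order_refl R0 eps lower] unfolding Q_def by blast
  have c: "c = 9 * c1" by (simp add: c_def c1_def)
  have "c1 * Q \<le> c1 * (9 * M1)" using M1 c1_ge by (intro mult_left_mono) auto
  then have M2: "c1 * Q \<le> c * 1 * M1" by (simp add: c)
  have M20: "0 \<le> c1 * Q" using c1_ge Q0 by simp
  have "I \<subseteq> inst_class 0 M R0" using upper by (auto simp: inst_class_0_Lip_def)
  then show ?thesis unfolding rpb_eps_optimal_def
    using eps_optimal_of_run_bounds[OF run low M20 M2] rpb_algorithms_nonempty[OF _ M order_refl R0 lam] c1_ge
    by (simp add: c)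
qed

theorem theorem7p3:
  fixes C :: real
  assumes "C > 0"
  shows "(\<forall>C'>0. \<exists>c>0. \<forall>\<epsilon> Mf R0 lam \<mu> :: real. \<forall>I :: problem set.
      \<epsilon> > 0 \<and> Mf \<ge> 0 \<and> R0 > 0 \<and> C * Mf * R0 / \<epsilon> \<ge> 1 \<and>
      R0 / Mf \<le> lam \<and> lam \<le> C * R0\<^sup>2 / \<epsilon> \<and>
      0 \<le> \<mu> \<and> \<mu> \<le> C' * Mf / R0 \<and>
      inst_class_u \<mu> Mf R0 \<subseteq> I \<and> I \<subseteq> inst_class \<mu> Mf R0 \<longrightarrow>
      rpb_eps_optimal c (1 + ln (\<mu> * R0\<^sup>2 / \<epsilon> + 1)) I \<epsilon> lam (\<epsilon> / 2)) \<and>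
    (\<exists>c>0. \<forall>\<epsilon> Mf R0 lam :: real. \<forall>I :: problem set.
      \<epsilon> > 0 \<and> Mf \<ge> 0 \<and> R0 > 0 \<and> C * Mf * R0 / \<epsilon> \<ge> 1 \<and>
      \<epsilon> / (C * Mf\<^sup>2) \<le> lam \<and> lam \<le> C * R0\<^sup>2 / \<epsilon> \<and>
      inst_class_u 0 Mf R0 \<subseteq> I \<and> I \<subseteq> inst_class_0_Lip Mf R0 C \<longrightarrow>
      rpb_eps_optimal c 1 I \<epsilon> lam (\<epsilon> / 2))"
proof (intro conjI allI impI)
  fix C' :: real
  assume "C' > 0"
  let ?w = "16 * (3 + C') + 2 * C * (1 + C')"
  let ?c = "9 * (1 + (?w * (4 + C) + 2 * C\<^sup>2) + (?w * 3 + 2 * C * C'))"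
  have "0 < ?c" using \<open>C > 0\<close> \<open>C' > 0\<close> by (intro mult_pos_pos add_pos_pos) auto
  then show "\<exists>c>0. \<forall>\<epsilon> Mf R0 lam \<mu> :: real. \<forall>I :: problem set.
      \<epsilon> > 0 \<and> Mf \<ge> 0 \<and> R0 > 0 \<and> C * Mf * R0 / \<epsilon> \<ge> 1 \<and>
      R0 / Mf \<le> lam \<and> lam \<le> C * R0\<^sup>2 / \<epsilon> \<and>
      0 \<le> \<mu> \<and> \<mu> \<le> C' * Mf / R0 \<and>
      inst_class_u \<mu> Mf R0 \<subseteq> I \<and> I \<subseteq> inst_class \<mu> Mf R0 \<longrightarrow>
      rpb_eps_optimal c (1 + ln (\<mu> * R0\<^sup>2 / \<epsilon> + 1)) I \<epsilon> lam (\<epsilon> / 2)"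
    using rpb_optimal_strongly_convex[OF \<open>C > 0\<close> \<open>C' > 0\<close>] by (intro exI[of _ ?c]) blast
next
  let ?w = "4 * (5 + C) + 2 * C"
  let ?c = "9 * (1 + (?w * (4 + C) + 2 * C\<^sup>2))"
  have "0 < ?c" using \<open>C > 0\<close> by (intro mult_pos_pos add_pos_pos) auto
  then show "\<exists>c>0. \<forall>\<epsilon> Mf R0 lam :: real. \<forall>I :: problem set.
      \<epsilon> > 0 \<and> Mf \<ge> 0 \<and> R0 > 0 \<and> C * Mf * R0 / \<epsilon> \<ge> 1 \<and>
      \<epsilon> / (C * Mf\<^sup>2) \<le> lam \<and> lam \<le> C * R0\<^sup>2 / \<epsilon> \<and>
      inst_class_u 0 Mf R0 \<subseteq> I \<and> I \<subseteq> inst_class_0_Lip Mf R0 C \<longrightarrow>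
      rpb_eps_optimal c 1 I \<epsilon> lam (\<epsilon> / 2)"
    using rpb_optimal_Lipschitz[OF \<open>C > 0\<close>] by (intro exI[of _ ?c]) blast
qed

end
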